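(* Let $G$ be a countable discrete group and $(H_n)_{n\in\mathbb{N}}$ a decreasing sequence of normal finite-index subgroups, $H_n\supset H_{n+1}$, with $\bigcap_{n\in\mathbb{N}}H_n=\{e\}$. Put $G_n=G/H_n$ for $n\in\mathbb{N}$, $G_\infty=G$, and let $\mathcal{G}=\bigsqcup_{n\in\overline{\mathbb{N}}}\{n\}\times G_n$ be the associated Higson–Lafforgue–Skandalis groupoid over $\overline{\mathbb{N}}=\mathbb{N}\cup\{\infty\}$. If there is a length function $l$ on $\mathcal{G}$ such that the rapid decay property holds uniformly in $n\in\overline{\mathbb{N}}$ for the groups $G_n$, i.e. there are constants $C,q>0$ with $\|\mathrm{ev}_n(a)\|_{C_r^*(G_n)}\le C\|\mathrm{ev}_n(a)\|_{2,q}$ for all $a\in C_c(\mathcal{G})$ and $n\in\overline{\mathbb{N}}$, where $\|\cdot\|_{2,q}$ on $C_c(G_n)$ is formed with the length function $l|_{G_n}$, then $\mathcal{G}$ has the rapid decay property and: (i) $C_r^*(\mathcal{G})$ is a continuous field of $C^*$-algebras over $\overline{\mathbb{N}}$. (ii) If there is for some $a=a^*\in C_r^*(G)$ a section $\hat a\in C_r^*(\mathcal{G})$ with $\mathrm{ev}_\infty(\hat a)=a$, then $\lim_{n\to\infty}\sigma(\mathrm{ev}_n(\hat a))=\sigma(a)$ in the Hausdorff topology.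
   Context: $\overline{\mathbb{N}}$ is the one-point compactification of $\mathbb{N}$. $\mathcal{G}$ carries fiberwise group operations and the quotient topology from $\overline{\mathbb{N}}\times G$ under the relation $(n,g)\sim(m,\tilde g)\iff n=m$ and $gH_n=\tilde gH_m$, where $H_\infty=\{e\}$. It is a locally compact Hausdorff étale groupoid with unit space $\overline{\mathbb{N}}$, and $p:(n,g)\mapsto n$ is a continuous open surjection with $p=p\circ s=p\circ r$ ($s,r$ the source and range maps), whose fiber over $n$ is the group $G_n$. For a locally compact second-countable Hausdorff étale groupoid $\mathcal{G}$, with $\mathcal{G}_u=s^{-1}(\{u\})$, $\mathcal{G}^u=r^{-1}(\{u\})$ for units $u$: $C_c(\mathcal{G})$ is a $*$-algebra with $(f_1*f_2)(\gamma)=\sum_{\eta\in\mathcal{G}_{s(\gamma)}}f_1(\gamma\eta^{-1})f_2(\eta)$, $f^*(\gamma)=\overline{f(\gamma^{-1})}$; it is represented on $\ell^2(\mathcal{G}_u)$ by $(\pi_u(f)\xi)(\gamma)=\sum_{\eta\in\mathcal{G}_u}f(\gamma\eta^{-1})\xi(\eta)$; $C_r^*(\mathcal{G})$ is the completion in the norm $\|f\|=\sup_{u\in\mathcal{G}^{(0)}}\|\pi_u(f)\|$ (the reduced group $C^*$-algebra when $\mathcal{G}$ is a discrete group). $\mathrm{ev}_n:C_r^*(\mathcal{G})\to C_r^*(G_n)$ is the continuous extension of the restriction map $C_c(\mathcal{G})\to C_c(G_n)$. A length function is a continuous function $l:\mathcal{G}\to[0,\infty)$ with $l(\gamma\gamma')\le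 l(\gamma)+l(\gamma')$ for composable $\gamma,\gamma'$, $l(\gamma)=l(\gamma^{-1})$, and $l(u)=0$ for all units $u$. For $f\in C_c(\mathcal{G})$, $q\ge0$: $\|f\|_{2,q}$ is the maximum of $\sup_{u}\big(\sum_{\gamma\in\mathcal{G}_u}|f(\gamma)|^2(1+l(\gamma))^{2q}\big)^{1/2}$ and $\sup_{u}\big(\sum_{\gamma\in\mathcal{G}^u}|f(\gamma)|^2(1+l(\gamma))^{2q}\big)^{1/2}$, suprema over $u\in\mathcal{G}^{(0)}$. $\mathcal{G}$ has the rapid decay property (with respect to $l$) if there are $C>0$, $q\ge0$ with $\|f\|_{C_r^*(\mathcal{G})}\le C\|f\|_{2,q}$ for all $f\in C_c(\mathcal{G})$. A continuous field of $C^*$-algebras over a locally compact Hausdorff space $T$ is a triple $(\mathcal{A},\{\mathcal{A}_t\}_{t\in T},\{\mathrm{ev}_t\}_{t\in T})$ of $C^*$-algebras and surjective $*$-homomorphisms $\mathrm{ev}_t:\mathcal{A}\to\mathcal{A}_t$ such that there is an action of $C_0(T)$ on $\mathcal{A}$ with $\mathrm{ev}_t(g\cdot a)=g(t)\mathrm{ev}_t(a)$; $\|a\|=\sup_t\|\mathrm{ev}_t(a)\|$; and $t\mapsto\|\mathrm{ev}_t(a)\|$ is in $C_0(T)$, for all $a\in\mathcal{A}$, $g\in C_0(T)$, $t\in T$. Here $\mathcal{A}=C_r^*(\mathcal{G})$, $T=\overline{\mathbb{N}}$, $\mathcal{A}_n=C_r^*(G_n)$, with the maps $\mathrm{ev}_n$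 above and the action $(g\cdot f)(\gamma)=g(p(\gamma))f(\gamma)$. $\sigma$ denotes the spectrum; the Hausdorff topology is the topology of the Hausdorff metric on compact sets. *)

theory Defs
  imports "HOL-Analysis.Analysis" "HOL-Algebra.Algebraic_Closure_Type"
begin

section \<open>\<open>C\<^sup>*\<close>-algebras\<close>

text \<open>The inherited field \<open>one\<close> is meaningful only for unital algebras; no axiom of \<open>cstar_algebra\<close>
  mentions it.\<close>

record 'b star_alg = "(complex, 'b) module" +
  star :: "'b \<Rightarrow> 'b"
  nrm :: "'b \<Rightarrow> real"

definition cauchy_seqs :: "('b, 'm) star_alg_scheme \<Rightarrow> (nat \<Rightarrow> 'b) set" where
  "cauchy_seqs A = {x. (\<forall>k. x k \<in> carrier A) \<and>
     (\<forall>e>0. \<exists>N. \<forall>i\<ge>N. \<forall>j\<ge>N. nrm A (x i \<ominus>\<^bsub>A\<^esub> x j) < e)}"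

locale cstar_algebra =
  fixes A :: "('b, 'm) star_alg_scheme" (structure)
  assumes vector_space: "Module.module (ring_of_type_algebra :: complex ring) A"
    and mult_closed: "\<lbrakk>a \<in> carrier A; b \<in> carrier A\<rbrakk> \<Longrightarrow> a \<otimes> b \<in> carrier A"
    and mult_assoc: "\<lbrakk>a \<in> carrier A; b \<in> carrier A; c \<in> carrier A\<rbrakk>
      \<Longrightarrow> (a \<otimes> b) \<otimes> c = a \<otimes> (b \<otimes> c)"
    and distr_l: "\<lbrakk>a \<in> carrier A; b \<in> carrier A; c \<in> carrier A\<rbrakk>
      \<Longrightarrow> (a \<oplus> b) \<otimes> c = a \<otimes> c \<oplus> b \<otimes> c"
    and distr_r: "\<lbrakk>a \<in> carrier A; b \<in> carrier A; c \<in> carrier A\<rbrakk>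
      \<Longrightarrow> c \<otimes> (a \<oplus> b) = c \<otimes> a \<oplus> c \<otimes> b"
    and smult_mult_l: "\<lbrakk>a \<in> carrier A; b \<in> carrier A\<rbrakk> \<Longrightarrow> (z \<odot> a) \<otimes> b = z \<odot> (a \<otimes> b)"
    and smult_mult_r: "\<lbrakk>a \<in> carrier A; b \<in> carrier A\<rbrakk> \<Longrightarrow> a \<otimes> (z \<odot> b) = z \<odot> (a \<otimes> b)"
    and star_closed: "a \<in> carrier A \<Longrightarrow> star A a \<in> carrier A"
    and star_star: "a \<in> carrier A \<Longrightarrow> star A (star A a) = a"
    and star_add: "\<lbrakk>a \<in> carrier A; b \<in> carrier A\<rbrakk> \<Longrightarrow> star A (a \<oplus> b) = star A a \<oplus> star A b"
    and star_smult: "a \<in> carrier A \<Longrightarrow> star A (z \<odot> a) = cnj z \<odot> star A a"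
    and star_mult: "\<lbrakk>a \<in> carrier A; b \<in> carrier A\<rbrakk> \<Longrightarrow> star A (a \<otimes> b) = star A b \<otimes> star A a"
    and nrm_nonneg: "a \<in> carrier A \<Longrightarrow> nrm A a \<ge> 0"
    and nrm_eq_zero_iff: "a \<in> carrier A \<Longrightarrow> nrm A a = 0 \<longleftrightarrow> a = \<zero>"
    and nrm_smult: "a \<in> carrier A \<Longrightarrow> nrm A (z \<odot> a) = cmod z * nrm A a"
    and nrm_add: "\<lbrakk>a \<in> carrier A; b \<in> carrier A\<rbrakk> \<Longrightarrow> nrm A (a \<oplus> b) \<le> nrm A a + nrm A b"
    and nrm_mult: "\<lbrakk>a \<in> carrier A; b \<in> carrier A\<rbrakk> \<Longrightarrow> nrm A (a \<otimes> b) \<le> nrm A a * nrm A b"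
    and cstar_identity: "a \<in> carrier A \<Longrightarrow> nrm A (star A a \<otimes> a) = (nrm A a)\<^sup>2"
    and complete: "x \<in> cauchy_seqs A \<Longrightarrow> \<exists>a\<in>carrier A. (\<lambda>k. nrm A (x k \<ominus> a)) \<longlonglongrightarrow> 0"

definition star_hom :: "('b, 'm) star_alg_scheme \<Rightarrow> ('c, 'n) star_alg_scheme \<Rightarrow> ('b \<Rightarrow> 'c) \<Rightarrow> bool" where
  "star_hom A B \<phi> \<longleftrightarrow> \<phi> \<in> carrier A \<rightarrow> carrier B \<and>
     (\<forall>a\<in>carrier A. \<forall>b\<in>carrier A. \<phi> (a \<oplus>\<^bsub>A\<^esub> b) = \<phi> a \<oplus>\<^bsub>B\<^esub> \<phi> b \<and> \<phi> (a \<otimes>\<^bsub>A\<^esub> b) = \<phi> a \<otimes>\<^bsub>B\<^esub> \<phi> b) \<and>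
     (\<forall>a\<in>carrier A. \<forall>z. \<phi> (z \<odot>\<^bsub>A\<^esub> a) = z \<odot>\<^bsub>B\<^esub> \<phi> a) \<and>
     (\<forall>a\<in>carrier A. \<phi> (star A a) = star B (\<phi> a))"

text \<open>The spectrum in a unital algebra.\<close>

definition spectrum :: "('b, 'm) star_alg_scheme \<Rightarrow> 'b \<Rightarrow> complex set" where
  "spectrum A a = {z. z \<odot>\<^bsub>A\<^esub> \<one>\<^bsub>A\<^esub> \<ominus>\<^bsub>A\<^esub> a \<notin> Units A}"

text \<open>The completion of a normed \<open>*\<close>-algebra: Cauchy sequences modulo null sequences.\<close>

definition cauchy_rel :: "('b, 'm) star_alg_scheme \<Rightarrow> ((nat \<Rightarrow> 'b) \<times> (nat \<Rightarrow> 'b)) set" where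
  "cauchy_rel A = {(x, y). x \<in> cauchy_seqs A \<and> y \<in> cauchy_seqs A \<and>
     (\<lambda>k. nrm A (x k \<ominus>\<^bsub>A\<^esub> y k)) \<longlonglongrightarrow> 0}"

definition completion :: "('b, 'm) star_alg_scheme \<Rightarrow> (nat \<Rightarrow> 'b) set star_alg" where
  "completion A = \<lparr>
     carrier = cauchy_seqs A // cauchy_rel A,
     monoid.mult = (\<lambda>a b. \<Union>x\<in>a. \<Union>y\<in>b. cauchy_rel A `` {\<lambda>k. x k \<otimes>\<^bsub>A\<^esub> y k}),
     monoid.one = cauchy_rel A `` {\<lambda>k. \<one>\<^bsub>A\<^esub>},
     ring.zero = cauchy_rel A `` {\<lambda>k. \<zero>\<^bsub>A\<^esub>},
     ring.add = (\<lambda>a b. \<Union>x\<in>a. \<Union>y\<in>b. cauchy_rel A `` {\<lambda>k. x k \<oplus>\<^bsub>A\<^esub> y k}),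
     module.smult = (\<lambda>z a. \<Union>x\<in>a. cauchy_rel A `` {\<lambda>k. z \<odot>\<^bsub>A\<^esub> x k}),
     star = (\<lambda>a. \<Union>x\<in>a. cauchy_rel A `` {\<lambda>k. star A (x k)}),
     nrm = (\<lambda>a. THE r. \<exists>x\<in>a. (\<lambda>k. nrm A (x k)) \<longlonglongrightarrow> r) \<rparr>"

text \<open>The continuous extension to completions of a bounded linear map \<open>\<phi>\<close> into \<open>B\<close>.\<close>

definition completion_map :: "('c, 'm) star_alg_scheme \<Rightarrow> ('b \<Rightarrow> 'c) \<Rightarrow> (nat \<Rightarrow> 'b) set \<Rightarrow> (nat \<Rightarrow> 'c) set" where
  "completion_map B \<phi> a = (\<Union>x\<in>a. cauchy_rel B `` {\<lambda>k. \<phi> (x k)})"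

section \<open>Continuous fields of \<open>C\<^sup>*\<close>-algebras\<close>

definition C0 :: "'t topology \<Rightarrow> ('t \<Rightarrow> complex) set" where
  "C0 T = {g. continuous_map T euclidean g \<and>
     (\<forall>e>0. \<exists>K. compactin T K \<and> (\<forall>t\<in>topspace T - K. cmod (g t) < e))}"

text \<open>An action of \<open>C\<^sub>0(T)\<close> is by central multipliers, compatibly with the \<open>*\<close>-algebra structures.\<close>

definition C0_action :: "'t topology \<Rightarrow> ('b, 'm) star_alg_scheme \<Rightarrow> (('t \<Rightarrow> complex) \<Rightarrow> 'b \<Rightarrow> 'b) \<Rightarrow> bool" where
  "C0_action T A act \<longleftrightarrow> (\<forall>g\<in>C0 T. \<forall>h\<in>C0 T. \<forall>z. \<forall>a\<in>carrier A. \<forall>b\<in>carrier A.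
     act g a \<in> carrier A \<and>
     act g (a \<oplus>\<^bsub>A\<^esub> b) = act g a \<oplus>\<^bsub>A\<^esub> act g b \<and>
     act g (z \<odot>\<^bsub>A\<^esub> a) = z \<odot>\<^bsub>A\<^esub> act g a \<and>
     act g (a \<otimes>\<^bsub>A\<^esub> b) = act g a \<otimes>\<^bsub>A\<^esub> b \<and>
     act g (a \<otimes>\<^bsub>A\<^esub> b) = a \<otimes>\<^bsub>A\<^esub> act g b \<and>
     act (\<lambda>t. g t + h t) a = act g a \<oplus>\<^bsub>A\<^esub> act h a \<and>
     act (\<lambda>t. z * g t) a = z \<odot>\<^bsub>A\<^esub> act g a \<and>
     act (\<lambda>t. g t * h t) a = act g (act h a) \<and>
     act (\<lambda>t. cnj (g t)) (star A a) = star A (act g a))"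

definition continuous_field :: "'t topology \<Rightarrow> ('b, 'm) star_alg_scheme \<Rightarrow> ('t \<Rightarrow> ('c, 'n) star_alg_scheme) \<Rightarrow>
    ('t \<Rightarrow> 'b \<Rightarrow> 'c) \<Rightarrow> (('t \<Rightarrow> complex) \<Rightarrow> 'b \<Rightarrow> 'b) \<Rightarrow> bool" where
  "continuous_field T A At ev act \<longleftrightarrow>
     locally_compact_space T \<and> Hausdorff_space T \<and> cstar_algebra A \<and>
     (\<forall>t\<in>topspace T. cstar_algebra (At t) \<and> star_hom A (At t) (ev t) \<and>
        ev t ` carrier A = carrier (At t)) \<and>
     C0_action T A act \<and>
     (\<forall>g\<in>C0 T. \<forall>a\<in>carrier A. \<forall>t\<in>topspace T. ev t (act g a) = g t \<odot>\<^bsub>At t\<^esub> ev t a) \<and>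
     (\<forall>a\<in>carrier A. nrm A a = (SUP t\<in>topspace T. nrm (At t) (ev t a))) \<and>
     (\<forall>a\<in>carrier A. (\<lambda>t. complex_of_real (nrm (At t) (ev t a))) \<in> C0 T)"

section \<open>Groupoids and their reduced \<open>C\<^sup>*\<close>-algebras\<close>

text \<open>The arrows are the points of \<open>arr_top\<close>, and the units are the arrows of the form \<open>src \<gamma>\<close>.
  The constructions below are meant for locally compact Hausdorff etale groupoids; there the infinite
  sums over source and range fibres have finitely many nonzero terms for compactly supported functions,
  and the suprema are finite.\<close>

record 'g groupoid =
  arr_top :: "'g topology"
  src :: "'g \<Rightarrow> 'g"
  rng :: "'g \<Rightarrow> 'g"
  comp :: "'g \<Rightarrow> 'g \<Rightarrow> 'g"
  ginv :: "'g \<Rightarrow> 'g"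

definition arrows :: "'g groupoid \<Rightarrow> 'g set" where
  "arrows \<G> = topspace (arr_top \<G>)"

definition gunits :: "'g groupoid \<Rightarrow> 'g set" where
  "gunits \<G> = src \<G> ` arrows \<G>"

definition src_fibre :: "'g groupoid \<Rightarrow> 'g \<Rightarrow> 'g set" where
  "src_fibre \<G> u = {\<gamma> \<in> arrows \<G>. src \<G> \<gamma> = u}"

definition rng_fibre :: "'g groupoid \<Rightarrow> 'g \<Rightarrow> 'g set" where
  "rng_fibre \<G> u = {\<gamma> \<in> arrows \<G>. rng \<G> \<gamma> = u}"

text \<open>Functions on the arrows are represented by functions vanishing outside the arrows.\<close>

definition Cc :: "'g groupoid \<Rightarrow> ('g \<Rightarrow> complex) set" where
  "Cc \<G> = {f. continuous_map (arr_top \<G>) euclidean f \<and> (\<forall>\<gamma>. \<gamma> \<notin> arrows \<G> \<longrightarrow> f \<gamma> = 0) \<and>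
     compactin (arr_top \<G>) (arr_top \<G> closure_of {\<gamma> \<in> arrows \<G>. f \<gamma> \<noteq> 0})}"

definition conv :: "'g groupoid \<Rightarrow> ('g \<Rightarrow> complex) \<Rightarrow> ('g \<Rightarrow> complex) \<Rightarrow> 'g \<Rightarrow> complex" where
  "conv \<G> f1 f2 \<gamma> = (if \<gamma> \<in> arrows \<G>
     then \<Sum>\<^sub>\<infinity>\<eta>\<in>src_fibre \<G> (src \<G> \<gamma>). f1 (comp \<G> \<gamma> (ginv \<G> \<eta>)) * f2 \<eta> else 0)"

definition gstar :: "'g groupoid \<Rightarrow> ('g \<Rightarrow> complex) \<Rightarrow> 'g \<Rightarrow> complex" where
  "gstar \<G> f \<gamma> = (if \<gamma> \<in> arrows \<G> then cnj (f (ginv \<G> \<gamma>)) else 0)"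

definition l2_set :: "'g set \<Rightarrow> ('g \<Rightarrow> complex) set" where
  "l2_set S = {\<xi>. (\<lambda>\<gamma>. (cmod (\<xi> \<gamma>))\<^sup>2) summable_on S}"

definition l2_norm :: "'g set \<Rightarrow> ('g \<Rightarrow> complex) \<Rightarrow> real" where
  "l2_norm S \<xi> = sqrt (\<Sum>\<^sub>\<infinity>\<gamma>\<in>S. (cmod (\<xi> \<gamma>))\<^sup>2)"

definition l2_opnorm :: "'g set \<Rightarrow> (('g \<Rightarrow> complex) \<Rightarrow> ('g \<Rightarrow> complex)) \<Rightarrow> real" where
  "l2_opnorm S T = (SUP \<xi>\<in>{\<xi> \<in> l2_set S. l2_norm S \<xi> \<le> 1}. l2_norm S (T \<xi>))"

definition regular_rep :: "'g groupoid \<Rightarrow> 'g \<Rightarrow> ('g \<Rightarrow> complex) \<Rightarrow> ('g \<Rightarrow> complex) \<Rightarrow> 'g \<Rightarrow> complex" where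
  "regular_rep \<G> u f \<xi> \<gamma> = (\<Sum>\<^sub>\<infinity>\<eta>\<in>src_fibre \<G> u. f (comp \<G> \<gamma> (ginv \<G> \<eta>)) * \<xi> \<eta>)"

definition reduced_norm :: "'g groupoid \<Rightarrow> ('g \<Rightarrow> complex) \<Rightarrow> real" where
  "reduced_norm \<G> f = (SUP u\<in>gunits \<G>. l2_opnorm (src_fibre \<G> u) (regular_rep \<G> u f))"

text \<open>The field \<open>one\<close> of \<open>Cc_alg \<G>\<close> is a unit of the algebra if the unit space is compact.\<close>

definition Cc_alg :: "'g groupoid \<Rightarrow> ('g \<Rightarrow> complex) star_alg" where
  "Cc_alg \<G> = \<lparr>
     carrier = Cc \<G>,
     monoid.mult = conv \<G>,
     monoid.one = (\<lambda>\<gamma>. if \<gamma> \<in> gunits \<G> then 1 else 0),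
     ring.zero = (\<lambda>\<gamma>. 0),
     ring.add = (\<lambda>f1 f2 \<gamma>. f1 \<gamma> + f2 \<gamma>),
     module.smult = (\<lambda>z f \<gamma>. z * f \<gamma>),
     star = gstar \<G>,
     nrm = reduced_norm \<G> \<rparr>"

definition Cr :: "'g groupoid \<Rightarrow> (nat \<Rightarrow> 'g \<Rightarrow> complex) set star_alg" where
  "Cr \<G> = completion (Cc_alg \<G>)"

definition length_function :: "'g groupoid \<Rightarrow> ('g \<Rightarrow> real) \<Rightarrow> bool" where
  "length_function \<G> l \<longleftrightarrow> continuous_map (arr_top \<G>) euclidean l \<and>
     (\<forall>\<gamma>\<in>arrows \<G>. l \<gamma> \<ge> 0) \<and>
     (\<forall>\<gamma>\<in>arrows \<G>. \<forall>\<gamma>'\<in>arrows \<G>. src \<G> \<gamma> = rng \<G> \<gamma>' \<longrightarrow> l (comp \<G> \<gamma> \<gamma>') \<le> l \<gamma> + l \<gamma>') \<and>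
     (\<forall>\<gamma>\<in>arrows \<G>. l (ginv \<G> \<gamma>) = l \<gamma>) \<and>
     (\<forall>u\<in>gunits \<G>. l u = 0)"

definition norm2 :: "'g groupoid \<Rightarrow> ('g \<Rightarrow> real) \<Rightarrow> real \<Rightarrow> ('g \<Rightarrow> complex) \<Rightarrow> real" where
  "norm2 \<G> l q f = max
     (SUP u\<in>gunits \<G>. sqrt (\<Sum>\<^sub>\<infinity>\<gamma>\<in>src_fibre \<G> u. (cmod (f \<gamma>))\<^sup>2 * (1 + l \<gamma>) powr (2 * q)))
     (SUP u\<in>gunits \<G>. sqrt (\<Sum>\<^sub>\<infinity>\<gamma>\<in>rng_fibre \<G> u. (cmod (f \<gamma>))\<^sup>2 * (1 + l \<gamma>) powr (2 * q)))"

definition rapid_decay :: "'g groupoid \<Rightarrow> ('g \<Rightarrow> real) \<Rightarrow> bool" where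
  "rapid_decay \<G> l \<longleftrightarrow> (\<exists>C>0. \<exists>q\<ge>0. \<forall>f\<in>Cc \<G>. reduced_norm \<G> f \<le> C * norm2 \<G> l q f)"

text \<open>A discrete group as a groupoid with one unit.\<close>

definition group_groupoid :: "('g, 'm) monoid_scheme \<Rightarrow> 'g groupoid" where
  "group_groupoid K = \<lparr>
     arr_top = discrete_topology (carrier K),
     src = (\<lambda>x. \<one>\<^bsub>K\<^esub>),
     rng = (\<lambda>x. \<one>\<^bsub>K\<^esub>),
     comp = (\<lambda>x y. x \<otimes>\<^bsub>K\<^esub> y),
     ginv = (\<lambda>x. inv\<^bsub>K\<^esub> x) \<rparr>"

section \<open>The Higson--Lafforgue--Skandalis groupoid\<close>

definition quotient_top :: "'x topology \<Rightarrow> ('x \<Rightarrow> 'y) \<Rightarrow> 'y topology" where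
  "quotient_top W q = topology (\<lambda>U. U \<subseteq> q ` topspace W \<and> openin W {x \<in> topspace W. q x \<in> U})"

lemma openin_quotient_top:
  "openin (quotient_top W q) U \<longleftrightarrow> U \<subseteq> q ` topspace W \<and> openin W {x \<in> topspace W. q x \<in> U}"
proof -
  have "istopology (\<lambda>U. U \<subseteq> q ` topspace W \<and> openin W {x \<in> topspace W. q x \<in> U})"
    unfolding istopology_def
  proof (intro conjI allI impI)
    fix S T
    assume "S \<subseteq> q ` topspace W \<and> openin W {x \<in> topspace W. q x \<in> S}"
      and "T \<subseteq> q ` topspace W \<and> openin W {x \<in> topspace W. q x \<in> T}"
    then show "S \<inter> T \<subseteq> q ` topspace W" and "openin W {x \<in> topspace W. q x \<in> S \<inter> T}"
      using openin_Int[of W "{x \<in> topspace W. q x \<in> S}" "{x \<in> topspace W. q x \<in> T}"]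
      by (auto simp: Collect_conj_eq[symmetric] Int_def cong: conj_cong elim: back_subst[of "openin W"])
  next
    fix \<K>
    assume *: "\<forall>K\<in>\<K>. K \<subseteq> q ` topspace W \<and> openin W {x \<in> topspace W. q x \<in> K}"
    then show "\<Union>\<K> \<subseteq> q ` topspace W"
      by blast
    have "openin W (\<Union>K\<in>\<K>. {x \<in> topspace W. q x \<in> K})"
      using * by blast
    also have "(\<Union>K\<in>\<K>. {x \<in> topspace W. q x \<in> K}) = {x \<in> topspace W. q x \<in> \<Union>\<K>}"
      by blast
    finally show "openin W {x \<in> topspace W. q x \<in> \<Union>\<K>}" .
  qed
  then show ?thesis
    unfolding quotient_top_def by (simp add: topology_inverse')
qed

lemma topspace_quotient_top: "topspace (quotient_top W q) = q ` topspace W"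
proof
  show "topspace (quotient_top W q) \<subseteq> q ` topspace W"
    unfolding topspace_def[of "quotient_top W q"] openin_quotient_top by blast
  have "{x \<in> topspace W. q x \<in> q ` topspace W} = topspace W"
    by blast
  then have "openin (quotient_top W q) (q ` topspace W)"
    by (simp add: openin_quotient_top)
  then show "q ` topspace W \<subseteq> topspace (quotient_top W q)"
    by (rule openin_subset)
qed

lemma quotient_map_quotient_top: "quotient_map W (quotient_top W q) q"
  by (auto simp: quotient_map_def openin_quotient_top topspace_quotient_top)

text \<open>The one-point compactification of the naturals is \<^typ>\<open>enat\<close> with its order topology.
  In \<open>G Mod N\<close> the elements are the right cosets \<open>N #>\<^bsub>G\<^esub> g\<close>, which for normal \<open>N\<close> coincide with the
  left ones. The fibre at infinity is \<open>G Mod {\<one>\<^bsub>G\<^esub>}\<close>, that is, \<open>G\<close> with \<open>g\<close> written as \<open>{g}\<close>.\<close>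

definition HLS_subgroup :: "('a, 'm) monoid_scheme \<Rightarrow> (nat \<Rightarrow> 'a set) \<Rightarrow> enat \<Rightarrow> 'a set" where
  "HLS_subgroup G H n = (case n of enat k \<Rightarrow> H k | \<infinity> \<Rightarrow> {\<one>\<^bsub>G\<^esub>})"

definition HLS_fibre :: "('a, 'm) monoid_scheme \<Rightarrow> (nat \<Rightarrow> 'a set) \<Rightarrow> enat \<Rightarrow> 'a set monoid" where
  "HLS_fibre G H n = G Mod HLS_subgroup G H n"

definition HLS :: "('a, 'm) monoid_scheme \<Rightarrow> (nat \<Rightarrow> 'a set) \<Rightarrow> (enat \<times> 'a set) groupoid" where
  "HLS G H = \<lparr>
     arr_top = quotient_top (prod_topology euclidean (discrete_topology (carrier G)))
       (\<lambda>(n, g). (n, HLS_subgroup G H n #>\<^bsub>G\<^esub> g)),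
     src = (\<lambda>(n, x). (n, \<one>\<^bsub>HLS_fibre G H n\<^esub>)),
     rng = (\<lambda>(n, x). (n, \<one>\<^bsub>HLS_fibre G H n\<^esub>)),
     comp = (\<lambda>(n, x) (m, y). (n, x \<otimes>\<^bsub>HLS_fibre G H n\<^esub> y)),
     ginv = (\<lambda>(n, x). (n, inv\<^bsub>HLS_fibre G H n\<^esub> x)) \<rparr>"

lemma arrows_HLS: "arrows (HLS G H) = (SIGMA n:UNIV. carrier (HLS_fibre G H n))"
  by (fastforce simp: arrows_def HLS_def topspace_quotient_top HLS_fibre_def FactGroup_def RCOSETS_def)

definition HLS_group :: "('a, 'm) monoid_scheme \<Rightarrow> (nat \<Rightarrow> 'a set) \<Rightarrow> enat \<Rightarrow> 'a set groupoid" where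
  "HLS_group G H n = group_groupoid (HLS_fibre G H n)"

definition HLS_restrict :: "enat \<Rightarrow> (enat \<times> 'a set \<Rightarrow> complex) \<Rightarrow> 'a set \<Rightarrow> complex" where
  "HLS_restrict n f = (\<lambda>x. f (n, x))"

definition HLS_ev :: "('a, 'm) monoid_scheme \<Rightarrow> (nat \<Rightarrow> 'a set) \<Rightarrow> enat \<Rightarrow>
    (nat \<Rightarrow> enat \<times> 'a set \<Rightarrow> complex) set \<Rightarrow> (nat \<Rightarrow> 'a set \<Rightarrow> complex) set" where
  "HLS_ev G H n = completion_map (Cc_alg (HLS_group G H n)) (HLS_restrict n)"

definition HLS_action :: "('a, 'm) monoid_scheme \<Rightarrow> (nat \<Rightarrow> 'a set) \<Rightarrow> (enat \<Rightarrow> complex) \<Rightarrow>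
    (nat \<Rightarrow> enat \<times> 'a set \<Rightarrow> complex) set \<Rightarrow> (nat \<Rightarrow> enat \<times> 'a set \<Rightarrow> complex) set" where
  "HLS_action G H g = completion_map (Cc_alg (HLS G H)) (\<lambda>f \<gamma>. g (fst \<gamma>) * f \<gamma>)"

section \<open>Hausdorff convergence\<close>

definition hausdorff_dist :: "'x::metric_space set \<Rightarrow> 'x set \<Rightarrow> real" where
  "hausdorff_dist S T = max (SUP x\<in>S. infdist x T) (SUP y\<in>T. infdist y S)"

text \<open>The Hausdorff metric is a metric on nonempty compact sets, so these conditions are part of
  the notion of convergence.\<close>

definition hausdorff_tendsto :: "(nat \<Rightarrow> 'x::metric_space set) \<Rightarrow> 'x set \<Rightarrow> bool" where
  "hausdorff_tendsto S T \<longleftrightarrow> (\<forall>n. compact (S n) \<and> S n \<noteq> {}) \<and> compact T \<and> T \<noteq> {} \<and>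
     (\<lambda>n. hausdorff_dist (S n) T) \<longlonglongrightarrow> 0"

end

theory Submission
  imports Defs "Jordan_Normal_Form.Schur_Decomposition" "HOL-Real_Asymp.Real_Asymp"
begin

text \<open>
  A compactly supported function on the groupoid is a family of finitely supported functions \<open>f\<^sub>n\<close> on the
  groups \<open>G\<^sub>n\<close>, with supports coming from one finite subset of \<open>G\<close> and with values that converge as
  \<open>n \<rightarrow> \<infinity>\<close> (\<open>Cc_HLS_iff\<close>). Its norm is the supremum of the reduced norms \<open>\<parallel>f\<^sub>n\<parallel>\<close>, and the weighted \<open>l\<^sup>2\<close> norms
  are suprema in the same way, so uniform rapid decay of the fibres is rapid decay of the groupoid.

  The continuous field rests on the convergence \<open>\<parallel>f\<^sub>n\<parallel> \<rightarrow> \<parallel>f\<^sub>\<infinity>\<parallel>\<close>. The lower estimate holds because a finite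
  subset of \<open>G\<close> embeds into \<open>G\<^sub>n\<close> for large \<open>n\<close>, so that vectors which nearly attain the norm of \<open>f\<^sub>\<infinity>\<close> can be
  transported to nearby fibres (\<open>reduced_norm_lower\<close>). For the upper estimate rapid decay is applied to
  iterated squares \<open>t\<close> of \<open>f\<^sup>*f\<close>: the norm of \<open>t\<^sub>n\<close> is a power \<open>\<parallel>f\<^sub>n\<parallel>\<^sup>m\<close>, while its weighted \<open>l\<^sup>2\<close> norm converges to that
  of \<open>t\<^sub>\<infinity>\<close>, which exceeds \<open>\<parallel>f\<^sub>\<infinity>\<parallel>\<^sup>m\<close> by a factor of polynomial growth in \<open>m\<close> at most, and this factor disappears
  on taking roots (\<open>reduced_norm_upper\<close>). Consequently functions on a fibre lift to the groupoid with nearly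
  the same norm, the evaluation maps are surjective on the completions, and all properties of the field
  follow by density.

  For the spectra, an inverse of \<open>z - a\<close> lifts to a section that is an approximate inverse over nearby fibres, and
  compactness yields that the spectra over \<open>n\<close> lie in any neighbourhood of the spectrum of \<open>a\<close> eventually
  (\<open>spectrum_upper\<close>). Conversely every point of the spectrum of \<open>a\<close> has to be approached
  (\<open>spectrum_lower\<close>). The section itself need not be self-adjoint, which rules out perturbation theory
  for self-adjoint elements. Instead the canonical traces are used: they form a continuous family
  (\<open>tendsto_tau_ev\<close>), over a finite group they are means over eigenvalues (\<open>tau_pow_bound\<close>), and over \<open>G\<close> the
  moments of a self-adjoint element control its norm (\<open>nrm_le_by_moments\<close>).
\<close>

section \<open>Completions of normed star-algebras\<close>

text \<open>The algebras of compactly supported functions, with a unit and before completion. Their norm is only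
  asked to be a seminorm, since the completion divides by the null sequences.\<close>

locale pre_cstar =
  fixes A :: "('b, 'm) star_alg_scheme" (structure)
  assumes vector_space: "Module.module (ring_of_type_algebra :: complex ring) A"
    and mult_closed: "\<lbrakk>a \<in> carrier A; b \<in> carrier A\<rbrakk> \<Longrightarrow> a \<otimes> b \<in> carrier A"
    and mult_assoc: "\<lbrakk>a \<in> carrier A; b \<in> carrier A; c \<in> carrier A\<rbrakk>
      \<Longrightarrow> (a \<otimes> b) \<otimes> c = a \<otimes> (b \<otimes> c)"
    and one_in_carrier: "\<one> \<in> carrier A"
    and one_left: "a \<in> carrier A \<Longrightarrow> \<one> \<otimes> a = a"
    and one_right: "a \<in> carrier A \<Longrightarrow> a \<otimes> \<one> = a"
    and distr_l: "\<lbrakk>a \<in> carrier A; b \<in> carrier A; c \<in> carrier A\<rbrakk>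
      \<Longrightarrow> (a \<oplus> b) \<otimes> c = a \<otimes> c \<oplus> b \<otimes> c"
    and distr_r: "\<lbrakk>a \<in> carrier A; b \<in> carrier A; c \<in> carrier A\<rbrakk>
      \<Longrightarrow> c \<otimes> (a \<oplus> b) = c \<otimes> a \<oplus> c \<otimes> b"
    and smult_mult_l: "\<lbrakk>a \<in> carrier A; b \<in> carrier A\<rbrakk> \<Longrightarrow> (z \<odot> a) \<otimes> b = z \<odot> (a \<otimes> b)"
    and smult_mult_r: "\<lbrakk>a \<in> carrier A; b \<in> carrier A\<rbrakk> \<Longrightarrow> a \<otimes> (z \<odot> b) = z \<odot> (a \<otimes> b)"
    and star_closed: "a \<in> carrier A \<Longrightarrow> star A a \<in> carrier A"
    and star_star: "a \<in> carrier A \<Longrightarrow> star A (star A a) = a"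
    and star_add: "\<lbrakk>a \<in> carrier A; b \<in> carrier A\<rbrakk> \<Longrightarrow> star A (a \<oplus> b) = star A a \<oplus> star A b"
    and star_smult: "a \<in> carrier A \<Longrightarrow> star A (z \<odot> a) = cnj z \<odot> star A a"
    and star_mult: "\<lbrakk>a \<in> carrier A; b \<in> carrier A\<rbrakk> \<Longrightarrow> star A (a \<otimes> b) = star A b \<otimes> star A a"
    and nrm_nonneg: "a \<in> carrier A \<Longrightarrow> nrm A a \<ge> 0"
    and nrm_smult: "a \<in> carrier A \<Longrightarrow> nrm A (z \<odot> a) = cmod z * nrm A a"
    and nrm_add: "\<lbrakk>a \<in> carrier A; b \<in> carrier A\<rbrakk> \<Longrightarrow> nrm A (a \<oplus> b) \<le> nrm A a + nrm A b"
    and nrm_mult: "\<lbrakk>a \<in> carrier A; b \<in> carrier A\<rbrakk> \<Longrightarrow> nrm A (a \<otimes> b) \<le> nrm A a * nrm A b"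
    and cstar_identity: "a \<in> carrier A \<Longrightarrow> nrm A (star A a \<otimes> a) = (nrm A a)\<^sup>2"

lemma complex_module_axioms_iff:
  "Module.module (ring_of_type_algebra :: complex ring) M \<longleftrightarrow>
     abelian_group M \<and> (\<forall>z. \<forall>a\<in>carrier M. z \<odot>\<^bsub>M\<^esub> a \<in> carrier M) \<and>
     (\<forall>z w. \<forall>a\<in>carrier M. (z + w) \<odot>\<^bsub>M\<^esub> a = z \<odot>\<^bsub>M\<^esub> a \<oplus>\<^bsub>M\<^esub> w \<odot>\<^bsub>M\<^esub> a) \<and>
     (\<forall>z. \<forall>a\<in>carrier M. \<forall>b\<in>carrier M. z \<odot>\<^bsub>M\<^esub> (a \<oplus>\<^bsub>M\<^esub> b) = z \<odot>\<^bsub>M\<^esub> a \<oplus>\<^bsub>M\<^esub> z \<odot>\<^bsub>M\<^esub> b) \<and>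
     (\<forall>z w. \<forall>a\<in>carrier M. (z * w) \<odot>\<^bsub>M\<^esub> a = z \<odot>\<^bsub>M\<^esub> (w \<odot>\<^bsub>M\<^esub> a)) \<and>
     (\<forall>a\<in>carrier M. 1 \<odot>\<^bsub>M\<^esub> a = a)"
  unfolding module_def module_axioms_def
  using cring_from_type_algebra[where 'a=complex]
  by (simp add: ring_of_type_algebra_def) blast

context pre_cstar
begin

lemma abelian_group: "abelian_group A"
  using vector_space by (simp add: complex_module_axioms_iff)

lemma smult_closed: "a \<in> carrier A \<Longrightarrow> z \<odot> a \<in> carrier A"
  and smult_add_left: "a \<in> carrier A \<Longrightarrow> (z + w) \<odot> a = z \<odot> a \<oplus> w \<odot> a"
  and smult_add_right: "\<lbrakk>a \<in> carrier A; b \<in> carrier A\<rbrakk> \<Longrightarrow> z \<odot> (a \<oplus> b) = z \<odot> a \<oplus> z \<odot> b"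
  and smult_smult: "a \<in> carrier A \<Longrightarrow> z \<odot> (w \<odot> a) = (z * w) \<odot> a"
  and smult_1: "a \<in> carrier A \<Longrightarrow> 1 \<odot> a = a"
  using vector_space by (auto simp: complex_module_axioms_iff)

sublocale ring A
proof (rule ringI)
  show "abelian_group A"
    by (rule abelian_group)
  show "Group.monoid A"
    by (rule monoidI) (auto simp: mult_closed mult_assoc one_in_carrier one_left one_right)
qed (auto simp: distr_l distr_r)

declare smult_closed [simp, intro] star_closed [simp, intro] nrm_nonneg [simp] smult_1 [simp]
  star_star [simp]

lemma smult_0: "a \<in> carrier A \<Longrightarrow> 0 \<odot> a = \<zero>"
  using smult_add_left[of a 0 0] by (metis add.l_cancel_one' add_0 smult_closed)

lemma smult_minus_1: "a \<in> carrier A \<Longrightarrow> (- 1) \<odot> a = \<ominus> a"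
  using smult_add_left[of a "-1" 1]
  by (metis add.inv_equality add.left_inverse group_add_class.add.left_inverse smult_0 smult_1 smult_closed)

lemma smult_minus_right: "\<lbrakk>a \<in> carrier A; b \<in> carrier A\<rbrakk> \<Longrightarrow> z \<odot> (a \<ominus> b) = z \<odot> a \<ominus> z \<odot> b"
  by (simp add: a_minus_def smult_add_right flip: smult_minus_1) (simp add: smult_smult mult.commute)

lemma minus_conv: "\<lbrakk>a \<in> carrier A; b \<in> carrier A\<rbrakk> \<Longrightarrow> a \<ominus> b = a \<oplus> (-1) \<odot> b"
  by (simp add: a_minus_def smult_minus_1)

lemma smult_diff_left: "a \<in> carrier A \<Longrightarrow> (z - w) \<odot> a = z \<odot> a \<ominus> w \<odot> a"
  using smult_add_left[of a z "-w"] by (simp add: minus_conv smult_smult)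

lemma star_minus: "\<lbrakk>a \<in> carrier A; b \<in> carrier A\<rbrakk> \<Longrightarrow> star A (a \<ominus> b) = star A a \<ominus> star A b"
  by (simp add: minus_conv star_add star_smult)

lemma star_one: "star A \<one> = \<one>"
  by (metis one_in_carrier one_left star_closed star_mult star_star r_one)

lemma nrm_zero: "nrm A \<zero> = 0"
  using nrm_smult[of \<one> 0] by (simp add: smult_0)

lemma nrm_uminus: "a \<in> carrier A \<Longrightarrow> nrm A (\<ominus> a) = nrm A a"
  using nrm_smult[of a "-1"] by (simp add: smult_minus_1)

lemma nrm_minus_commute: "\<lbrakk>a \<in> carrier A; b \<in> carrier A\<rbrakk> \<Longrightarrow> nrm A (a \<ominus> b) = nrm A (b \<ominus> a)"
  by (metis minus_add minus_closed minus_minus nrm_uminus a_minus_def a_comm a_inv_closed)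

lemma minus_telescope:
  "\<lbrakk>a \<in> carrier A; b \<in> carrier A; c \<in> carrier A\<rbrakk> \<Longrightarrow> (a \<ominus> b) \<oplus> (b \<ominus> c) = a \<ominus> c"
  by (simp add: a_minus_def a_assoc[symmetric]) (simp add: a_assoc l_neg)

lemma nrm_triangle:
  "\<lbrakk>a \<in> carrier A; b \<in> carrier A; c \<in> carrier A\<rbrakk>
    \<Longrightarrow> nrm A (a \<ominus> c) \<le> nrm A (a \<ominus> b) + nrm A (b \<ominus> c)"
  using nrm_add[of "a \<ominus> b" "b \<ominus> c"] by (simp add: minus_telescope)

lemma minus_add_cancel: "\<lbrakk>a \<in> carrier A; b \<in> carrier A\<rbrakk> \<Longrightarrow> (a \<ominus> b) \<oplus> b = a"
  by (simp add: a_minus_def a_assoc l_neg)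

lemma nrm_diff_le: "\<lbrakk>a \<in> carrier A; b \<in> carrier A\<rbrakk> \<Longrightarrow> \<bar>nrm A a - nrm A b\<bar> \<le> nrm A (a \<ominus> b)"
  using nrm_add[of "a \<ominus> b" b] nrm_add[of "b \<ominus> a" a] nrm_minus_commute[of a b]
  by (simp add: minus_add_cancel)

text \<open>By the \<open>C\<^sup>*\<close>-identity \<open>\<parallel>a\<parallel>\<^sup>2 = \<parallel>a\<^sup>*a\<parallel> \<le> \<parallel>a\<^sup>*\<parallel> \<parallel>a\<parallel>\<close>, so the involution is isometric.\<close>

lemma nrm_star_le: "a \<in> carrier A \<Longrightarrow> nrm A a \<le> nrm A (star A a)"
proof -
  assume a: "a \<in> carrier A"
  then have "nrm A a * nrm A a \<le> nrm A (star A a) * nrm A a"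
    using cstar_identity[OF a] nrm_mult[of "star A a" a] by (simp add: power2_eq_square)
  then show ?thesis
    using a nrm_nonneg[of a] nrm_nonneg[of "star A a"]
    by (cases "nrm A a = 0") (auto simp: mult_le_cancel_right order_less_le)
qed

lemma nrm_star: "a \<in> carrier A \<Longrightarrow> nrm A (star A a) = nrm A a"
  using nrm_star_le[of a] nrm_star_le[of "star A a"] by simp

lemma nrm_one_le: "nrm A \<one> \<le> 1"
proof -
  have "nrm A \<one> = (nrm A \<one>)\<^sup>2"
    using cstar_identity[of \<one>] by (simp add: star_one)
  then have "nrm A \<one> = 0 \<or> nrm A \<one> = 1"
    by (simp add: power2_eq_square)
  then show ?thesis by auto
qed

lemma add_minus_add:
  "\<lbrakk>a \<in> carrier A; b \<in> carrier A; c \<in> carrier A; d \<in> carrier A\<rbrakk>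
    \<Longrightarrow> (a \<oplus> b) \<ominus> (c \<oplus> d) = (a \<ominus> c) \<oplus> (b \<ominus> d)"
  by (simp add: a_minus_def minus_add a_ac)

lemma mult_minus_left:
  "\<lbrakk>a \<in> carrier A; b \<in> carrier A; c \<in> carrier A\<rbrakk> \<Longrightarrow> (a \<ominus> b) \<otimes> c = a \<otimes> c \<ominus> b \<otimes> c"
  by (simp add: a_minus_def l_distr l_minus)

lemma mult_minus_right:
  "\<lbrakk>a \<in> carrier A; b \<in> carrier A; c \<in> carrier A\<rbrakk> \<Longrightarrow> c \<otimes> (a \<ominus> b) = c \<otimes> a \<ominus> c \<otimes> b"
  by (simp add: a_minus_def r_distr r_minus)

lemma mult_minus_mult:
  "\<lbrakk>a \<in> carrier A; b \<in> carrier A; c \<in> carrier A; d \<in> carrier A\<rbrakk>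
    \<Longrightarrow> a \<otimes> b \<ominus> c \<otimes> d = (a \<ominus> c) \<otimes> b \<oplus> c \<otimes> (b \<ominus> d)"
  by (simp add: mult_minus_left mult_minus_right minus_telescope)

lemma cauchy_seqsD:
  assumes "x \<in> cauchy_seqs A" "e > 0"
  obtains N where "\<And>i j. i \<ge> N \<Longrightarrow> j \<ge> N \<Longrightarrow> nrm A (x i \<ominus> x j) < e"
  using assms unfolding cauchy_seqs_def by blast

lemma cauchy_seqs_carrier [simp]: "x \<in> cauchy_seqs A \<Longrightarrow> x k \<in> carrier A"
  unfolding cauchy_seqs_def by blast

lemma cauchy_seqs_const: "a \<in> carrier A \<Longrightarrow> (\<lambda>k. a) \<in> cauchy_seqs A"
  unfolding cauchy_seqs_def by (simp add: minus_eq r_neg nrm_zero)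

lemma cauchy_seqs_image:
  assumes x: "x \<in> cauchy_seqs A" and y: "\<And>k. y k \<in> carrier A"
    and le: "\<And>i j. nrm A (y i \<ominus> y j) \<le> K * nrm A (x i \<ominus> x j)"
  shows "y \<in> cauchy_seqs A"
  unfolding cauchy_seqs_def
proof (intro CollectI conjI allI impI)
  show "y k \<in> carrier A" for k by (rule y)
  fix e :: real assume e: "e > 0"
  define c where "c = \<bar>K\<bar> + 1"
  have c: "c > 0" by (simp add: c_def)
  obtain N where N: "\<And>i j. i \<ge> N \<Longrightarrow> j \<ge> N \<Longrightarrow> nrm A (x i \<ominus> x j) < e / c"
    using cauchy_seqsD[OF x, of "e / c"] e c by auto
  have "nrm A (y i \<ominus> y j) < e" if "i \<ge> N" "j \<ge> N" for i j
  proof -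
    have "nrm A (y i \<ominus> y j) \<le> K * nrm A (x i \<ominus> x j)" by (rule le)
    also have "\<dots> \<le> c * nrm A (x i \<ominus> x j)"
      by (rule mult_right_mono) (auto simp: c_def x)
    also have "\<dots> < e" using N[OF that] c by (simp add: field_simps)
    finally show ?thesis .
  qed
  then show "\<exists>N. \<forall>i\<ge>N. \<forall>j\<ge>N. nrm A (y i \<ominus> y j) < e" by blast
qed

lemma cauchy_seqs_bounded:
  assumes x: "x \<in> cauchy_seqs A"
  obtains K where "K > 0" "\<And>k. nrm A (x k) \<le> K"
proof -
  obtain N where N: "\<And>i j. i \<ge> N \<Longrightarrow> j \<ge> N \<Longrightarrow> nrm A (x i \<ominus> x j) < 1"
    using cauchy_seqsD[OF x, of 1] by auto
  define K where "K = Max ((\<lambda>k. nrm A (x k)) ` {..N}) + 1"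
  have *: "nrm A (x k) \<le> K - 1" if "k \<le> N" for k
    unfolding K_def using that by (auto intro!: Max_ge)
  have "nrm A (x k) \<le> K" for k
  proof (cases "k \<le> N")
    case False
    then have "nrm A (x k) \<le> nrm A (x N) + 1"
      using nrm_diff_le[of "x k" "x N"] N[of k N] x by auto
    then show ?thesis using *[of N] by simp
  qed (use * in force)
  moreover have "K > 0" using *[of 0] nrm_nonneg[OF cauchy_seqs_carrier[OF x, of 0]] by simp
  ultimately show ?thesis using that by blast
qed

lemma cauchy_seqs_add:
  assumes x: "x \<in> cauchy_seqs A" and y: "y \<in> cauchy_seqs A"
  shows "(\<lambda>k. x k \<oplus> y k) \<in> cauchy_seqs A"
  unfolding cauchy_seqs_def
proof (intro CollectI conjI allI impI)
  fix e :: real assume e: "e > 0"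
  obtain N where N: "\<And>i j. i \<ge> N \<Longrightarrow> j \<ge> N \<Longrightarrow> nrm A (x i \<ominus> x j) < e / 2"
    using cauchy_seqsD[OF x, of "e / 2"] e by auto
  obtain M where M: "\<And>i j. i \<ge> M \<Longrightarrow> j \<ge> M \<Longrightarrow> nrm A (y i \<ominus> y j) < e / 2"
    using cauchy_seqsD[OF y, of "e / 2"] e by auto
  have "nrm A ((x i \<oplus> y i) \<ominus> (x j \<oplus> y j)) < e" if "i \<ge> max N M" "j \<ge> max N M" for i j
    using that N[of i j] M[of i j] nrm_add[of "x i \<ominus> x j" "y i \<ominus> y j"] x y
    by (simp add: add_minus_add)
  then show "\<exists>N. \<forall>i\<ge>N. \<forall>j\<ge>N. nrm A ((x i \<oplus> y i) \<ominus> (x j \<oplus> y j)) < e" by blast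
qed (use x y in auto)

lemma nrm_mult_diff_le:
  assumes "a \<in> carrier A" "b \<in> carrier A" "c \<in> carrier A" "d \<in> carrier A"
    and "nrm A b \<le> K" "nrm A c \<le> L"
  shows "nrm A (a \<otimes> b \<ominus> c \<otimes> d) \<le> K * nrm A (a \<ominus> c) + L * nrm A (b \<ominus> d)"
proof -
  have "nrm A (a \<otimes> b \<ominus> c \<otimes> d) \<le> nrm A ((a \<ominus> c) \<otimes> b) + nrm A (c \<otimes> (b \<ominus> d))"
    using assms by (simp add: mult_minus_mult nrm_add)
  also have "\<dots> \<le> nrm A (a \<ominus> c) * nrm A b + nrm A c * nrm A (b \<ominus> d)"
    using assms by (intro add_mono nrm_mult) auto
  also have "\<dots> \<le> nrm A (a \<ominus> c) * K + L * nrm A (b \<ominus> d)"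
    using assms by (intro add_mono mult_left_mono mult_right_mono) auto
  finally show ?thesis by (simp add: mult.commute)
qed

lemma cauchy_seqs_mult:
  assumes x: "x \<in> cauchy_seqs A" and y: "y \<in> cauchy_seqs A"
  shows "(\<lambda>k. x k \<otimes> y k) \<in> cauchy_seqs A"
  unfolding cauchy_seqs_def
proof (intro CollectI conjI allI impI)
  fix e :: real assume e: "e > 0"
  obtain K where K: "K > 0" "\<And>k. nrm A (y k) \<le> K" using cauchy_seqs_bounded[OF y] by blast
  obtain L where L: "L > 0" "\<And>k. nrm A (x k) \<le> L" using cauchy_seqs_bounded[OF x] by blast
  obtain N where N: "\<And>i j. i \<ge> N \<Longrightarrow> j \<ge> N \<Longrightarrow> nrm A (x i \<ominus> x j) < e / (2 * K)"
    using cauchy_seqsD[OF x, of "e / (2 * K)"] e K by auto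
  obtain M where M: "\<And>i j. i \<ge> M \<Longrightarrow> j \<ge> M \<Longrightarrow> nrm A (y i \<ominus> y j) < e / (2 * L)"
    using cauchy_seqsD[OF y, of "e / (2 * L)"] e L by auto
  have "nrm A (x i \<otimes> y i \<ominus> x j \<otimes> y j) < e" if "i \<ge> max N M" "j \<ge> max N M" for i j
  proof -
    have "K * nrm A (x i \<ominus> x j) < e / 2" "L * nrm A (y i \<ominus> y j) < e / 2"
      using that N[of i j] M[of i j] K(1) L(1) by (auto simp: field_simps)
    then show ?thesis
      using nrm_mult_diff_le[of "x i" "y i" "x j" "y j" K L] K L x y by simp
  qed
  then show "\<exists>N. \<forall>i\<ge>N. \<forall>j\<ge>N. nrm A (x i \<otimes> y i \<ominus> x j \<otimes> y j) < e" by blast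
qed (use x y in auto)

lemma cauchy_seqs_smult: "x \<in> cauchy_seqs A \<Longrightarrow> (\<lambda>k. z \<odot> x k) \<in> cauchy_seqs A"
  by (rule cauchy_seqs_image[where K="cmod z"]) (auto simp: nrm_smult simp flip: smult_minus_right)

lemma cauchy_seqs_star: "x \<in> cauchy_seqs A \<Longrightarrow> (\<lambda>k. star A (x k)) \<in> cauchy_seqs A"
  by (rule cauchy_seqs_image[where K=1]) (auto simp: nrm_star simp flip: star_minus)

lemma cauchy_rel_iff:
  "(x, y) \<in> cauchy_rel A \<longleftrightarrow> x \<in> cauchy_seqs A \<and> y \<in> cauchy_seqs A \<and>
     (\<lambda>k. nrm A (x k \<ominus> y k)) \<longlonglongrightarrow> 0"
  by (simp add: cauchy_rel_def)

lemma equiv_cauchy_rel: "equiv (cauchy_seqs A) (cauchy_rel A)"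
proof (rule equivI)
  show "cauchy_rel A \<subseteq> cauchy_seqs A \<times> cauchy_seqs A"
    by (auto simp: cauchy_rel_iff)
  show "refl_on (cauchy_seqs A) (cauchy_rel A)"
    by (auto intro!: refl_onI simp: cauchy_rel_iff minus_eq r_neg nrm_zero)
  show "sym (cauchy_rel A)"
    by (rule symI) (auto simp: cauchy_rel_iff nrm_minus_commute)
  show "trans (cauchy_rel A)"
  proof (rule transI, unfold cauchy_rel_iff, safe)
    fix x y z assume xyz: "x \<in> cauchy_seqs A" "y \<in> cauchy_seqs A" "z \<in> cauchy_seqs A"
      and "(\<lambda>k. nrm A (x k \<ominus> y k)) \<longlonglongrightarrow> 0" "(\<lambda>k. nrm A (y k \<ominus> z k)) \<longlonglongrightarrow> 0"
    then have "(\<lambda>k. nrm A (x k \<ominus> y k) + nrm A (y k \<ominus> z k)) \<longlonglongrightarrow> 0"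
      using tendsto_add by fastforce
    then show "(\<lambda>k. nrm A (x k \<ominus> z k)) \<longlonglongrightarrow> 0"
      by (rule Lim_null_comparison[rotated]) (use xyz in \<open>auto simp: nrm_triangle\<close>)
  qed
qed

definition cls :: "(nat \<Rightarrow> 'b) \<Rightarrow> (nat \<Rightarrow> 'b) set" where
  "cls x = cauchy_rel A `` {x}"

lemma carrier_completion: "carrier (completion A) = cls ` cauchy_seqs A"
  by (auto simp: completion_def quotient_def cls_def)

lemma cls_closed [simp]: "x \<in> cauchy_seqs A \<Longrightarrow> cls x \<in> carrier (completion A)"
  by (simp add: carrier_completion)

lemma completion_cases [consumes 1]:
  assumes "a \<in> carrier (completion A)"
  obtains x where "x \<in> cauchy_seqs A" "a = cls x"
  using assms by (auto simp: carrier_completion)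

lemma cls_eq_iff:
  "\<lbrakk>x \<in> cauchy_seqs A; y \<in> cauchy_seqs A\<rbrakk> \<Longrightarrow> cls x = cls y \<longleftrightarrow> (\<lambda>k. nrm A (x k \<ominus> y k)) \<longlonglongrightarrow> 0"
  unfolding cls_def using eq_equiv_class_iff[OF equiv_cauchy_rel] by (simp add: cauchy_rel_iff)

lemma UN_cls:
  assumes x: "x \<in> cauchy_seqs A"
    and F: "\<And>y. y \<in> cauchy_seqs A \<Longrightarrow> (\<lambda>k. nrm A (x k \<ominus> y k)) \<longlonglongrightarrow> 0 \<Longrightarrow> F y = F x"
  shows "(\<Union>y\<in>cls x. F y) = F x"
proof -
  have "x \<in> cls x"
    using equiv_class_self[OF equiv_cauchy_rel x] by (simp add: cls_def)
  moreover have "F y = F x" if "y \<in> cls x" for y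
    using that F by (auto simp: cls_def cauchy_rel_iff)
  ultimately show ?thesis by blast
qed

text \<open>A binary operation on sequences descends to classes as soon as it respects null sequences.\<close>

lemma UN_cls2:
  assumes x: "x \<in> cauchy_seqs A" and y: "y \<in> cauchy_seqs A"
    and F: "\<And>x' y'. \<lbrakk>x' \<in> cauchy_seqs A; (\<lambda>k. nrm A (x k \<ominus> x' k)) \<longlonglongrightarrow> 0;
       y' \<in> cauchy_seqs A; (\<lambda>k. nrm A (y k \<ominus> y' k)) \<longlonglongrightarrow> 0\<rbrakk> \<Longrightarrow> F x' y' = F x y"
  shows "(\<Union>x'\<in>cls x. \<Union>y'\<in>cls y. F x' y') = F x y"
proof -
  have null: "(\<lambda>k. nrm A (z k \<ominus> z k)) \<longlonglongrightarrow> 0" if "z \<in> cauchy_seqs A" for z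
    using that by (simp add: minus_eq r_neg nrm_zero)
  have inner: "(\<Union>y'\<in>cls y. F x' y') = F x y"
    if x': "x' \<in> cauchy_seqs A" "(\<lambda>k. nrm A (x k \<ominus> x' k)) \<longlonglongrightarrow> 0" for x'
  proof -
    have "(\<Union>y'\<in>cls y. F x' y') = F x' y"
    proof (rule UN_cls[OF y])
      fix y' assume y': "y' \<in> cauchy_seqs A" "(\<lambda>k. nrm A (y k \<ominus> y' k)) \<longlonglongrightarrow> 0"
      show "F x' y' = F x' y" using F[OF x' y'] F[OF x' y null[OF y]] by simp
    qed
    also have "\<dots> = F x y" by (rule F[OF x' y null[OF y]])
    finally show ?thesis .
  qed
  have "(\<Union>x'\<in>cls x. \<Union>y'\<in>cls y. F x' y') = (\<Union>y'\<in>cls y. F x y')"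
  proof (rule UN_cls[OF x])
    fix x' assume x': "x' \<in> cauchy_seqs A" "(\<lambda>k. nrm A (x k \<ominus> x' k)) \<longlonglongrightarrow> 0"
    show "(\<Union>y'\<in>cls y. F x' y') = (\<Union>y'\<in>cls y. F x y')"
      using inner[OF x'] inner[OF x null[OF x]] by simp
  qed
  then show ?thesis using inner[OF x null[OF x]] by simp
qed

lemma completion_add_cls:
  assumes x: "x \<in> cauchy_seqs A" and y: "y \<in> cauchy_seqs A"
  shows "cls x \<oplus>\<^bsub>completion A\<^esub> cls y = cls (\<lambda>k. x k \<oplus> y k)"
proof -
  have "(\<Union>x'\<in>cls x. \<Union>y'\<in>cls y. cls (\<lambda>k. x' k \<oplus> y' k)) = cls (\<lambda>k. x k \<oplus> y k)"
  proof (rule UN_cls2[OF x y])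
    fix x' y'
    assume that: "x' \<in> cauchy_seqs A" "(\<lambda>k. nrm A (x k \<ominus> x' k)) \<longlonglongrightarrow> 0"
       "y' \<in> cauchy_seqs A" "(\<lambda>k. nrm A (y k \<ominus> y' k)) \<longlonglongrightarrow> 0"
    have "(\<lambda>k. nrm A (x k \<ominus> x' k) + nrm A (y k \<ominus> y' k)) \<longlonglongrightarrow> 0"
      using tendsto_add[OF that(2,4)] by simp
    then have "(\<lambda>k. nrm A ((x k \<oplus> y k) \<ominus> (x' k \<oplus> y' k))) \<longlonglongrightarrow> 0"
      by (rule Lim_null_comparison[rotated]) (use x y that in \<open>auto simp: add_minus_add nrm_add\<close>)
    then show "cls (\<lambda>k. x' k \<oplus> y' k) = cls (\<lambda>k. x k \<oplus> y k)"
      using x y that by (subst eq_commute) (simp add: cls_eq_iff cauchy_seqs_add)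
  qed
  then show ?thesis by (simp add: completion_def cls_def)
qed

lemma completion_mult_cls:
  assumes x: "x \<in> cauchy_seqs A" and y: "y \<in> cauchy_seqs A"
  shows "cls x \<otimes>\<^bsub>completion A\<^esub> cls y = cls (\<lambda>k. x k \<otimes> y k)"
proof -
  have "(\<Union>x'\<in>cls x. \<Union>y'\<in>cls y. cls (\<lambda>k. x' k \<otimes> y' k)) = cls (\<lambda>k. x k \<otimes> y k)"
  proof (rule UN_cls2[OF x y])
    fix x' y'
    assume x': "x' \<in> cauchy_seqs A" and x'0: "(\<lambda>k. nrm A (x k \<ominus> x' k)) \<longlonglongrightarrow> 0"
      and y': "y' \<in> cauchy_seqs A" and y'0: "(\<lambda>k. nrm A (y k \<ominus> y' k)) \<longlonglongrightarrow> 0"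
    obtain K where K: "K > 0" "\<And>k. nrm A (y k) \<le> K" using cauchy_seqs_bounded[OF y] by blast
    obtain L where L: "L > 0" "\<And>k. nrm A (x' k) \<le> L" using cauchy_seqs_bounded[OF x'] by blast
    have "(\<lambda>k. K * nrm A (x k \<ominus> x' k) + L * nrm A (y k \<ominus> y' k)) \<longlonglongrightarrow> K * 0 + L * 0"
      using x'0 y'0 by (intro tendsto_intros)
    then have lim: "(\<lambda>k. K * nrm A (x k \<ominus> x' k) + L * nrm A (y k \<ominus> y' k)) \<longlonglongrightarrow> 0"
      by simp
    have "norm (nrm A (x k \<otimes> y k \<ominus> x' k \<otimes> y' k))
        \<le> K * nrm A (x k \<ominus> x' k) + L * nrm A (y k \<ominus> y' k)" for k
      using nrm_mult_diff_le[of "x k" "y k" "x' k" "y' k" K L] x y x' y' K L by simp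
    then have "(\<lambda>k. nrm A (x k \<otimes> y k \<ominus> x' k \<otimes> y' k)) \<longlonglongrightarrow> 0"
      by (intro Lim_null_comparison[OF always_eventually lim] allI)
    then show "cls (\<lambda>k. x' k \<otimes> y' k) = cls (\<lambda>k. x k \<otimes> y k)"
      using x y x' y' by (subst eq_commute) (simp add: cls_eq_iff cauchy_seqs_mult)
  qed
  then show ?thesis by (simp add: completion_def cls_def)
qed

lemma completion_smult_cls:
  assumes x: "x \<in> cauchy_seqs A"
  shows "z \<odot>\<^bsub>completion A\<^esub> cls x = cls (\<lambda>k. z \<odot> x k)"
proof -
  have "(\<Union>y\<in>cls x. cls (\<lambda>k. z \<odot> y k)) = cls (\<lambda>k. z \<odot> x k)"
  proof (rule UN_cls[OF x])
    fix y assume y: "y \<in> cauchy_seqs A" "(\<lambda>k. nrm A (x k \<ominus> y k)) \<longlonglongrightarrow> 0"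
    have "(\<lambda>k. cmod z * nrm A (x k \<ominus> y k)) \<longlonglongrightarrow> cmod z * 0"
      using y by (intro tendsto_intros)
    then show "cls (\<lambda>k. z \<odot> y k) = cls (\<lambda>k. z \<odot> x k)"
      using x y by (subst eq_commute)
        (simp add: cls_eq_iff cauchy_seqs_smult nrm_smult flip: smult_minus_right)
  qed
  then show ?thesis by (simp add: completion_def cls_def)
qed

lemma completion_star_cls:
  assumes x: "x \<in> cauchy_seqs A"
  shows "star (completion A) (cls x) = cls (\<lambda>k. star A (x k))"
proof -
  have "(\<Union>y\<in>cls x. cls (\<lambda>k. star A (y k))) = cls (\<lambda>k. star A (x k))"
  proof (rule UN_cls[OF x])
    fix y assume y: "y \<in> cauchy_seqs A" "(\<lambda>k. nrm A (x k \<ominus> y k)) \<longlonglongrightarrow> 0"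
    then show "cls (\<lambda>k. star A (y k)) = cls (\<lambda>k. star A (x k))"
      using x by (subst eq_commute) (simp add: cls_eq_iff cauchy_seqs_star nrm_star flip: star_minus)
  qed
  then show ?thesis by (simp add: completion_def cls_def)
qed

lemma completion_zero: "\<zero>\<^bsub>completion A\<^esub> = cls (\<lambda>k. \<zero>)"
  and completion_one: "\<one>\<^bsub>completion A\<^esub> = cls (\<lambda>k. \<one>)"
  by (simp_all add: completion_def cls_def)

lemma convergent_nrm:
  assumes x: "x \<in> cauchy_seqs A"
  shows "convergent (\<lambda>k. nrm A (x k))"
proof (rule Cauchy_convergent, rule metric_CauchyI)
  fix e :: real assume "e > 0"
  then obtain N where N: "\<And>i j. i \<ge> N \<Longrightarrow> j \<ge> N \<Longrightarrow> nrm A (x i \<ominus> x j) < e"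
    using cauchy_seqsD[OF x] by blast
  have "dist (nrm A (x i)) (nrm A (x j)) < e" if "i \<ge> N" "j \<ge> N" for i j
    using nrm_diff_le[of "x i" "x j"] N[OF that] x by (simp add: dist_real_def)
  then show "\<exists>M. \<forall>m\<ge>M. \<forall>n\<ge>M. dist (nrm A (x m)) (nrm A (x n)) < e" by blast
qed

lemma tendsto_nrm_cls:
  assumes x: "x \<in> cauchy_seqs A"
  shows "(\<lambda>k. nrm A (x k)) \<longlonglongrightarrow> nrm (completion A) (cls x)"
proof -
  obtain r where r: "(\<lambda>k. nrm A (x k)) \<longlonglongrightarrow> r"
    using convergent_nrm[OF x] by (auto simp: convergent_def)
  have "s = r" if y: "y \<in> cls x" and s: "(\<lambda>k. nrm A (y k)) \<longlonglongrightarrow> s" for y s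
  proof -
    have y: "y \<in> cauchy_seqs A" "(\<lambda>k. nrm A (x k \<ominus> y k)) \<longlonglongrightarrow> 0"
      using y by (auto simp: cls_def cauchy_rel_iff)
    have "(\<lambda>k. nrm A (x k) - nrm A (y k)) \<longlonglongrightarrow> 0"
      by (rule Lim_null_comparison[OF _ y(2)]) (use x y in \<open>auto simp: nrm_diff_le\<close>)
    moreover have "(\<lambda>k. nrm A (x k) - nrm A (y k)) \<longlonglongrightarrow> r - s"
      using r s by (intro tendsto_intros)
    ultimately have "r - s = 0" by (rule LIMSEQ_unique[rotated])
    then show ?thesis by simp
  qed
  moreover have "x \<in> cls x"
    using equiv_class_self[OF equiv_cauchy_rel x] by (simp add: cls_def)
  ultimately have "(THE r. \<exists>y\<in>cls x. (\<lambda>k. nrm A (y k)) \<longlonglongrightarrow> r) = r"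
    using r by (intro the_equality) blast+
  then show ?thesis using r by (simp add: completion_def)
qed

lemma nrm_cls_const: "a \<in> carrier A \<Longrightarrow> nrm (completion A) (cls (\<lambda>k. a)) = nrm A a"
  using tendsto_nrm_cls[OF cauchy_seqs_const] LIMSEQ_unique[OF tendsto_const] by metis

lemma abelian_group_completion: "abelian_group (completion A)"
proof (rule abelian_groupI)
  fix a assume "a \<in> carrier (completion A)"
  then obtain x where x: "x \<in> cauchy_seqs A" "a = cls x" by (rule completion_cases)
  then have "cls (\<lambda>k. (-1) \<odot> x k) \<oplus>\<^bsub>completion A\<^esub> a = \<zero>\<^bsub>completion A\<^esub>"
    using cauchy_seqs_smult[OF x(1), of "-1"]
    by (simp add: completion_add_cls completion_zero smult_minus_1 l_neg)
  moreover have "cls (\<lambda>k. (-1) \<odot> x k) \<in> carrier (completion A)"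
    by (rule cls_closed) (rule cauchy_seqs_smult[OF x(1)])
  ultimately show "\<exists>b\<in>carrier (completion A). b \<oplus>\<^bsub>completion A\<^esub> a = \<zero>\<^bsub>completion A\<^esub>"
    by (rule bexI)
next
  fix a b assume "a \<in> carrier (completion A)" "b \<in> carrier (completion A)"
  then obtain x y where x: "x \<in> cauchy_seqs A" "a = cls x" and y: "y \<in> cauchy_seqs A" "b = cls y"
    by (meson completion_cases)
  show "a \<oplus>\<^bsub>completion A\<^esub> b \<in> carrier (completion A)"
    "a \<oplus>\<^bsub>completion A\<^esub> b = b \<oplus>\<^bsub>completion A\<^esub> a"
    by (simp_all add: x y completion_add_cls cauchy_seqs_add a_comm)
  fix c assume "c \<in> carrier (completion A)"
  then obtain w where w: "w \<in> cauchy_seqs A" "c = cls w" by (rule completion_cases)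
  show "a \<oplus>\<^bsub>completion A\<^esub> b \<oplus>\<^bsub>completion A\<^esub> c = a \<oplus>\<^bsub>completion A\<^esub> (b \<oplus>\<^bsub>completion A\<^esub> c)"
    by (simp add: x y w completion_add_cls cauchy_seqs_add a_assoc)
next
  fix a assume "a \<in> carrier (completion A)"
  then obtain x where x: "x \<in> cauchy_seqs A" "a = cls x" by (rule completion_cases)
  then show "\<zero>\<^bsub>completion A\<^esub> \<oplus>\<^bsub>completion A\<^esub> a = a"
    by (simp add: completion_zero completion_add_cls cauchy_seqs_const)
next
  have "(\<lambda>k. \<zero>) \<in> cauchy_seqs A" by (rule cauchy_seqs_const) (rule zero_closed)
  then show "\<zero>\<^bsub>completion A\<^esub> \<in> carrier (completion A)"
    unfolding completion_zero by (rule cls_closed)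
qed

end

context pre_cstar begin

lemmas completion_rules = completion_add_cls completion_mult_cls completion_smult_cls completion_star_cls
  completion_one cauchy_seqs_add cauchy_seqs_mult cauchy_seqs_smult cauchy_seqs_star cauchy_seqs_const

lemma pre_cstar_completion: "pre_cstar (completion A)"
proof (rule pre_cstar.intro)
  show "Module.module (ring_of_type_algebra :: complex ring) (completion A)"
    unfolding complex_module_axioms_iff carrier_completion ball_simps
    by (intro conjI abelian_group_completion allI ballI)
      (simp_all add: completion_smult_cls completion_add_cls cauchy_seqs_smult cauchy_seqs_add
        smult_add_left smult_add_right smult_smult)
next
  fix a assume "a \<in> carrier (completion A)"
  then obtain x where x: "x \<in> cauchy_seqs A" "a = cls x" by (rule completion_cases)
  show "nrm (completion A) a \<ge> 0"
    by (rule LIMSEQ_le_const[OF tendsto_nrm_cls[OF x(1), folded x(2)]]) (use x in auto)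
  show "nrm (completion A) (z \<odot>\<^bsub>completion A\<^esub> a) = cmod z * nrm (completion A) a" for z
  proof (rule LIMSEQ_unique)
    show "(\<lambda>k. nrm A (z \<odot> x k)) \<longlonglongrightarrow> nrm (completion A) (z \<odot>\<^bsub>completion A\<^esub> a)"
      using tendsto_nrm_cls[OF cauchy_seqs_smult[OF x(1)], of z] x by (simp add: completion_smult_cls)
    show "(\<lambda>k. nrm A (z \<odot> x k)) \<longlonglongrightarrow> cmod z * nrm (completion A) a"
      using tendsto_mult[OF tendsto_const tendsto_nrm_cls[OF x(1)], of "cmod z"] x by (simp add: nrm_smult)
  qed
  show "nrm (completion A) (star (completion A) a \<otimes>\<^bsub>completion A\<^esub> a) = (nrm (completion A) a)\<^sup>2"
  proof (rule LIMSEQ_unique)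
    show "(\<lambda>k. nrm A (star A (x k) \<otimes> x k)) \<longlonglongrightarrow>
        nrm (completion A) (star (completion A) a \<otimes>\<^bsub>completion A\<^esub> a)"
      using tendsto_nrm_cls[OF cauchy_seqs_mult[OF cauchy_seqs_star[OF x(1)] x(1)]] x
      by (simp add: completion_star_cls completion_mult_cls cauchy_seqs_star)
    show "(\<lambda>k. nrm A (star A (x k) \<otimes> x k)) \<longlonglongrightarrow> (nrm (completion A) a)\<^sup>2"
      using tendsto_power[OF tendsto_nrm_cls[OF x(1)], of 2] x by (simp add: cstar_identity)
  qed
  show "\<one>\<^bsub>completion A\<^esub> \<otimes>\<^bsub>completion A\<^esub> a = a"
    "a \<otimes>\<^bsub>completion A\<^esub> \<one>\<^bsub>completion A\<^esub> = a"
    "star (completion A) a \<in> carrier (completion A)"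
    "star (completion A) (star (completion A) a) = a"
    by (simp_all add: x completion_rules)
  show "star (completion A) (z \<odot>\<^bsub>completion A\<^esub> a)
      = cnj z \<odot>\<^bsub>completion A\<^esub> star (completion A) a" for z
    by (simp add: x completion_rules star_smult)
  fix b assume "b \<in> carrier (completion A)"
  then obtain y where y: "y \<in> cauchy_seqs A" "b = cls y" by (rule completion_cases)
  show "nrm (completion A) (a \<oplus>\<^bsub>completion A\<^esub> b) \<le> nrm (completion A) a + nrm (completion A) b"
  proof (rule LIMSEQ_le)
    show "(\<lambda>k. nrm A (x k \<oplus> y k)) \<longlonglongrightarrow> nrm (completion A) (a \<oplus>\<^bsub>completion A\<^esub> b)"
      using tendsto_nrm_cls[OF cauchy_seqs_add[OF x(1) y(1)]] x y by (simp add: completion_add_cls)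
    show "(\<lambda>k. nrm A (x k) + nrm A (y k)) \<longlonglongrightarrow> nrm (completion A) a + nrm (completion A) b"
      using tendsto_nrm_cls x y by (intro tendsto_intros) auto
    show "\<exists>N. \<forall>n\<ge>N. nrm A (x n \<oplus> y n) \<le> nrm A (x n) + nrm A (y n)"
      using x y by (auto simp: nrm_add)
  qed
  show "nrm (completion A) (a \<otimes>\<^bsub>completion A\<^esub> b) \<le> nrm (completion A) a * nrm (completion A) b"
  proof (rule LIMSEQ_le)
    show "(\<lambda>k. nrm A (x k \<otimes> y k)) \<longlonglongrightarrow> nrm (completion A) (a \<otimes>\<^bsub>completion A\<^esub> b)"
      using tendsto_nrm_cls[OF cauchy_seqs_mult[OF x(1) y(1)]] x y by (simp add: completion_mult_cls)
    show "(\<lambda>k. nrm A (x k) * nrm A (y k)) \<longlonglongrightarrow> nrm (completion A) a * nrm (completion A) b"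
      using tendsto_nrm_cls x y by (intro tendsto_intros) auto
    show "\<exists>N. \<forall>n\<ge>N. nrm A (x n \<otimes> y n) \<le> nrm A (x n) * nrm A (y n)"
      using x y by (auto simp: nrm_mult)
  qed
  show "a \<otimes>\<^bsub>completion A\<^esub> b \<in> carrier (completion A)"
    "star (completion A) (a \<otimes>\<^bsub>completion A\<^esub> b)
      = star (completion A) b \<otimes>\<^bsub>completion A\<^esub> star (completion A) a"
    "star (completion A) (a \<oplus>\<^bsub>completion A\<^esub> b)
      = star (completion A) a \<oplus>\<^bsub>completion A\<^esub> star (completion A) b"
    by (simp_all add: x y completion_rules star_mult star_add)
  show "(z \<odot>\<^bsub>completion A\<^esub> a) \<otimes>\<^bsub>completion A\<^esub> b
      = z \<odot>\<^bsub>completion A\<^esub> (a \<otimes>\<^bsub>completion A\<^esub> b)"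
    "a \<otimes>\<^bsub>completion A\<^esub> (z \<odot>\<^bsub>completion A\<^esub> b)
      = z \<odot>\<^bsub>completion A\<^esub> (a \<otimes>\<^bsub>completion A\<^esub> b)" for z
    by (simp_all add: x y completion_rules smult_mult_l smult_mult_r)
  fix c assume "c \<in> carrier (completion A)"
  then obtain w where w: "w \<in> cauchy_seqs A" "c = cls w" by (rule completion_cases)
  show "(a \<otimes>\<^bsub>completion A\<^esub> b) \<otimes>\<^bsub>completion A\<^esub> c
      = a \<otimes>\<^bsub>completion A\<^esub> (b \<otimes>\<^bsub>completion A\<^esub> c)"
    "(a \<oplus>\<^bsub>completion A\<^esub> b) \<otimes>\<^bsub>completion A\<^esub> c
      = a \<otimes>\<^bsub>completion A\<^esub> c \<oplus>\<^bsub>completion A\<^esub> b \<otimes>\<^bsub>completion A\<^esub> c"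
    "c \<otimes>\<^bsub>completion A\<^esub> (a \<oplus>\<^bsub>completion A\<^esub> b)
      = c \<otimes>\<^bsub>completion A\<^esub> a \<oplus>\<^bsub>completion A\<^esub> c \<otimes>\<^bsub>completion A\<^esub> b"
    by (simp_all add: x y w completion_rules m_assoc distr_l distr_r)
next
  have "(\<lambda>k. \<one>) \<in> cauchy_seqs A" by (rule cauchy_seqs_const) (rule one_closed)
  then show "\<one>\<^bsub>completion A\<^esub> \<in> carrier (completion A)"
    unfolding completion_one by (rule cls_closed)
qed

interpretation completion: pre_cstar "completion A"
  by (rule pre_cstar_completion)

lemma cauchy_seqs_uminus: "x \<in> cauchy_seqs A \<Longrightarrow> (\<lambda>k. \<ominus> x k) \<in> cauchy_seqs A"
  using cauchy_seqs_smult[of x "-1"] by (simp add: smult_minus_1)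

lemma cauchy_seqs_minus:
  assumes "x \<in> cauchy_seqs A" "y \<in> cauchy_seqs A"
  shows "(\<lambda>k. x k \<ominus> y k) \<in> cauchy_seqs A"
  using cauchy_seqs_add[OF assms(1) cauchy_seqs_uminus[OF assms(2)]] by (simp add: a_minus_def)

lemma completion_minus_cls:
  assumes x: "x \<in> cauchy_seqs A" and y: "y \<in> cauchy_seqs A"
  shows "cls x \<ominus>\<^bsub>completion A\<^esub> cls y = cls (\<lambda>k. x k \<ominus> y k)"
proof -
  have "cls x \<ominus>\<^bsub>completion A\<^esub> cls y = cls (\<lambda>k. x k \<oplus> (-1) \<odot> y k)"
    using x y by (simp add: completion.minus_conv completion_add_cls completion_smult_cls cauchy_seqs_smult)
  also have "(\<lambda>k. x k \<oplus> (-1) \<odot> y k) = (\<lambda>k. x k \<ominus> y k)"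
    using x y by (intro ext) (simp add: minus_conv)
  finally show ?thesis .
qed

lemma completion_dense:
  assumes a: "a \<in> carrier (completion A)" and e: "e > 0"
  obtains b where "b \<in> carrier A" "nrm (completion A) (a \<ominus>\<^bsub>completion A\<^esub> cls (\<lambda>k. b)) < e"
proof -
  obtain x where x: "x \<in> cauchy_seqs A" "a = cls x" using a by (rule completion_cases)
  obtain N where N: "\<And>i j. i \<ge> N \<Longrightarrow> j \<ge> N \<Longrightarrow> nrm A (x i \<ominus> x j) < e / 2"
    using cauchy_seqsD[OF x(1), of "e / 2"] e by auto
  have c: "(\<lambda>k. x N) \<in> cauchy_seqs A" using x by (intro cauchy_seqs_const) auto
  have "nrm (completion A) (a \<ominus>\<^bsub>completion A\<^esub> cls (\<lambda>k. x N)) \<le> e / 2"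
  proof (rule LIMSEQ_le_const2)
    show "(\<lambda>k. nrm A (x k \<ominus> x N)) \<longlonglongrightarrow> nrm (completion A) (a \<ominus>\<^bsub>completion A\<^esub> cls (\<lambda>k. x N))"
      using tendsto_nrm_cls[OF cauchy_seqs_minus[OF x(1) c]] x c by (simp add: completion_minus_cls)
    show "\<exists>M. \<forall>n\<ge>M. nrm A (x n \<ominus> x N) \<le> e / 2"
      using N by (meson less_imp_le order_refl)
  qed
  then show ?thesis using that[of "x N"] x e by simp
qed

lemma completion_nrm_eq_zero_iff:
  assumes "a \<in> carrier (completion A)"
  shows "nrm (completion A) a = 0 \<longleftrightarrow> a = \<zero>\<^bsub>completion A\<^esub>"
proof
  assume 0: "nrm (completion A) a = 0"
  obtain x where x: "x \<in> cauchy_seqs A" "a = cls x" using assms by (rule completion_cases)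
  have z: "(\<lambda>k. \<zero>) \<in> cauchy_seqs A" by (rule cauchy_seqs_const) simp
  have "(\<lambda>k. nrm A (x k \<ominus> \<zero>)) \<longlonglongrightarrow> 0"
    using tendsto_nrm_cls[OF x(1)] x 0 by (simp add: a_minus_def)
  then show "a = \<zero>\<^bsub>completion A\<^esub>"
    using x z by (simp add: completion_zero cls_eq_iff)
qed (simp add: completion.nrm_zero)

lemma completion_cls_tendsto:
  assumes x: "x \<in> cauchy_seqs A"
  shows "(\<lambda>k. nrm (completion A) (cls (\<lambda>i. x k) \<ominus>\<^bsub>completion A\<^esub> cls x)) \<longlonglongrightarrow> 0"
proof (rule LIMSEQ_I)
  fix e :: real assume e: "e > 0"
  obtain N where N: "\<And>i j. i \<ge> N \<Longrightarrow> j \<ge> N \<Longrightarrow> nrm A (x i \<ominus> x j) < e / 2"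
    using cauchy_seqsD[OF x, of "e / 2"] e by auto
  have "norm (nrm (completion A) (cls (\<lambda>i. x k) \<ominus>\<^bsub>completion A\<^esub> cls x) - 0) < e" if k: "k \<ge> N" for k
  proof -
    have c: "(\<lambda>i. x k) \<in> cauchy_seqs A" using x by (intro cauchy_seqs_const) auto
    have "nrm (completion A) (cls (\<lambda>i. x k) \<ominus>\<^bsub>completion A\<^esub> cls x) \<le> e / 2"
    proof (rule LIMSEQ_le_const2)
      show "(\<lambda>i. nrm A (x k \<ominus> x i)) \<longlonglongrightarrow> nrm (completion A) (cls (\<lambda>i. x k) \<ominus>\<^bsub>completion A\<^esub> cls x)"
        using tendsto_nrm_cls[OF cauchy_seqs_minus[OF c x]] x c by (simp add: completion_minus_cls)
      show "\<exists>M. \<forall>n\<ge>M. nrm A (x k \<ominus> x n) \<le> e / 2"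
        using N k by (meson less_imp_le)
    qed
    then show ?thesis using e x c by simp
  qed
  then show "\<exists>no. \<forall>n\<ge>no. norm (nrm (completion A) (cls (\<lambda>i. x n) \<ominus>\<^bsub>completion A\<^esub> cls x) - 0) < e"
    by blast
qed

text \<open>A Cauchy sequence of classes is within \<open>1/(k+1)\<close> of the class of a constant sequence \<open>b\<^sub>k\<close>; the
  sequence \<open>b\<close> is Cauchy and its class is the limit.\<close>

lemma completion_complete:
  assumes Y: "Y \<in> cauchy_seqs (completion A)"
  shows "\<exists>a\<in>carrier (completion A). (\<lambda>k. nrm (completion A) (Y k \<ominus>\<^bsub>completion A\<^esub> a)) \<longlonglongrightarrow> 0"
proof -
  let ?C = "completion A" and ?c = "\<lambda>b. cls (\<lambda>i. b)"
  have Yc: "Y k \<in> carrier ?C" for k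
    using Y by (rule completion.cauchy_seqs_carrier)
  have "\<exists>b. b \<in> carrier A \<and> nrm ?C (Y k \<ominus>\<^bsub>?C\<^esub> ?c b) < 1 / (real k + 1)" for k
    by (rule completion_dense[OF Yc, of "1 / (real k + 1)" k]) auto
  then obtain b where b: "\<And>k. b k \<in> carrier A"
      and bY: "\<And>k. nrm ?C (Y k \<ominus>\<^bsub>?C\<^esub> ?c (b k)) < 1 / (real k + 1)"
    by metis
  have lim1: "(\<lambda>k. 1 / (real k + 1)) \<longlonglongrightarrow> 0"
    using LIMSEQ_inverse_real_of_nat by (simp add: inverse_eq_divide add.commute)
  have bc: "?c (b k) \<in> carrier ?C" for k
    by (intro cls_closed cauchy_seqs_const b)
  have "b \<in> cauchy_seqs A"
    unfolding cauchy_seqs_def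
  proof (intro CollectI conjI allI impI b)
    fix e :: real assume e: "e > 0"
    obtain N where N: "\<And>i j. i \<ge> N \<Longrightarrow> j \<ge> N \<Longrightarrow> nrm ?C (Y i \<ominus>\<^bsub>?C\<^esub> Y j) < e / 3"
      using completion.cauchy_seqsD[OF Y, of "e / 3"] e by auto
    obtain M where M: "\<And>k. k \<ge> M \<Longrightarrow> 1 / (real k + 1) < e / 3"
      using order_tendstoD(2)[OF lim1, of "e / 3"] e by (auto simp: eventually_sequentially)
    have "nrm A (b i \<ominus> b j) < e" if ij: "i \<ge> max N M" "j \<ge> max N M" for i j
    proof -
      have "nrm A (b i \<ominus> b j) = nrm ?C (?c (b i) \<ominus>\<^bsub>?C\<^esub> ?c (b j))"
        using b by (simp add: completion_minus_cls cauchy_seqs_const nrm_cls_const)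
      also have "\<dots> \<le> nrm ?C (?c (b i) \<ominus>\<^bsub>?C\<^esub> Y i) + nrm ?C (Y i \<ominus>\<^bsub>?C\<^esub> ?c (b j))"
        by (rule completion.nrm_triangle[OF bc Yc bc])
      also have "nrm ?C (Y i \<ominus>\<^bsub>?C\<^esub> ?c (b j)) \<le> nrm ?C (Y i \<ominus>\<^bsub>?C\<^esub> Y j) + nrm ?C (Y j \<ominus>\<^bsub>?C\<^esub> ?c (b j))"
        by (rule completion.nrm_triangle[OF Yc Yc bc])
      also have "nrm ?C (?c (b i) \<ominus>\<^bsub>?C\<^esub> Y i) = nrm ?C (Y i \<ominus>\<^bsub>?C\<^esub> ?c (b i))"
        by (rule completion.nrm_minus_commute[OF bc Yc])
      finally show ?thesis
        using bY[of i] bY[of j] N[of i j] M[of i] M[of j] ij by simp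
    qed
    then show "\<exists>N. \<forall>i\<ge>N. \<forall>j\<ge>N. nrm A (b i \<ominus> b j) < e" by blast
  qed
  note bC = this
  have "(\<lambda>k. 1 / (real k + 1) + nrm ?C (?c (b k) \<ominus>\<^bsub>?C\<^esub> cls b)) \<longlonglongrightarrow> 0 + 0"
    by (intro tendsto_add lim1 completion_cls_tendsto bC)
  then have lim: "(\<lambda>k. 1 / (real k + 1) + nrm ?C (?c (b k) \<ominus>\<^bsub>?C\<^esub> cls b)) \<longlonglongrightarrow> 0"
    by simp
  have cb: "cls b \<in> carrier ?C" using bC by simp
  have "norm (nrm ?C (Y k \<ominus>\<^bsub>?C\<^esub> cls b)) \<le> 1 / (real k + 1) + nrm ?C (?c (b k) \<ominus>\<^bsub>?C\<^esub> cls b)" for k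
    using completion.nrm_triangle[OF Yc bc cb, of k k] bY[of k] completion.nrm_nonneg[of "Y k \<ominus>\<^bsub>?C\<^esub> cls b"]
      completion.minus_closed[OF Yc cb]
    by auto
  then have "(\<lambda>k. nrm ?C (Y k \<ominus>\<^bsub>?C\<^esub> cls b)) \<longlonglongrightarrow> 0"
    by (intro Lim_null_comparison[OF always_eventually lim] allI)
  then show ?thesis using cb by blast
qed

end

locale unital_cstar = pre_cstar +
  assumes nrm_eq_zero_iff: "a \<in> carrier A \<Longrightarrow> nrm A a = 0 \<longleftrightarrow> a = \<zero>"
    and complete: "x \<in> cauchy_seqs A \<Longrightarrow> \<exists>a\<in>carrier A. (\<lambda>k. nrm A (x k \<ominus> a)) \<longlonglongrightarrow> 0"

lemma (in unital_cstar) cstar_algebra: "cstar_algebra A"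
  by (rule cstar_algebra.intro)
    (auto simp: vector_space mult_assoc distr_l distr_r smult_mult_l smult_mult_r star_add star_smult
      star_mult nrm_smult nrm_add nrm_mult cstar_identity nrm_eq_zero_iff complete)

lemma (in pre_cstar) unital_cstar_completion: "unital_cstar (completion A)"
  by (intro unital_cstar.intro unital_cstar_axioms.intro pre_cstar_completion
      completion_nrm_eq_zero_iff completion_complete)

text \<open>Only differences and norms enter the extension of a map to the completions. This covers both
  the restriction to a fibre and the multiplication by a function on the base.\<close>

locale bounded_map = A: pre_cstar A + B: pre_cstar B
  for A :: "('b, 'm) star_alg_scheme" and B :: "('c, 'n) star_alg_scheme" +
  fixes \<phi> :: "'b \<Rightarrow> 'c" and K :: real
  assumes closed: "a \<in> carrier A \<Longrightarrow> \<phi> a \<in> carrier B"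
    and minus: "\<lbrakk>a \<in> carrier A; b \<in> carrier A\<rbrakk> \<Longrightarrow> \<phi> (a \<ominus>\<^bsub>A\<^esub> b) = \<phi> a \<ominus>\<^bsub>B\<^esub> \<phi> b"
    and bounded: "a \<in> carrier A \<Longrightarrow> nrm B (\<phi> a) \<le> K * nrm A a"
begin

lemma cauchy: "x \<in> cauchy_seqs A \<Longrightarrow> (\<lambda>k. \<phi> (x k)) \<in> cauchy_seqs B"
  unfolding cauchy_seqs_def[of B]
proof (intro CollectI conjI allI impI)
  assume x: "x \<in> cauchy_seqs A"
  show "\<phi> (x k) \<in> carrier B" for k using x by (simp add: closed)
  fix e :: real assume e: "e > 0"
  define c where "c = \<bar>K\<bar> + 1"
  have c: "c > 0" by (simp add: c_def)
  obtain N where N: "\<And>i j. i \<ge> N \<Longrightarrow> j \<ge> N \<Longrightarrow> nrm A (x i \<ominus>\<^bsub>A\<^esub> x j) < e / c"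
    using A.cauchy_seqsD[OF x, of "e / c"] e c by auto
  have "nrm B (\<phi> (x i) \<ominus>\<^bsub>B\<^esub> \<phi> (x j)) < e" if "i \<ge> N" "j \<ge> N" for i j
  proof -
    have "nrm B (\<phi> (x i) \<ominus>\<^bsub>B\<^esub> \<phi> (x j)) \<le> K * nrm A (x i \<ominus>\<^bsub>A\<^esub> x j)"
      using bounded[of "x i \<ominus>\<^bsub>A\<^esub> x j"] x by (simp add: minus)
    also have "\<dots> \<le> c * nrm A (x i \<ominus>\<^bsub>A\<^esub> x j)"
      by (rule mult_right_mono) (auto simp: c_def x)
    also have "\<dots> < e" using N[OF that] c by (simp add: field_simps)
    finally show ?thesis .
  qed
  then show "\<exists>N. \<forall>i\<ge>N. \<forall>j\<ge>N. nrm B (\<phi> (x i) \<ominus>\<^bsub>B\<^esub> \<phi> (x j)) < e" by blast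
qed

lemma completion_map_cls:
  assumes x: "x \<in> cauchy_seqs A"
  shows "completion_map B \<phi> (A.cls x) = B.cls (\<lambda>k. \<phi> (x k))"
proof -
  have "(\<Union>y\<in>A.cls x. B.cls (\<lambda>k. \<phi> (y k))) = B.cls (\<lambda>k. \<phi> (x k))"
  proof (rule A.UN_cls[OF x])
    fix y assume y: "y \<in> cauchy_seqs A" "(\<lambda>k. nrm A (x k \<ominus>\<^bsub>A\<^esub> y k)) \<longlonglongrightarrow> 0"
    have lim: "(\<lambda>k. K * nrm A (x k \<ominus>\<^bsub>A\<^esub> y k)) \<longlonglongrightarrow> 0"
      using tendsto_mult[OF tendsto_const y(2), of K] by simp
    have "norm (nrm B (\<phi> (x k) \<ominus>\<^bsub>B\<^esub> \<phi> (y k))) \<le> K * nrm A (x k \<ominus>\<^bsub>A\<^esub> y k)" for k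
      using bounded[of "x k \<ominus>\<^bsub>A\<^esub> y k"] x y by (simp add: minus closed)
    then have "(\<lambda>k. nrm B (\<phi> (x k) \<ominus>\<^bsub>B\<^esub> \<phi> (y k))) \<longlonglongrightarrow> 0"
      by (intro Lim_null_comparison[OF always_eventually lim] allI)
    then show "B.cls (\<lambda>k. \<phi> (y k)) = B.cls (\<lambda>k. \<phi> (x k))"
      using x y by (subst eq_commute) (simp add: B.cls_eq_iff cauchy)
  qed
  then show ?thesis by (simp add: completion_map_def B.cls_def)
qed

lemma completion_map_closed:
  "a \<in> carrier (completion A) \<Longrightarrow> completion_map B \<phi> a \<in> carrier (completion B)"
  by (erule A.completion_cases) (simp add: completion_map_cls cauchy)

lemma completion_map_bounded:
  assumes "a \<in> carrier (completion A)"
  shows "nrm (completion B) (completion_map B \<phi> a) \<le> K * nrm (completion A) a"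
proof -
  obtain x where x: "x \<in> cauchy_seqs A" "a = A.cls x" using assms by (rule A.completion_cases)
  show ?thesis
  proof (rule LIMSEQ_le)
    show "(\<lambda>k. nrm B (\<phi> (x k))) \<longlonglongrightarrow> nrm (completion B) (completion_map B \<phi> a)"
      using B.tendsto_nrm_cls[OF cauchy[OF x(1)]] x by (simp add: completion_map_cls)
    show "(\<lambda>k. K * nrm A (x k)) \<longlonglongrightarrow> K * nrm (completion A) a"
      using A.tendsto_nrm_cls[OF x(1)] x by (intro tendsto_intros) simp
    show "\<exists>N. \<forall>n\<ge>N. nrm B (\<phi> (x n)) \<le> K * nrm A (x n)"
      using x bounded by simp
  qed
qed

lemma completion_map_minus:
  assumes "a \<in> carrier (completion A)" "b \<in> carrier (completion A)"
  shows "completion_map B \<phi> (a \<ominus>\<^bsub>completion A\<^esub> b) = completion_map B \<phi> a \<ominus>\<^bsub>completion B\<^esub> completion_map B \<phi> b"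
proof -
  obtain x where x: "x \<in> cauchy_seqs A" "a = A.cls x" using assms(1) by (rule A.completion_cases)
  obtain y where y: "y \<in> cauchy_seqs A" "b = A.cls y" using assms(2) by (rule A.completion_cases)
  show ?thesis
    using x y by (simp add: A.completion_minus_cls B.completion_minus_cls completion_map_cls cauchy
        A.cauchy_seqs_minus minus)
qed

lemma star_hom_completion_map:
  assumes "star_hom A B \<phi>"
  shows "star_hom (completion A) (completion B) (completion_map B \<phi>)"
  unfolding star_hom_def
proof (intro conjI ballI allI)
  show "completion_map B \<phi> \<in> carrier (completion A) \<rightarrow> carrier (completion B)"
    using completion_map_closed by blast
next
  fix a assume "a \<in> carrier (completion A)"
  then obtain x where x: "x \<in> cauchy_seqs A" "a = A.cls x" by (rule A.completion_cases)
  show "completion_map B \<phi> (z \<odot>\<^bsub>completion A\<^esub> a) = z \<odot>\<^bsub>completion B\<^esub> completion_map B \<phi> a" for z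
    using x assms by (simp add: A.completion_rules B.completion_rules completion_map_cls cauchy star_hom_def)
  show "completion_map B \<phi> (star (completion A) a) = star (completion B) (completion_map B \<phi> a)"
    using x assms by (simp add: A.completion_rules B.completion_rules completion_map_cls cauchy star_hom_def)
  fix b assume "b \<in> carrier (completion A)"
  then obtain y where y: "y \<in> cauchy_seqs A" "b = A.cls y" by (rule A.completion_cases)
  show "completion_map B \<phi> (a \<oplus>\<^bsub>completion A\<^esub> b)
      = completion_map B \<phi> a \<oplus>\<^bsub>completion B\<^esub> completion_map B \<phi> b"
    "completion_map B \<phi> (a \<otimes>\<^bsub>completion A\<^esub> b)
      = completion_map B \<phi> a \<otimes>\<^bsub>completion B\<^esub> completion_map B \<phi> b"
    using x y assms by (simp_all add: A.completion_rules B.completion_rules completion_map_cls cauchy star_hom_def)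
qed

end

section \<open>The reduced norm of a discrete group\<close>

definition supp :: "('x \<Rightarrow> complex) \<Rightarrow> 'x set" where
  "supp f = {x. f x \<noteq> 0}"

text \<open>The \<open>l\<^sup>2\<close> norm of a function of finite support, as a finite sum, free of summability conditions.\<close>

definition n2 :: "('x \<Rightarrow> complex) \<Rightarrow> real" where
  "n2 f = L2_set (\<lambda>x. cmod (f x)) (supp f)"

lemma n2_eq: "\<lbrakk>finite S; supp f \<subseteq> S\<rbrakk> \<Longrightarrow> n2 f = L2_set (\<lambda>x. cmod (f x)) S"
  unfolding n2_def L2_set_def by (intro arg_cong[where f=sqrt] sum.mono_neutral_left) (auto simp: supp_def)

lemma n2_nonneg [simp]: "n2 f \<ge> 0"
  by (simp add: n2_def)

lemma n2_sq: "\<lbrakk>finite S; supp f \<subseteq> S\<rbrakk> \<Longrightarrow> (n2 f)\<^sup>2 = (\<Sum>x\<in>S. (cmod (f x))\<^sup>2)"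
  by (simp add: n2_eq L2_set_def sum_nonneg)

lemma n2_add:
  assumes "finite (supp f)" "finite (supp g)"
  shows "n2 (\<lambda>x. f x + g x) \<le> n2 f + n2 g"
proof -
  let ?S = "supp f \<union> supp g"
  have "n2 (\<lambda>x. f x + g x) = L2_set (\<lambda>x. cmod (f x + g x)) ?S"
    by (rule n2_eq) (use assms in \<open>auto simp: supp_def\<close>)
  also have "\<dots> \<le> L2_set (\<lambda>x. cmod (f x) + cmod (g x)) ?S"
    by (rule L2_set_mono) (auto simp: norm_triangle_ineq)
  also have "\<dots> \<le> L2_set (\<lambda>x. cmod (f x)) ?S + L2_set (\<lambda>x. cmod (g x)) ?S"
    by (rule L2_set_triangle_ineq)
  also have "\<dots> = n2 f + n2 g"
    using assms by (simp add: n2_eq[of ?S])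
  finally show ?thesis .
qed

lemma n2_smult: "finite (supp f) \<Longrightarrow> n2 (\<lambda>x. z * f x) = cmod z * n2 f"
proof -
  assume f: "finite (supp f)"
  then have "n2 (\<lambda>x. z * f x) = L2_set (\<lambda>x. cmod (z * f x)) (supp f)"
    by (intro n2_eq) (auto simp: supp_def)
  then show ?thesis by (simp add: norm_mult L2_set_right_distrib n2_def)
qed

lemma cmod_le_n2: "finite (supp f) \<Longrightarrow> cmod (f x) \<le> n2 f"
  by (cases "f x = 0") (auto simp: n2_def supp_def intro: member_le_L2_set[of "{x. f x \<noteq> 0}" x "\<lambda>x. cmod (f x)"])

lemma cmod_sum_le_n2:
  assumes "finite S" "supp f \<subseteq> S" "supp g \<subseteq> S"
  shows "cmod (\<Sum>x\<in>S. cnj (g x) * f x) \<le> n2 g * n2 f"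
proof -
  have "cmod (\<Sum>x\<in>S. cnj (g x) * f x) \<le> (\<Sum>x\<in>S. \<bar>cmod (g x)\<bar> * \<bar>cmod (f x)\<bar>)"
    by (rule order_trans[OF norm_sum]) (simp add: norm_mult)
  also have "\<dots> \<le> L2_set (\<lambda>x. cmod (g x)) S * L2_set (\<lambda>x. cmod (f x)) S"
    by (rule L2_set_mult_ineq)
  finally show ?thesis using assms by (simp add: n2_eq)
qed

context group
begin

abbreviation "\<Gamma> \<equiv> group_groupoid G"

lemma arrows_group [simp]: "arrows \<Gamma> = carrier G"
  and src_group [simp]: "src \<Gamma> x = \<one>"
  and rng_group [simp]: "rng \<Gamma> x = \<one>"
  and comp_group [simp]: "comp \<Gamma> x y = x \<otimes> y"
  and ginv_group [simp]: "ginv \<Gamma> x = inv x"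
  and gunits_group [simp]: "gunits \<Gamma> = {\<one>}"
  and src_fibre_group [simp]: "src_fibre \<Gamma> \<one> = carrier G"
  and rng_fibre_group [simp]: "rng_fibre \<Gamma> \<one> = carrier G"
  by (auto simp: arrows_def group_groupoid_def gunits_def src_fibre_def rng_fibre_def)

lemma Cc_group_iff: "f \<in> Cc \<Gamma> \<longleftrightarrow> finite (supp f) \<and> supp f \<subseteq> carrier G"
proof -
  have "{x \<in> carrier G. f x \<noteq> 0} = supp f" if "\<forall>x. x \<notin> carrier G \<longrightarrow> f x = 0"
    using that by (auto simp: supp_def)
  moreover have "arr_top \<Gamma> = discrete_topology (carrier G)"
    by (simp add: group_groupoid_def)
  moreover have "(\<forall>x. x \<notin> carrier G \<longrightarrow> f x = 0) \<longleftrightarrow> supp f \<subseteq> carrier G"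
    by (auto simp: supp_def)
  ultimately show ?thesis
    by (auto simp: Cc_def discrete_topology_closure_of compactin_discrete_topology Int_absorb1)
qed

lemma CcD: assumes "f \<in> Cc \<Gamma>"
  shows "finite (supp f)" "supp f \<subseteq> carrier G" "x \<notin> carrier G \<Longrightarrow> f x = 0"
  using assms by (auto simp: Cc_group_iff supp_def)

lemma inv_mult_cancel: "\<lbrakk>x \<in> carrier G; y \<in> carrier G\<rbrakk> \<Longrightarrow> inv x \<otimes> (x \<otimes> y) = y"
  and mult_inv_cancel: "\<lbrakk>x \<in> carrier G; y \<in> carrier G\<rbrakk> \<Longrightarrow> x \<otimes> (inv x \<otimes> y) = y"
  by (simp_all add: m_assoc[symmetric])

lemmas group_cancel = inv_mult_group m_assoc inv_mult_cancel mult_inv_cancel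

lemma bij_betw_inv_mult: "x \<in> carrier G \<Longrightarrow> bij_betw (\<lambda>z. inv z \<otimes> x) (carrier G) (carrier G)"
  by (rule bij_betwI[where g="\<lambda>y. x \<otimes> inv y"]) (auto simp: group_cancel)

lemma bij_betw_inv: "bij_betw (\<lambda>z. inv z) (carrier G) (carrier G)"
  by (rule bij_betwI[where g="\<lambda>y. inv y"]) auto

lemma infsum_conv:
  assumes "x \<in> carrier G"
  shows "(\<Sum>\<^sub>\<infinity>y\<in>carrier G. f (x \<otimes> inv y) * g y) = (\<Sum>\<^sub>\<infinity>z\<in>carrier G. f z * g (inv z \<otimes> x) :: complex)"
proof -
  have "(\<Sum>\<^sub>\<infinity>y\<in>carrier G. f (x \<otimes> inv y) * g y)
      = (\<Sum>\<^sub>\<infinity>z\<in>carrier G. f (x \<otimes> inv (inv z \<otimes> x)) * g (inv z \<otimes> x))"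
    by (rule infsum_reindex_bij_betw[OF bij_betw_inv_mult[OF assms], symmetric])
  also have "\<dots> = (\<Sum>\<^sub>\<infinity>z\<in>carrier G. f z * g (inv z \<otimes> x))"
    by (rule infsum_cong) (use assms in \<open>simp add: inv_mult_group m_assoc[symmetric]\<close>)
  finally show ?thesis .
qed

lemma infsum_supp:
  assumes "finite S" "supp f \<subseteq> S" "S \<subseteq> carrier G"
  shows "(\<Sum>\<^sub>\<infinity>z\<in>carrier G. f z * h z) = (\<Sum>z\<in>S. f z * h z)"
proof -
  have "(\<Sum>\<^sub>\<infinity>z\<in>carrier G. f z * h z) = (\<Sum>\<^sub>\<infinity>z\<in>S. f z * h z)"
    by (rule infsum_cong_neutral) (use assms in \<open>auto simp: supp_def\<close>)
  then show ?thesis using assms by (simp add: infsum_finite)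
qed

lemma conv_infsum:
  "x \<in> carrier G \<Longrightarrow> conv \<Gamma> f g x = (\<Sum>\<^sub>\<infinity>z\<in>carrier G. f z * g (inv z \<otimes> x))"
  by (simp add: conv_def infsum_conv)

lemma conv_off: "x \<notin> carrier G \<Longrightarrow> conv \<Gamma> f g x = 0"
  by (simp add: conv_def)

lemma conv_eq:
  assumes "finite S" "supp f \<subseteq> S" "S \<subseteq> carrier G" "x \<in> carrier G"
  shows "conv \<Gamma> f g x = (\<Sum>z\<in>S. f z * g (inv z \<otimes> x))"
  using assms by (simp add: conv_infsum infsum_supp)

lemma regular_rep_eq:
  assumes "finite S" "supp f \<subseteq> S" "S \<subseteq> carrier G" "x \<in> carrier G"
  shows "regular_rep \<Gamma> \<one> f \<xi> x = (\<Sum>z\<in>S. f z * \<xi> (inv z \<otimes> x))"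
  using assms by (simp add: regular_rep_def infsum_conv infsum_supp)

lemma supp_conv:
  assumes f: "f \<in> Cc \<Gamma>"
  shows "supp (conv \<Gamma> f g) \<subseteq> (\<lambda>(z, w). z \<otimes> w) ` (supp f \<times> (supp g \<inter> carrier G))"
proof
  fix x assume x: "x \<in> supp (conv \<Gamma> f g)"
  then have xG: "x \<in> carrier G"
    using conv_off by (auto simp: supp_def)
  have "(\<Sum>z\<in>supp f. f z * g (inv z \<otimes> x)) \<noteq> 0"
    using x conv_eq[OF CcD(1)[OF f] order_refl CcD(2)[OF f] xG, of g] by (simp add: supp_def)
  then obtain z where z: "z \<in> supp f" "f z * g (inv z \<otimes> x) \<noteq> 0"
    by (meson sum.neutral)
  then have "inv z \<otimes> x \<in> supp g \<inter> carrier G" "x = z \<otimes> (inv z \<otimes> x)"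
    using xG CcD(2)[OF f] by (auto simp: supp_def m_assoc[symmetric])
  then show "x \<in> (\<lambda>(z, w). z \<otimes> w) ` (supp f \<times> (supp g \<inter> carrier G))"
    using z by force
qed

lemma conv_closed [intro]:
  assumes f: "f \<in> Cc \<Gamma>" and g: "g \<in> Cc \<Gamma>"
  shows "conv \<Gamma> f g \<in> Cc \<Gamma>"
  unfolding Cc_group_iff
proof
  show "finite (supp (conv \<Gamma> f g))"
    by (rule finite_subset[OF supp_conv[OF f]]) (use CcD(1)[OF f] CcD(1)[OF g] in auto)
  show "supp (conv \<Gamma> f g) \<subseteq> carrier G"
    using conv_off by (auto simp: supp_def)
qed

lemma add_closed [intro]: "\<lbrakk>f \<in> Cc \<Gamma>; g \<in> Cc \<Gamma>\<rbrakk> \<Longrightarrow> (\<lambda>x. f x + g x) \<in> Cc \<Gamma>"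
  unfolding Cc_group_iff
  by (auto simp: supp_def intro: finite_subset[of _ "{x. f x \<noteq> 0} \<union> {x. g x \<noteq> 0}"])
    (metis (mono_tags, lifting) add_0 mem_Collect_eq subset_iff)

lemma smult_closed [intro]: "f \<in> Cc \<Gamma> \<Longrightarrow> (\<lambda>x. z * f x) \<in> Cc \<Gamma>"
  unfolding Cc_group_iff by (auto simp: supp_def intro: finite_subset[of _ "{x. f x \<noteq> 0}"])

lemma zero_closed [intro]: "(\<lambda>x. 0) \<in> Cc \<Gamma>"
  by (simp add: Cc_group_iff supp_def)

lemma supp_gstar: "f \<in> Cc \<Gamma> \<Longrightarrow> supp (gstar \<Gamma> f) = (\<lambda>x. inv x) ` supp f"
  unfolding gstar_def supp_def using CcD(3)[of f]
  by (auto intro!: image_eqI[where x="inv x" for x] split: if_splits) (metis inv_inv)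

lemma gstar_closed [intro]: "f \<in> Cc \<Gamma> \<Longrightarrow> gstar \<Gamma> f \<in> Cc \<Gamma>"
  unfolding Cc_group_iff[of "gstar \<Gamma> f"] using CcD(1,2)[of f] by (simp add: supp_gstar image_subset_iff) blast

definition \<delta> :: "'a \<Rightarrow> complex" where
  "\<delta> x = (if x = \<one> then 1 else 0)"

lemma delta_closed [intro, simp]: "\<delta> \<in> Cc \<Gamma>"
  by (auto simp: Cc_group_iff supp_def \<delta>_def intro: finite_subset[of _ "{\<one>}"])

lemma conv_delta_left: "f \<in> Cc \<Gamma> \<Longrightarrow> conv \<Gamma> \<delta> f = f"
proof
  fix x assume f: "f \<in> Cc \<Gamma>"
  show "conv \<Gamma> \<delta> f x = f x"
  proof (cases "x \<in> carrier G")
    case True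
    then show ?thesis
      using conv_eq[of "{\<one>}" \<delta> x f] by (simp add: supp_def \<delta>_def)
  qed (simp add: conv_off CcD(3)[OF f])
qed

lemma conv_delta_right: "f \<in> Cc \<Gamma> \<Longrightarrow> conv \<Gamma> f \<delta> = f"
proof
  fix x assume f: "f \<in> Cc \<Gamma>"
  show "conv \<Gamma> f \<delta> x = f x"
  proof (cases "x \<in> carrier G")
    case True
    have "conv \<Gamma> f \<delta> x = (\<Sum>z\<in>insert x (supp f). f z * \<delta> (inv z \<otimes> x))"
      by (rule conv_eq) (use f True CcD in auto)
    also have "\<dots> = (\<Sum>z\<in>insert x (supp f). if z = x then f z else 0)"
    proof (rule sum.cong)
      fix z assume z: "z \<in> insert x (supp f)"
      then have zG: "z \<in> carrier G" using CcD(2)[OF f] True by blast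
      then have "inv z \<otimes> x = \<one> \<longleftrightarrow> z = x"
        using True by (metis inv_closed inv_equality inv_inv l_inv)
      then show "f z * \<delta> (inv z \<otimes> x) = (if z = x then f z else 0)"
        by (simp add: \<delta>_def)
    qed simp
    also have "\<dots> = f x"
      using CcD(1)[OF f] by (simp add: sum.delta)
    finally show ?thesis .
  qed (simp add: conv_off CcD(3)[OF f])
qed

lemma conv_assoc:
  assumes f: "f \<in> Cc \<Gamma>" and g: "g \<in> Cc \<Gamma>"
  shows "conv \<Gamma> (conv \<Gamma> f g) h = conv \<Gamma> f (conv \<Gamma> g h)"
proof
  fix x
  show "conv \<Gamma> (conv \<Gamma> f g) h x = conv \<Gamma> f (conv \<Gamma> g h) x"
  proof (cases "x \<in> carrier G")
    case True
    define S where "S = (\<lambda>(z, w). z \<otimes> w) ` (supp f \<times> supp g)"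
    note F = CcD(1)[OF f] CcD(2)[OF f] and H = CcD(1)[OF g] CcD(2)[OF g]
    have S: "finite S" "S \<subseteq> carrier G" "supp (conv \<Gamma> f g) \<subseteq> S"
      using F H supp_conv[OF f, of g] by (auto simp: S_def)
    have "conv \<Gamma> (conv \<Gamma> f g) h x = (\<Sum>u\<in>S. conv \<Gamma> f g u * h (inv u \<otimes> x))"
      by (rule conv_eq) (use S True in auto)
    also have "\<dots> = (\<Sum>u\<in>S. (\<Sum>z\<in>supp f. f z * g (inv z \<otimes> u)) * h (inv u \<otimes> x))"
      by (rule sum.cong) (use S F conv_eq[OF F(1) order_refl F(2)] in auto)
    also have "\<dots> = (\<Sum>z\<in>supp f. \<Sum>u\<in>S. f z * (g (inv z \<otimes> u) * h (inv u \<otimes> x)))"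
      unfolding sum_distrib_right by (subst sum.swap) (simp add: mult.assoc)
    also have "\<dots> = (\<Sum>z\<in>supp f. f z * conv \<Gamma> g h (inv z \<otimes> x))"
    proof (rule sum.cong)
      fix z assume z: "z \<in> supp f"
      then have zG: "z \<in> carrier G" using F by blast
      have inj: "inj_on (\<lambda>u. inv z \<otimes> u) S"
        using zG S by (intro inj_onI) (auto simp: subset_iff)
      have "(\<Sum>u\<in>S. g (inv z \<otimes> u) * h (inv u \<otimes> x))
          = (\<Sum>w\<in>(\<lambda>u. inv z \<otimes> u) ` S. g w * h (inv w \<otimes> (inv z \<otimes> x)))"
        unfolding sum.reindex[OF inj] o_def
        by (rule sum.cong) (use zG S True in \<open>auto simp: group_cancel subset_iff\<close>)
      also have "\<dots> = conv \<Gamma> g h (inv z \<otimes> x)"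
      proof (rule conv_eq[symmetric])
        show "supp g \<subseteq> (\<lambda>u. inv z \<otimes> u) ` S"
        proof
          fix w assume "w \<in> supp g"
          then have "z \<otimes> w \<in> S" "w = inv z \<otimes> (z \<otimes> w)"
            using z zG H by (auto simp: S_def m_assoc[symmetric] subset_iff)
          then show "w \<in> (\<lambda>u. inv z \<otimes> u) ` S" by blast
        qed
      qed (use S zG True in \<open>auto simp: subset_iff\<close>)
      finally show "(\<Sum>u\<in>S. f z * (g (inv z \<otimes> u) * h (inv u \<otimes> x))) = f z * conv \<Gamma> g h (inv z \<otimes> x)"
        by (simp flip: sum_distrib_left)
    qed simp
    also have "\<dots> = conv \<Gamma> f (conv \<Gamma> g h) x"
      by (rule conv_eq[symmetric]) (use F True in auto)
    finally show ?thesis .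
  qed (simp add: conv_off)
qed

lemma conv_add_left:
  assumes "f \<in> Cc \<Gamma>" "g \<in> Cc \<Gamma>"
  shows "conv \<Gamma> (\<lambda>x. f x + g x) h = (\<lambda>x. conv \<Gamma> f h x + conv \<Gamma> g h x)"
proof
  fix x
  note C = CcD[OF assms(1)] CcD[OF assms(2)]
  have "supp (\<lambda>x. f x + g x) \<subseteq> supp f \<union> supp g" by (auto simp: supp_def)
  then show "conv \<Gamma> (\<lambda>x. f x + g x) h x = conv \<Gamma> f h x + conv \<Gamma> g h x"
    using C conv_eq[of "supp f \<union> supp g" _ x h]
    by (cases "x \<in> carrier G") (auto simp: conv_off sum.distrib distrib_right)
qed

lemma conv_add_right:
  assumes "f \<in> Cc \<Gamma>"
  shows "conv \<Gamma> f (\<lambda>x. g x + h x) = (\<lambda>x. conv \<Gamma> f g x + conv \<Gamma> f h x)"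
proof
  fix x
  show "conv \<Gamma> f (\<lambda>x. g x + h x) x = conv \<Gamma> f g x + conv \<Gamma> f h x"
    using CcD[OF assms] conv_eq[of "supp f" f x]
    by (cases "x \<in> carrier G") (auto simp: conv_off sum.distrib distrib_left)
qed

lemma conv_smult_left:
  assumes "f \<in> Cc \<Gamma>"
  shows "conv \<Gamma> (\<lambda>x. z * f x) h = (\<lambda>x. z * conv \<Gamma> f h x)"
proof
  fix x
  have "supp (\<lambda>x. z * f x) \<subseteq> supp f" by (auto simp: supp_def)
  then show "conv \<Gamma> (\<lambda>x. z * f x) h x = z * conv \<Gamma> f h x"
    using CcD[OF assms] conv_eq[of "supp f" _ x h]
    by (cases "x \<in> carrier G") (auto simp: conv_off sum_distrib_left mult.assoc)
qed

lemma conv_smult_right: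
  assumes "f \<in> Cc \<Gamma>"
  shows "conv \<Gamma> f (\<lambda>x. z * g x) = (\<lambda>x. z * conv \<Gamma> f g x)"
proof
  fix x
  show "conv \<Gamma> f (\<lambda>x. z * g x) x = z * conv \<Gamma> f g x"
    using CcD[OF assms] conv_eq[of "supp f" f x]
    by (cases "x \<in> carrier G") (auto simp: conv_off sum_distrib_left mult_ac)
qed

lemma gstar_gstar: "f \<in> Cc \<Gamma> \<Longrightarrow> gstar \<Gamma> (gstar \<Gamma> f) = f"
  by (auto simp: gstar_def fun_eq_iff CcD)

lemma gstar_conv:
  assumes "f \<in> Cc \<Gamma>" "g \<in> Cc \<Gamma>"
  shows "gstar \<Gamma> (conv \<Gamma> f g) = conv \<Gamma> (gstar \<Gamma> g) (gstar \<Gamma> f)"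
proof
  fix x
  show "gstar \<Gamma> (conv \<Gamma> f g) x = conv \<Gamma> (gstar \<Gamma> g) (gstar \<Gamma> f) x"
  proof (cases "x \<in> carrier G")
    case True
    have "gstar \<Gamma> (conv \<Gamma> f g) x = (\<Sum>\<^sub>\<infinity>y\<in>carrier G. cnj (f (inv x \<otimes> inv y) * g y))"
      using True by (simp add: gstar_def conv_def infsum_cnj[symmetric])
    also have "\<dots> = (\<Sum>\<^sub>\<infinity>z\<in>carrier G. cnj (f (inv x \<otimes> inv (inv z)) * g (inv z)))"
      by (rule infsum_reindex_bij_betw[OF bij_betw_inv, symmetric])
    also have "\<dots> = (\<Sum>\<^sub>\<infinity>z\<in>carrier G. gstar \<Gamma> g z * gstar \<Gamma> f (inv z \<otimes> x))"
      by (rule infsum_cong) (use True in \<open>simp add: gstar_def inv_mult_group\<close>)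
    also have "\<dots> = conv \<Gamma> (gstar \<Gamma> g) (gstar \<Gamma> f) x"
      using True by (simp add: conv_infsum)
    finally show ?thesis .
  qed (simp add: conv_off gstar_def)
qed

text \<open>The value at the unit of \<open>g\<^sup>* f\<close> is the \<open>l\<^sup>2\<close> inner product, which turns the Hilbert space
  computations below into computations in the group algebra.\<close>

lemma conv_gstar_one:
  assumes f: "f \<in> Cc \<Gamma>" and g: "g \<in> Cc \<Gamma>" and S: "finite S" "S \<subseteq> carrier G" "supp g \<subseteq> S"
  shows "conv \<Gamma> (gstar \<Gamma> g) f \<one> = (\<Sum>x\<in>S. cnj (g x) * f x)"
proof -
  have inj: "inj_on (\<lambda>x. inv x) S"
    using S(2) by (intro inj_onI) (metis inv_inv subsetD)
  have "conv \<Gamma> (gstar \<Gamma> g) f \<one> = (\<Sum>z\<in>(\<lambda>x. inv x) ` S. gstar \<Gamma> g z * f (inv z \<otimes> \<one>))"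
    by (rule conv_eq) (use S supp_gstar[OF g] in auto)
  also have "\<dots> = (\<Sum>x\<in>S. cnj (g x) * f x)"
    unfolding sum.reindex[OF inj] o_def by (rule sum.cong) (use S in \<open>auto simp: gstar_def subset_iff\<close>)
  finally show ?thesis .
qed

lemma conv_gstar_one_le:
  assumes f: "f \<in> Cc \<Gamma>" and g: "g \<in> Cc \<Gamma>"
  shows "cmod (conv \<Gamma> (gstar \<Gamma> g) f \<one>) \<le> n2 g * n2 f"
proof -
  have "conv \<Gamma> (gstar \<Gamma> g) f \<one> = (\<Sum>x\<in>supp f \<union> supp g. cnj (g x) * f x)"
    by (rule conv_gstar_one[OF f g]) (use CcD[OF f] CcD[OF g] in auto)
  then show ?thesis
    using cmod_sum_le_n2[of "supp f \<union> supp g" f g] CcD(1)[OF f] CcD(1)[OF g] by simp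
qed

lemma conv_gstar_one_self:
  assumes f: "f \<in> Cc \<Gamma>"
  shows "conv \<Gamma> (gstar \<Gamma> f) f \<one> = of_real ((n2 f)\<^sup>2)"
proof -
  have "conv \<Gamma> (gstar \<Gamma> f) f \<one> = (\<Sum>x\<in>supp f. cnj (f x) * f x)"
    by (rule conv_gstar_one[OF f f]) (use CcD[OF f] in auto)
  also have "\<dots> = (\<Sum>x\<in>supp f. of_real ((cmod (f x))\<^sup>2))"
    by (rule sum.cong) (simp_all only: complex_norm_square mult.commute)
  also have "\<dots> = of_real ((n2 f)\<^sup>2)"
    using n2_sq[OF CcD(1)[OF f] order_refl] by simp
  finally show ?thesis .
qed

lemma n2_translate:
  assumes g: "g \<in> Cc \<Gamma>" and z: "z \<in> carrier G"
  shows "(\<lambda>x. if x \<in> carrier G then g (inv z \<otimes> x) else 0) \<in> Cc \<Gamma>" (is "?h \<in> _")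
    and "n2 (\<lambda>x. if x \<in> carrier G then g (inv z \<otimes> x) else 0) = n2 g"
proof -
  note C = CcD[OF g]
  have sup: "supp ?h \<subseteq> (\<lambda>x. z \<otimes> x) ` supp g"
  proof
    fix x assume "x \<in> supp ?h"
    then have "x \<in> carrier G" "inv z \<otimes> x \<in> supp g" by (auto simp: supp_def split: if_splits)
    moreover have "x = z \<otimes> (inv z \<otimes> x)" using \<open>x \<in> carrier G\<close> z by (simp add: m_assoc[symmetric])
    ultimately show "x \<in> (\<lambda>x. z \<otimes> x) ` supp g" by blast
  qed
  show "?h \<in> Cc \<Gamma>"
    unfolding Cc_group_iff using sup C z by (auto intro: finite_subset)
  have inj: "inj_on (\<lambda>x. z \<otimes> x) (supp g)"
    using C z by (intro inj_onI) (auto simp: subset_iff)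
  have "n2 ?h = L2_set (\<lambda>x. cmod (?h x)) ((\<lambda>x. z \<otimes> x) ` supp g)"
    by (rule n2_eq) (use sup C in auto)
  also have "\<dots> = n2 g"
    unfolding n2_def L2_set_def sum.reindex[OF inj] o_def
    using C(2) z by (intro arg_cong[where f=sqrt] sum.cong) (auto simp: m_assoc[symmetric] subset_iff)
  finally show "n2 ?h = n2 g" .
qed

text \<open>Convolution by \<open>f\<close> is the combination of the left translations, which preserve the \<open>l\<^sup>2\<close> norm, with
  coefficients \<open>f(z)\<close>. This first bound shows that the supremum defining the reduced norm is finite.\<close>

lemma n2_conv_le_sum:
  assumes f: "f \<in> Cc \<Gamma>" and g: "g \<in> Cc \<Gamma>"
  shows "n2 (conv \<Gamma> f g) \<le> (\<Sum>z\<in>supp f. cmod (f z)) * n2 g"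
proof -
  have "finite F \<Longrightarrow> F \<subseteq> carrier G \<Longrightarrow>
      (\<lambda>x. if x \<in> carrier G then \<Sum>z\<in>F. f z * g (inv z \<otimes> x) else 0) \<in> Cc \<Gamma> \<and>
      n2 (\<lambda>x. if x \<in> carrier G then \<Sum>z\<in>F. f z * g (inv z \<otimes> x) else 0) \<le> (\<Sum>z\<in>F. cmod (f z)) * n2 g" for F
  proof (induction F rule: finite_induct)
    case empty
    have "(\<lambda>x. if x \<in> carrier G then \<Sum>z\<in>{}. f z * g (inv z \<otimes> x) else 0) = (\<lambda>x. 0)"
      by auto
    then show ?case by (simp only:) (simp add: zero_closed n2_def supp_def)
  next
    case (insert z F)
    let ?a = "\<lambda>x. f z * (if x \<in> carrier G then g (inv z \<otimes> x) else 0)"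
    let ?b = "\<lambda>x. if x \<in> carrier G then \<Sum>z\<in>F. f z * g (inv z \<otimes> x) else 0"
    have a: "?a \<in> Cc \<Gamma>" and b: "?b \<in> Cc \<Gamma>"
      using n2_translate[OF g, of z] insert by auto
    have eq: "(\<lambda>x. if x \<in> carrier G then \<Sum>z\<in>insert z F. f z * g (inv z \<otimes> x) else 0) = (\<lambda>x. ?a x + ?b x)"
      using insert by auto
    have "n2 (\<lambda>x. ?a x + ?b x) \<le> n2 ?a + n2 ?b"
      by (rule n2_add) (use a b CcD in auto)
    also have "n2 ?a = cmod (f z) * n2 g"
      using n2_translate[OF g, of z] insert by (subst n2_smult) (auto simp: CcD)
    finally show ?case
      unfolding eq using insert a b by (auto simp: distrib_right)
  qed
  from this[of "supp f"] have "n2 (\<lambda>x. if x \<in> carrier G then \<Sum>z\<in>supp f. f z * g (inv z \<otimes> x) else 0)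
      \<le> (\<Sum>z\<in>supp f. cmod (f z)) * n2 g"
    using CcD[OF f] by auto
  also have "(\<lambda>x. if x \<in> carrier G then \<Sum>z\<in>supp f. f z * g (inv z \<otimes> x) else 0) = conv \<Gamma> f g"
    using conv_eq[of "supp f" f _ g] CcD[OF f] by (auto simp: conv_off)
  finally show ?thesis .
qed

lemma l2_norm_eq_n2: "f \<in> Cc \<Gamma> \<Longrightarrow> l2_norm (carrier G) f = n2 f"
proof -
  assume f: "f \<in> Cc \<Gamma>"
  have "(\<Sum>\<^sub>\<infinity>x\<in>carrier G. (cmod (f x))\<^sup>2) = (\<Sum>\<^sub>\<infinity>x\<in>supp f. (cmod (f x))\<^sup>2)"
    by (rule infsum_cong_neutral) (use CcD[OF f] in \<open>auto simp: supp_def\<close>)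
  then show ?thesis
    using CcD(1)[OF f] by (simp add: l2_norm_def n2_def L2_set_def infsum_finite)
qed

lemma Cc_in_l2_set: "f \<in> Cc \<Gamma> \<Longrightarrow> f \<in> l2_set (carrier G)"
proof -
  assume f: "f \<in> Cc \<Gamma>"
  have "(\<lambda>x. (cmod (f x))\<^sup>2) summable_on supp f" using CcD(1)[OF f] by (rule summable_on_finite)
  then have "(\<lambda>x. (cmod (f x))\<^sup>2) summable_on carrier G"
    by (rule summable_on_cong_neutral[THEN iffD1, rotated -1]) (use CcD[OF f] in \<open>auto simp: supp_def\<close>)
  then show ?thesis by (simp add: l2_set_def)
qed

text \<open>A coordinate of \<open>f * \<xi>\<close> depends on finitely many coordinates of \<open>\<xi>\<close> only, so a bound on finitely
  supported vectors is a bound on all of \<open>l\<^sup>2\<close>.\<close>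

lemma regular_rep_bound:
  assumes f: "f \<in> Cc \<Gamma>" and c: "c \<ge> 0"
    and le: "\<And>g. g \<in> Cc \<Gamma> \<Longrightarrow> n2 (conv \<Gamma> f g) \<le> c * n2 g"
    and \<xi>: "\<xi> \<in> l2_set (carrier G)"
  shows "l2_norm (carrier G) (regular_rep \<Gamma> \<one> f \<xi>) \<le> c * l2_norm (carrier G) \<xi>"
proof -
  let ?h = "\<lambda>x. (cmod (regular_rep \<Gamma> \<one> f \<xi> x))\<^sup>2" and ?s = "\<Sum>\<^sub>\<infinity>x\<in>carrier G. (cmod (\<xi> x))\<^sup>2"
  note F = CcD(1)[OF f] CcD(2)[OF f]
  have sm: "(\<lambda>x. (cmod (\<xi> x))\<^sup>2) summable_on carrier G" using \<xi> by (simp add: l2_set_def)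
  have fin: "sum ?h B \<le> c\<^sup>2 * ?s" if B: "finite B" "B \<subseteq> carrier G" for B
  proof -
    define T where "T = (\<lambda>(z, x). inv z \<otimes> x) ` (supp f \<times> B)"
    define g where "g y = (if y \<in> T then \<xi> y else 0)" for y
    have T: "finite T" "T \<subseteq> carrier G" using F B by (auto simp: T_def)
    have sg: "supp g \<subseteq> T" by (auto simp: supp_def g_def split: if_splits)
    have g: "g \<in> Cc \<Gamma>" using T sg by (auto simp: Cc_group_iff intro: finite_subset)
    have "regular_rep \<Gamma> \<one> f \<xi> x = conv \<Gamma> f g x" if x: "x \<in> B" for x
    proof -
      have xG: "x \<in> carrier G" using x B by blast
      show ?thesis
        unfolding regular_rep_eq[OF F(1) order_refl F(2) xG] conv_eq[OF F(1) order_refl F(2) xG]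
        by (rule sum.cong) (use x in \<open>auto simp: g_def T_def\<close>)
    qed
    then have "sum ?h B = (\<Sum>x\<in>B. (cmod (conv \<Gamma> f g x))\<^sup>2)" by simp
    also have "\<dots> \<le> (\<Sum>x\<in>B \<union> supp (conv \<Gamma> f g). (cmod (conv \<Gamma> f g x))\<^sup>2)"
      using B CcD(1)[OF conv_closed[OF f g]] by (intro sum_mono2) auto
    also have "\<dots> = (n2 (conv \<Gamma> f g))\<^sup>2"
      using B CcD(1)[OF conv_closed[OF f g]] by (intro n2_sq[symmetric]) auto
    also have "\<dots> \<le> (c * n2 g)\<^sup>2" by (intro power_mono le g) simp
    also have "\<dots> = c\<^sup>2 * (\<Sum>x\<in>T. (cmod (g x))\<^sup>2)"
      using T sg by (simp add: power_mult_distrib n2_sq)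
    also have "(\<Sum>x\<in>T. (cmod (g x))\<^sup>2) = (\<Sum>x\<in>T. (cmod (\<xi> x))\<^sup>2)"
      by (rule sum.cong) (auto simp: g_def)
    also have "\<dots> \<le> ?s"
      by (rule finite_sum_le_infsum[OF sm T]) auto
    finally show ?thesis by (simp add: mult_left_mono)
  qed
  have "?h summable_on carrier G"
    by (rule nonneg_bdd_above_summable_on) (auto intro!: bdd_aboveI2 fin)
  then have "infsum ?h (carrier G) \<le> c\<^sup>2 * ?s"
    by (rule infsum_le_finite_sums) (use fin in auto)
  then have "sqrt (infsum ?h (carrier G)) \<le> sqrt (c\<^sup>2 * ?s)" by simp
  then show ?thesis using c by (simp add: l2_norm_def real_sqrt_mult)
qed

lemma reduced_norm_group:
  "reduced_norm \<Gamma> f = (SUP \<xi>\<in>{\<xi> \<in> l2_set (carrier G). l2_norm (carrier G) \<xi> \<le> 1}.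
     l2_norm (carrier G) (regular_rep \<Gamma> \<one> f \<xi>))"
  by (simp add: reduced_norm_def l2_opnorm_def)

lemma reduced_norm_le:
  assumes f: "f \<in> Cc \<Gamma>" and c: "c \<ge> 0"
    and le: "\<And>g. g \<in> Cc \<Gamma> \<Longrightarrow> n2 (conv \<Gamma> f g) \<le> c * n2 g"
  shows "reduced_norm \<Gamma> f \<le> c"
  unfolding reduced_norm_group
proof (rule cSUP_least)
  have "(\<lambda>x. 0) \<in> {\<xi> \<in> l2_set (carrier G). l2_norm (carrier G) \<xi> \<le> 1}"
    by (simp add: l2_set_def l2_norm_def)
  then show "{\<xi> \<in> l2_set (carrier G). l2_norm (carrier G) \<xi> \<le> 1} \<noteq> {}" by blast
  fix \<xi> assume "\<xi> \<in> {\<xi> \<in> l2_set (carrier G). l2_norm (carrier G) \<xi> \<le> 1}"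
  then have \<xi>: "\<xi> \<in> l2_set (carrier G)" "l2_norm (carrier G) \<xi> \<le> 1" by auto
  have "l2_norm (carrier G) (regular_rep \<Gamma> \<one> f \<xi>) \<le> c * l2_norm (carrier G) \<xi>"
    by (rule regular_rep_bound[OF f c le \<xi>(1)])
  also have "\<dots> \<le> c * 1" by (rule mult_left_mono[OF \<xi>(2) c])
  finally show "l2_norm (carrier G) (regular_rep \<Gamma> \<one> f \<xi>) \<le> c" by simp
qed

lemma n2_conv_le:
  assumes f: "f \<in> Cc \<Gamma>" and g: "g \<in> Cc \<Gamma>"
  shows "n2 (conv \<Gamma> f g) \<le> reduced_norm \<Gamma> f * n2 g"
proof (cases "n2 g = 0")
  case True
  then show ?thesis using n2_conv_le_sum[OF f g] by simp
next
  case False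
  define r where "r = n2 g"
  have r: "r > 0" using False n2_nonneg[of g] unfolding r_def by linarith
  define h where "h = (\<lambda>x. of_real (1 / r) * g x)"
  have h: "h \<in> Cc \<Gamma>" unfolding h_def by (rule smult_closed[OF g])
  have nh: "n2 h = 1"
    unfolding h_def using n2_smult[OF CcD(1)[OF g], of "of_real (1 / r)"] r by (simp add: norm_divide r_def)
  have eq: "l2_norm (carrier G) (regular_rep \<Gamma> \<one> f h) = n2 (conv \<Gamma> f h)"
  proof -
    have "regular_rep \<Gamma> \<one> f h x = conv \<Gamma> f h x" if "x \<in> carrier G" for x
      using that by (simp add: regular_rep_def conv_def)
    then have "l2_norm (carrier G) (regular_rep \<Gamma> \<one> f h) = l2_norm (carrier G) (conv \<Gamma> f h)"
      unfolding l2_norm_def by (intro arg_cong[where f=sqrt] infsum_cong) simp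
    then show ?thesis using l2_norm_eq_n2[OF conv_closed[OF f h]] by simp
  qed
  have "n2 (conv \<Gamma> f h) \<le> reduced_norm \<Gamma> f"
    unfolding reduced_norm_group eq[symmetric]
  proof (rule cSUP_upper)
    show "h \<in> {\<xi> \<in> l2_set (carrier G). l2_norm (carrier G) \<xi> \<le> 1}"
      using Cc_in_l2_set[OF h] l2_norm_eq_n2[OF h] nh by simp
    let ?c = "\<Sum>z\<in>supp f. cmod (f z)"
    have c: "?c \<ge> 0" by (simp add: sum_nonneg)
    have "l2_norm (carrier G) (regular_rep \<Gamma> \<one> f \<xi>) \<le> ?c"
      if \<xi>: "\<xi> \<in> l2_set (carrier G)" "l2_norm (carrier G) \<xi> \<le> 1" for \<xi>
      using regular_rep_bound[OF f c n2_conv_le_sum[OF f] \<xi>(1)] mult_left_mono[OF \<xi>(2) c] by simp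
    then show "bdd_above ((\<lambda>\<xi>. l2_norm (carrier G) (regular_rep \<Gamma> \<one> f \<xi>)) `
        {\<xi> \<in> l2_set (carrier G). l2_norm (carrier G) \<xi> \<le> 1})"
      by (intro bdd_aboveI2) blast
  qed
  moreover have "n2 (conv \<Gamma> f h) = n2 (conv \<Gamma> f g) / r"
    unfolding h_def conv_smult_right[OF f]
    using n2_smult[OF CcD(1)[OF conv_closed[OF f g]], of "of_real (1 / r)"] r by (simp add: norm_divide)
  ultimately show ?thesis using r by (simp add: field_simps flip: r_def)
qed

lemma n2_delta: "n2 \<delta> = 1"
  using n2_eq[of "{\<one>}" \<delta>] by (simp add: supp_def \<delta>_def)

lemma n2_le_reduced_norm: "f \<in> Cc \<Gamma> \<Longrightarrow> n2 f \<le> reduced_norm \<Gamma> f"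
  using n2_conv_le[of f \<delta>] by (simp add: conv_delta_right n2_delta)

lemma reduced_norm_nonneg: "f \<in> Cc \<Gamma> \<Longrightarrow> reduced_norm \<Gamma> f \<ge> 0"
  using n2_le_reduced_norm[of f] n2_nonneg[of f] by linarith

lemma reduced_norm_add:
  assumes f: "f \<in> Cc \<Gamma>" and g: "g \<in> Cc \<Gamma>"
  shows "reduced_norm \<Gamma> (\<lambda>x. f x + g x) \<le> reduced_norm \<Gamma> f + reduced_norm \<Gamma> g"
proof (rule reduced_norm_le)
  show "(\<lambda>x. f x + g x) \<in> Cc \<Gamma>" using f g by auto
  show "0 \<le> reduced_norm \<Gamma> f + reduced_norm \<Gamma> g" using f g by (simp add: reduced_norm_nonneg)
  fix h assume h: "h \<in> Cc \<Gamma>"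
  have "n2 (conv \<Gamma> (\<lambda>x. f x + g x) h) \<le> n2 (conv \<Gamma> f h) + n2 (conv \<Gamma> g h)"
    unfolding conv_add_left[OF f g] using f g h by (intro n2_add CcD(1) conv_closed)
  also have "\<dots> \<le> (reduced_norm \<Gamma> f + reduced_norm \<Gamma> g) * n2 h"
    using n2_conv_le[OF f h] n2_conv_le[OF g h] by (simp add: distrib_right)
  finally show "n2 (conv \<Gamma> (\<lambda>x. f x + g x) h) \<le> (reduced_norm \<Gamma> f + reduced_norm \<Gamma> g) * n2 h" .
qed

lemma reduced_norm_conv:
  assumes f: "f \<in> Cc \<Gamma>" and g: "g \<in> Cc \<Gamma>"
  shows "reduced_norm \<Gamma> (conv \<Gamma> f g) \<le> reduced_norm \<Gamma> f * reduced_norm \<Gamma> g"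
proof (rule reduced_norm_le)
  show "conv \<Gamma> f g \<in> Cc \<Gamma>" using f g by auto
  show "0 \<le> reduced_norm \<Gamma> f * reduced_norm \<Gamma> g" using f g by (simp add: reduced_norm_nonneg)
  fix h assume h: "h \<in> Cc \<Gamma>"
  have "n2 (conv \<Gamma> (conv \<Gamma> f g) h) \<le> reduced_norm \<Gamma> f * n2 (conv \<Gamma> g h)"
    unfolding conv_assoc[OF f g] using f g h by (intro n2_conv_le conv_closed)
  also have "\<dots> \<le> reduced_norm \<Gamma> f * (reduced_norm \<Gamma> g * n2 h)"
    using n2_conv_le[OF g h] f by (intro mult_left_mono reduced_norm_nonneg)
  finally show "n2 (conv \<Gamma> (conv \<Gamma> f g) h) \<le> reduced_norm \<Gamma> f * reduced_norm \<Gamma> g * n2 h"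
    by (simp add: mult.assoc)
qed

lemma reduced_norm_smult_le:
  assumes f: "f \<in> Cc \<Gamma>"
  shows "reduced_norm \<Gamma> (\<lambda>x. z * f x) \<le> cmod z * reduced_norm \<Gamma> f"
proof (rule reduced_norm_le)
  show "(\<lambda>x. z * f x) \<in> Cc \<Gamma>" using f by auto
  show "0 \<le> cmod z * reduced_norm \<Gamma> f" using f by (simp add: reduced_norm_nonneg)
  fix h assume h: "h \<in> Cc \<Gamma>"
  have "n2 (conv \<Gamma> (\<lambda>x. z * f x) h) = cmod z * n2 (conv \<Gamma> f h)"
    unfolding conv_smult_left[OF f] using f h by (intro n2_smult CcD(1) conv_closed)
  also have "\<dots> \<le> cmod z * (reduced_norm \<Gamma> f * n2 h)"
    by (intro mult_left_mono n2_conv_le f h) auto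
  finally show "n2 (conv \<Gamma> (\<lambda>x. z * f x) h) \<le> cmod z * reduced_norm \<Gamma> f * n2 h"
    by (simp add: mult.assoc)
qed

lemma reduced_norm_smult:
  assumes f: "f \<in> Cc \<Gamma>"
  shows "reduced_norm \<Gamma> (\<lambda>x. z * f x) = cmod z * reduced_norm \<Gamma> f"
proof (cases "z = 0")
  case True
  then show ?thesis
    using reduced_norm_smult_le[OF f, of z] reduced_norm_nonneg[OF zero_closed] by simp
next
  case False
  have "reduced_norm \<Gamma> f \<le> cmod (inverse z) * reduced_norm \<Gamma> (\<lambda>x. z * f x)"
    using reduced_norm_smult_le[OF smult_closed[OF f, of z], of "inverse z"] False
    by (simp only: mult.assoc[symmetric]) simp
  then have "cmod z * reduced_norm \<Gamma> f \<le> cmod z * (inverse (cmod z) * reduced_norm \<Gamma> (\<lambda>x. z * f x))"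
    by (intro mult_left_mono) (simp_all add: norm_inverse)
  then have "cmod z * reduced_norm \<Gamma> f \<le> reduced_norm \<Gamma> (\<lambda>x. z * f x)"
    using False by (simp add: mult.assoc[symmetric])
  then show ?thesis using reduced_norm_smult_le[OF f, of z] by simp
qed

text \<open>The heart of the \<open>C\<^sup>*\<close>-identity: \<open>\<parallel>f g\<parallel>\<^sub>2\<^sup>2 = \<langle>f\<^sup>*f g, g\<rangle> \<le> \<parallel>f\<^sup>*f\<parallel> \<parallel>g\<parallel>\<^sub>2\<^sup>2\<close>.\<close>

lemma reduced_norm_sq_le:
  assumes f: "f \<in> Cc \<Gamma>"
  shows "(reduced_norm \<Gamma> f)\<^sup>2 \<le> reduced_norm \<Gamma> (conv \<Gamma> (gstar \<Gamma> f) f)"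
proof -
  let ?F = "conv \<Gamma> (gstar \<Gamma> f) f"
  have F: "?F \<in> Cc \<Gamma>" using f by auto
  have "reduced_norm \<Gamma> f \<le> sqrt (reduced_norm \<Gamma> ?F)"
  proof (rule reduced_norm_le[OF f])
    show "0 \<le> sqrt (reduced_norm \<Gamma> ?F)" using F by (simp add: reduced_norm_nonneg)
    fix g assume g: "g \<in> Cc \<Gamma>"
    have "of_real ((n2 (conv \<Gamma> f g))\<^sup>2) = conv \<Gamma> (gstar \<Gamma> (conv \<Gamma> f g)) (conv \<Gamma> f g) \<one>"
      using f g by (simp add: conv_gstar_one_self conv_closed)
    also have "\<dots> = conv \<Gamma> (gstar \<Gamma> g) (conv \<Gamma> ?F g) \<one>"
      using f g by (simp add: gstar_conv conv_assoc gstar_closed conv_closed)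
    finally have "(n2 (conv \<Gamma> f g))\<^sup>2 = cmod (conv \<Gamma> (gstar \<Gamma> g) (conv \<Gamma> ?F g) \<one>)"
      by (metis norm_of_real abs_of_nonneg zero_le_power2)
    also have "\<dots> \<le> n2 g * n2 (conv \<Gamma> ?F g)"
      by (intro conv_gstar_one_le conv_closed F g)
    also have "\<dots> \<le> n2 g * (reduced_norm \<Gamma> ?F * n2 g)"
      by (intro mult_left_mono n2_conv_le F g) simp
    also have "\<dots> = (sqrt (reduced_norm \<Gamma> ?F) * n2 g)\<^sup>2"
      using F by (simp add: power_mult_distrib reduced_norm_nonneg power2_eq_square)
    finally show "n2 (conv \<Gamma> f g) \<le> sqrt (reduced_norm \<Gamma> ?F) * n2 g"
      by (rule power2_le_imp_le) (use F in \<open>simp add: reduced_norm_nonneg\<close>)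
  qed
  then have "(reduced_norm \<Gamma> f)\<^sup>2 \<le> (sqrt (reduced_norm \<Gamma> ?F))\<^sup>2"
    by (rule power_mono) (rule reduced_norm_nonneg[OF f])
  then show ?thesis using F by (simp add: reduced_norm_nonneg)
qed

lemma reduced_norm_gstar_le: "f \<in> Cc \<Gamma> \<Longrightarrow> reduced_norm \<Gamma> (gstar \<Gamma> f) \<le> reduced_norm \<Gamma> f"
proof -
  assume f: "f \<in> Cc \<Gamma>"
  have "(reduced_norm \<Gamma> (gstar \<Gamma> f))\<^sup>2 \<le> reduced_norm \<Gamma> (conv \<Gamma> f (gstar \<Gamma> f))"
    using reduced_norm_sq_le[OF gstar_closed[OF f]] f by (simp add: gstar_gstar)
  also have "\<dots> \<le> reduced_norm \<Gamma> f * reduced_norm \<Gamma> (gstar \<Gamma> f)"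
    using f by (intro reduced_norm_conv) auto
  finally show ?thesis
    using reduced_norm_nonneg[OF f] reduced_norm_nonneg[OF gstar_closed[OF f]]
    by (cases "reduced_norm \<Gamma> (gstar \<Gamma> f) = 0") (auto simp: power2_eq_square)
qed

lemma reduced_norm_cstar:
  assumes f: "f \<in> Cc \<Gamma>"
  shows "reduced_norm \<Gamma> (conv \<Gamma> (gstar \<Gamma> f) f) = (reduced_norm \<Gamma> f)\<^sup>2"
proof (rule antisym)
  have "reduced_norm \<Gamma> (conv \<Gamma> (gstar \<Gamma> f) f) \<le> reduced_norm \<Gamma> (gstar \<Gamma> f) * reduced_norm \<Gamma> f"
    using f by (intro reduced_norm_conv) auto
  also have "\<dots> \<le> reduced_norm \<Gamma> f * reduced_norm \<Gamma> f"
    using f by (intro mult_right_mono reduced_norm_gstar_le reduced_norm_nonneg)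
  finally show "reduced_norm \<Gamma> (conv \<Gamma> (gstar \<Gamma> f) f) \<le> (reduced_norm \<Gamma> f)\<^sup>2"
    by (simp add: power2_eq_square)
qed (rule reduced_norm_sq_le[OF f])

end

lemma Cc_alg_simps [simp]:
  "carrier (Cc_alg \<G>) = Cc \<G>" "a \<otimes>\<^bsub>Cc_alg \<G>\<^esub> b = conv \<G> a b"
  "\<one>\<^bsub>Cc_alg \<G>\<^esub> = (\<lambda>\<gamma>. if \<gamma> \<in> gunits \<G> then 1 else 0)" "\<zero>\<^bsub>Cc_alg \<G>\<^esub> = (\<lambda>\<gamma>. 0)"
  "a \<oplus>\<^bsub>Cc_alg \<G>\<^esub> b = (\<lambda>\<gamma>. a \<gamma> + b \<gamma>)" "z \<odot>\<^bsub>Cc_alg \<G>\<^esub> a = (\<lambda>\<gamma>. z * a \<gamma>)"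
  "star (Cc_alg \<G>) a = gstar \<G> a" "nrm (Cc_alg \<G>) a = reduced_norm \<G> a"
  by (simp_all add: Cc_alg_def)

lemma module_Cc_alg:
  assumes add: "\<And>f g. f \<in> Cc \<G> \<Longrightarrow> g \<in> Cc \<G> \<Longrightarrow> (\<lambda>x. f x + g x) \<in> Cc \<G>"
    and smult: "\<And>z f. f \<in> Cc \<G> \<Longrightarrow> (\<lambda>x. z * f x) \<in> Cc \<G>" and zero: "(\<lambda>x. 0) \<in> Cc \<G>"
  shows "Module.module (ring_of_type_algebra :: complex ring) (Cc_alg \<G>)"
proof -
  have "abelian_group (Cc_alg \<G>)"
  proof (rule abelian_groupI)
    fix f assume f: "f \<in> carrier (Cc_alg \<G>)"
    show "\<exists>b\<in>carrier (Cc_alg \<G>). b \<oplus>\<^bsub>Cc_alg \<G>\<^esub> f = \<zero>\<^bsub>Cc_alg \<G>\<^esub>"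
      using f smult[of f "-1"] by (intro bexI[of _ "\<lambda>x. (-1) * f x"]) auto
  qed (auto simp: add zero add_ac)
  then show ?thesis
    unfolding complex_module_axioms_iff by (auto simp: add smult algebra_simps)
qed

lemma (in group) pre_cstar_group: "pre_cstar (Cc_alg \<Gamma>)"
proof -
  have one: "(\<lambda>\<gamma>. if \<gamma> = \<one> then 1 else 0) = \<delta>" by (simp add: \<delta>_def fun_eq_iff)
  show ?thesis
  proof (rule pre_cstar.intro, simp_all only: Cc_alg_simps gunits_group singleton_iff one)
    show "Module.module (ring_of_type_algebra :: complex ring) (Cc_alg \<Gamma>)"
      by (rule module_Cc_alg) auto
  qed (auto simp: conv_assoc conv_delta_left conv_delta_right conv_add_left conv_add_right
        conv_smult_left conv_smult_right gstar_gstar gstar_conv reduced_norm_nonneg reduced_norm_smult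
        reduced_norm_add reduced_norm_conv reduced_norm_cstar fun_eq_iff gstar_def)
qed

text \<open>The canonical image of the group algebra in its completion.\<close>

definition (in group) const_class :: "('a \<Rightarrow> complex) \<Rightarrow> (nat \<Rightarrow> 'a \<Rightarrow> complex) set" where
  "const_class f = pre_cstar.cls (Cc_alg \<Gamma>) (\<lambda>k. f)"

section \<open>Functions on the Higson--Lafforgue--Skandalis groupoid\<close>

lemma continuous_map_enat_iff:
  fixes f :: "enat \<Rightarrow> 'y::topological_space"
  shows "continuous_map euclidean euclidean f \<longleftrightarrow> (\<lambda>n. f (enat n)) \<longlonglongrightarrow> f \<infinity>"
proof
  assume "continuous_map euclidean euclidean f"
  then have f: "continuous_on UNIV f" by simp
  show "(\<lambda>n. f (enat n)) \<longlonglongrightarrow> f \<infinity>"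
  proof (rule topological_tendstoI)
    fix S assume "open S" "f \<infinity> \<in> S"
    then have "open (f -` S)" "\<infinity> \<in> f -` S"
      using f by (auto intro: open_vimage)
    then obtain m :: nat where "{enat m<..} \<subseteq> f -` S"
      unfolding open_enat_iff by blast
    then show "\<forall>\<^sub>F n in sequentially. f (enat n) \<in> S"
      by (intro eventually_sequentiallyI[of "Suc m"]) (auto simp: subset_iff)
  qed
next
  assume lim: "(\<lambda>n. f (enat n)) \<longlonglongrightarrow> f \<infinity>"
  have "open (f -` S)" if S: "open S" for S
    unfolding open_enat_iff
  proof
    assume "\<infinity> \<in> f -` S"
    then have "\<forall>\<^sub>F n in sequentially. f (enat n) \<in> S"
      using lim S by (auto intro: topological_tendstoD)
    then obtain m where m: "\<And>n. n \<ge> m \<Longrightarrow> f (enat n) \<in> S"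
      by (auto simp: eventually_sequentially)
    have "{enat m<..} \<subseteq> f -` S"
    proof
      fix x assume "x \<in> {enat m<..}"
      then show "x \<in> f -` S"
        using m \<open>\<infinity> \<in> f -` S\<close> by (cases x) auto
    qed
    then show "\<exists>n. {enat n<..} \<subseteq> f -` S" by blast
  qed
  then show "continuous_map euclidean euclidean f"
    by (simp add: continuous_on_open_vimage)
qed

locale hls = group G for G :: "('a, 'm) monoid_scheme" (structure) +
  fixes H :: "nat \<Rightarrow> 'a set"
  assumes normal: "H n \<lhd> G"
    and finite_index: "finite (rcosets (H n))"
    and decreasing: "H (Suc n) \<subseteq> H n"
    and Int_trivial: "(\<Inter>n. H n) = {\<one>}"
begin

abbreviation "N \<equiv> HLS_subgroup G H"
abbreviation "F \<equiv> HLS_fibre G H"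
abbreviation "\<G> \<equiv> HLS G H"
abbreviation "\<K> n \<equiv> group_groupoid (HLS_fibre G H n)"
abbreviation "q n g \<equiv> HLS_subgroup G H n #> g"

lemma normal_N: "N n \<lhd> G"
  by (cases n) (auto simp: HLS_subgroup_def normal one_is_normal)

lemma subgroup_N: "subgroup (N n) G"
  using normal_N by (rule normal_imp_subgroup)

sublocale F: group "F n" for n
  unfolding HLS_fibre_def by (rule normal.factorgroup_is_group[OF normal_N])

lemma carrier_F: "carrier (F n) = q n ` carrier G"
  by (simp add: HLS_fibre_def carrier_FactGroup)

lemma q_closed [simp]: "g \<in> carrier G \<Longrightarrow> q n g \<in> carrier (F n)"
  by (simp add: carrier_F)

lemma q_mult: "\<lbrakk>g \<in> carrier G; h \<in> carrier G\<rbrakk> \<Longrightarrow> q n g \<otimes>\<^bsub>F n\<^esub> q n h = q n (g \<otimes> h)"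
  by (simp add: HLS_fibre_def normal.rcos_sum[OF normal_N])

lemma q_one: "q n \<one> = \<one>\<^bsub>F n\<^esub>"
  using subgroup.subset[OF subgroup_N] by (simp add: HLS_fibre_def coset_mult_one)

lemma q_inv: "g \<in> carrier G \<Longrightarrow> inv\<^bsub>F n\<^esub> q n g = q n (inv g)"
  using q_closed[of g n]
  by (simp add: HLS_fibre_def normal.inv_FactGroup[OF normal_N] normal.rcos_inv[OF normal_N])

lemma q_eq_iff:
  assumes "g \<in> carrier G" "h \<in> carrier G"
  shows "q n g = q n h \<longleftrightarrow> g \<otimes> inv h \<in> N n"
proof -
  have "q n g = q n h \<longleftrightarrow> q n g \<otimes>\<^bsub>F n\<^esub> inv\<^bsub>F n\<^esub> q n h = \<one>\<^bsub>F n\<^esub>"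
    using assms by (metis F.inv_closed F.inv_equality F.inv_inv F.r_inv q_closed)
  also have "\<dots> \<longleftrightarrow> q n (g \<otimes> inv h) = N n"
    using assms by (simp add: q_inv q_mult) (simp add: HLS_fibre_def)
  also have "\<dots> \<longleftrightarrow> g \<otimes> inv h \<in> N n"
    using assms subgroup_N rcos_self[of "g \<otimes> inv h" "N n"] coset_join2[of "g \<otimes> inv h" "N n"]
    by auto
  finally show ?thesis .
qed

lemma decreasing_le: "m \<le> n \<Longrightarrow> H n \<subseteq> H m"
  using decreasing by (rule lift_Suc_antimono_le)

lemma q_infinity: "g \<in> carrier G \<Longrightarrow> q \<infinity> g = {g}"
  by (simp add: HLS_subgroup_def r_coset_def)

lemma q_infinity_eq_iff: "\<lbrakk>g \<in> carrier G; h \<in> carrier G\<rbrakk> \<Longrightarrow> q \<infinity> g = q \<infinity> h \<longleftrightarrow> g = h"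
  by (simp add: q_infinity)

lemma eventually_q_neq:
  assumes g: "g \<in> carrier G" and h: "h \<in> carrier G" and "g \<noteq> h"
  shows "\<forall>\<^sub>F n in sequentially. q (enat n) g \<noteq> q (enat n) h"
proof -
  have "g \<otimes> inv h \<noteq> \<one>"
    using assms by (metis inv_closed inv_equality inv_inv)
  then obtain m where m: "g \<otimes> inv h \<notin> H m"
    using Int_trivial by blast
  have "q (enat n) g \<noteq> q (enat n) h" if "n \<ge> m" for n
    using m decreasing_le[OF that] q_eq_iff[OF g h, of "enat n"] by (auto simp: HLS_subgroup_def)
  then show ?thesis by (rule eventually_sequentiallyI)
qed

lemma eventually_inj_q:
  assumes "finite S" "S \<subseteq> carrier G"
  shows "\<forall>\<^sub>F n in sequentially. inj_on (q (enat n)) S"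
proof -
  have "\<forall>\<^sub>F n in sequentially. \<forall>g\<in>S. \<forall>h\<in>S. g \<noteq> h \<longrightarrow> q (enat n) g \<noteq> q (enat n) h"
    using assms by (intro eventually_ball_finite ballI)
      (auto intro: eventually_q_neq simp: subset_iff eventually_const_iff)
  then show ?thesis by eventually_elim (auto simp: inj_on_def)
qed

lemma inj_q_infinity: "S \<subseteq> carrier G \<Longrightarrow> inj_on (q \<infinity>) S"
  by (auto intro!: inj_onI simp: q_infinity subset_iff)

text \<open>Continuity on the groupoid amounts to convergence along each of the sections \<open>n \<mapsto> (n, q n g)\<close>.\<close>

definition tends :: "(enat \<times> 'a set \<Rightarrow> 'y::topological_space) \<Rightarrow> bool" where
  "tends f \<longleftrightarrow> (\<forall>g\<in>carrier G. (\<lambda>n. f (enat n, q (enat n) g)) \<longlonglongrightarrow> f (\<infinity>, q \<infinity> g))"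

text \<open>The map \<open>q n\<close> is eventually injective on finite sets, so sums over fibres converge with their terms.\<close>

lemma tendsto_fibre_sum:
  fixes \<phi> :: "enat \<times> 'a set \<Rightarrow> 'y::real_normed_vector"
  assumes S: "finite S" "S \<subseteq> carrier G"
    and \<phi>: "\<And>g. g \<in> S \<Longrightarrow> (\<lambda>n. \<phi> (enat n, q (enat n) g)) \<longlonglongrightarrow> \<phi> (\<infinity>, q \<infinity> g)"
  shows "(\<lambda>n. \<Sum>x\<in>q (enat n) ` S. \<phi> (enat n, x)) \<longlonglongrightarrow> (\<Sum>x\<in>q \<infinity> ` S. \<phi> (\<infinity>, x))"
proof -
  have "(\<lambda>n. \<Sum>g\<in>S. \<phi> (enat n, q (enat n) g)) \<longlonglongrightarrow> (\<Sum>g\<in>S. \<phi> (\<infinity>, q \<infinity> g))"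
    by (intro tendsto_sum \<phi>)
  also have "(\<Sum>g\<in>S. \<phi> (\<infinity>, q \<infinity> g)) = (\<Sum>x\<in>q \<infinity> ` S. \<phi> (\<infinity>, x))"
    using inj_q_infinity[OF S(2)] by (simp add: sum.reindex)
  finally show ?thesis
  proof (rule Lim_transform_eventually)
    show "\<forall>\<^sub>F n in sequentially. (\<Sum>g\<in>S. \<phi> (enat n, q (enat n) g)) = (\<Sum>x\<in>q (enat n) ` S. \<phi> (enat n, x))"
      using eventually_inj_q[OF S] by eventually_elim (simp add: sum.reindex)
  qed
qed

lemma arrows_HLS_q: "(n, x) \<in> arrows \<G> \<longleftrightarrow> x \<in> carrier (F n)"
  by (simp add: arrows_HLS)

subsection \<open>The topology\<close>

text \<open>The base of the quotient is a disjoint union of copies of the compactified naturals, one for each \<open>g\<close>.\<close>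

lemma openin_base_iff:
  "openin (prod_topology (euclidean :: enat topology) (discrete_topology (carrier G))) S \<longleftrightarrow>
     S \<subseteq> UNIV \<times> carrier G \<and> (\<forall>g\<in>carrier G. open {n. (n, g) \<in> S})" (is "openin ?W S \<longleftrightarrow> ?R")
proof
  assume S: "openin ?W S"
  then have sub: "S \<subseteq> UNIV \<times> carrier G"
    using openin_subset[OF S] by simp
  moreover have "open {n. (n, g) \<in> S}" for g
  proof (subst open_subopen, intro ballI)
    fix n assume "n \<in> {n. (n, g) \<in> S}"
    then obtain U V where "open U" "n \<in> U" "g \<in> V" "U \<times> V \<subseteq> S"
      using S[unfolded openin_prod_topology_alt, rule_format, of n g] by auto
    then show "\<exists>T. open T \<and> n \<in> T \<and> T \<subseteq> {n. (n, g) \<in> S}" by blast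
  qed
  ultimately show ?R by blast
next
  assume R: ?R
  show "openin ?W S"
    unfolding openin_prod_topology_alt
  proof (intro allI impI)
    fix n g assume ng: "(n, g) \<in> S"
    then have "g \<in> carrier G" using R by blast
    then show "\<exists>U V. openin euclidean U \<and> openin (discrete_topology (carrier G)) V \<and> n \<in> U \<and> g \<in> V \<and> U \<times> V \<subseteq> S"
      using R ng by (intro exI[of _ "{n. (n, g) \<in> S}"] exI[of _ "{g}"]) auto
  qed
qed

lemma topspace_HLS: "topspace (arr_top \<G>) = arrows \<G>"
  by (simp add: arrows_def)

lemma openin_HLS_iff:
  "openin (arr_top \<G>) S \<longleftrightarrow> S \<subseteq> arrows \<G> \<and> (\<forall>g\<in>carrier G. open {n. (n, q n g) \<in> S})"
proof -
  have "(\<lambda>(n, g). (n, q n g)) ` (UNIV \<times> carrier G) = arrows \<G>"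
    by (auto simp: arrows_HLS carrier_F)
  moreover have "{n. n \<in> UNIV \<and> g \<in> carrier G \<and> (n, q n g) \<in> S} = {n. (n, q n g) \<in> S}"
    if "g \<in> carrier G" for g using that by auto
  ultimately show ?thesis
    by (auto simp: HLS_def openin_quotient_top openin_base_iff cong: conj_cong)
qed

lemma open_section_iff: "open {n. (n, q n g) \<in> S} \<longleftrightarrow>
    ((\<infinity>, q \<infinity> g) \<in> S \<longrightarrow> (\<forall>\<^sub>F n in sequentially. (enat n, q (enat n) g) \<in> S))"
proof -
  have "(\<exists>m::nat. {enat m<..} \<subseteq> {n. (n, q n g) \<in> S}) \<longleftrightarrow> (\<forall>\<^sub>F n in sequentially. (enat n, q (enat n) g) \<in> S)"
    if inf: "(\<infinity>, q \<infinity> g) \<in> S"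
  proof
    assume "\<exists>m::nat. {enat m<..} \<subseteq> {n. (n, q n g) \<in> S}"
    then obtain m where "{enat m<..} \<subseteq> {n. (n, q n g) \<in> S}" by blast
    then show "\<forall>\<^sub>F n in sequentially. (enat n, q (enat n) g) \<in> S"
      by (intro eventually_sequentiallyI[of "Suc m"]) (auto simp: subset_iff)
  next
    assume "\<forall>\<^sub>F n in sequentially. (enat n, q (enat n) g) \<in> S"
    then obtain m where m: "\<And>n. n \<ge> m \<Longrightarrow> (enat n, q (enat n) g) \<in> S"
      by (auto simp: eventually_sequentially)
    have "{enat m<..} \<subseteq> {n. (n, q n g) \<in> S}"
    proof
      fix x assume "x \<in> {enat m<..}"
      then show "x \<in> {n. (n, q n g) \<in> S}"
        using m inf by (cases x) auto
    qed
    then show "\<exists>m::nat. {enat m<..} \<subseteq> {n. (n, q n g) \<in> S}" by blast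
  qed
  then show ?thesis unfolding open_enat_iff by blast
qed

lemma continuous_map_HLS_iff:
  "continuous_map (arr_top \<G>) euclidean f \<longleftrightarrow> tends f"
proof
  assume f: "continuous_map (arr_top \<G>) euclidean f"
  show "tends f"
    unfolding tends_def
  proof (intro ballI topological_tendstoI)
    fix g S assume g: "g \<in> carrier G" and S: "open S" "f (\<infinity>, q \<infinity> g) \<in> S"
    have "openin (arr_top \<G>) {x \<in> arrows \<G>. f x \<in> S}"
      using openin_continuous_map_preimage[OF f, of S] S by (simp add: topspace_HLS)
    then have "\<forall>\<^sub>F n in sequentially. (enat n, q (enat n) g) \<in> {x \<in> arrows \<G>. f x \<in> S}"
      using g S unfolding openin_HLS_iff open_section_iff by (auto simp: arrows_HLS)
    then show "\<forall>\<^sub>F n in sequentially. f (enat n, q (enat n) g) \<in> S"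
      by (rule eventually_mono) simp
  qed
next
  assume f: "tends f"
  show "continuous_map (arr_top \<G>) euclidean f"
    unfolding continuous_map_def topspace_HLS openin_HLS_iff open_section_iff
  proof (intro conjI allI impI ballI)
    fix S g assume S: "openin euclidean S" and g: "g \<in> carrier G"
      and "(\<infinity>, q \<infinity> g) \<in> {x \<in> arrows \<G>. f x \<in> S}"
    then have "\<forall>\<^sub>F n in sequentially. f (enat n, q (enat n) g) \<in> S"
      using f by (auto simp: tends_def intro: topological_tendstoD)
    then show "\<forall>\<^sub>F n in sequentially. (enat n, q (enat n) g) \<in> {x \<in> arrows \<G>. f x \<in> S}"
      by (rule eventually_mono) (use g in \<open>simp add: arrows_HLS\<close>)
  qed auto
qed

text \<open>The image of the copy of the base indexed by \<open>g\<close>. It is open and closed because distinct elements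
  of \<open>G\<close> have distinct cosets from some \<open>n\<close> on, and it is compact as a continuous image of the base.\<close>

definition bis :: "'a \<Rightarrow> (enat \<times> 'a set) set" where
  "bis g = range (\<lambda>n. (n, q n g))"

lemma bis_arrows: "g \<in> carrier G \<Longrightarrow> bis g \<subseteq> arrows \<G>"
  by (auto simp: bis_def arrows_HLS)

lemma openin_bis: "g \<in> carrier G \<Longrightarrow> openin (arr_top \<G>) (bis g)"
  unfolding openin_HLS_iff open_section_iff
  using bis_arrows[of g] by (auto simp: bis_def q_infinity_eq_iff)

lemma closedin_bis: "g \<in> carrier G \<Longrightarrow> closedin (arr_top \<G>) (bis g)"
  unfolding closedin_def topspace_HLS openin_HLS_iff open_section_iff
proof (intro conjI ballI impI bis_arrows)
  fix h assume g: "g \<in> carrier G" and h: "h \<in> carrier G" and "(\<infinity>, q \<infinity> h) \<in> arrows \<G> - bis g"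
  then have "g \<noteq> h" by (auto simp: bis_def)
  from eventually_q_neq[OF g h this]
  show "\<forall>\<^sub>F n in sequentially. (enat n, q (enat n) h) \<in> arrows \<G> - bis g"
    by (rule eventually_mono) (use h in \<open>auto simp: bis_def arrows_HLS\<close>)
qed auto

lemma compactin_bis: "g \<in> carrier G \<Longrightarrow> compactin (arr_top \<G>) (bis g)"
  unfolding bis_def
proof (rule image_compactin)
  show "compactin euclidean (UNIV :: enat set)"
    by (simp add: compact_UNIV)
  assume g: "g \<in> carrier G"
  show "continuous_map euclidean (arr_top \<G>) (\<lambda>n. (n, q n g))"
    unfolding continuous_map_def topspace_HLS openin_HLS_iff using g by (auto simp: arrows_HLS)
qed

text \<open>A compact set is covered by finitely many of the compact open sets \<open>bis g\<close>, so a compactly supported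
  function lives on the cosets of a finite subset of \<open>G\<close> that serves all fibres at once.\<close>

lemma Cc_HLS_iff:
  "f \<in> Cc \<G> \<longleftrightarrow> (\<forall>\<gamma>. \<gamma> \<notin> arrows \<G> \<longrightarrow> f \<gamma> = 0) \<and> tends f \<and>
     (\<exists>S. finite S \<and> S \<subseteq> carrier G \<and> (\<forall>n x. f (n, x) \<noteq> 0 \<longrightarrow> x \<in> q n ` S))"
  (is "_ \<longleftrightarrow> ?Z \<and> _ \<and> ?R")
proof -
  let ?s = "{\<gamma> \<in> arrows \<G>. f \<gamma> \<noteq> 0}"
  let ?c = "arr_top \<G> closure_of ?s"
  have "compactin (arr_top \<G>) (?c) \<longleftrightarrow> ?R" if Z: ?Z
  proof
    assume K: "compactin (arr_top \<G>) (?c)"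
    have "\<exists>\<F>. finite \<F> \<and> \<F> \<subseteq> bis ` carrier G \<and> ?c \<subseteq> \<Union>\<F>"
    proof (rule K[unfolded compactin_def, THEN conjunct2, rule_format], intro conjI)
      show "\<forall>U\<in>bis ` carrier G. openin (arr_top \<G>) U" using openin_bis by blast
      have "arrows \<G> \<subseteq> \<Union> (bis ` carrier G)"
        by (auto simp: arrows_HLS carrier_F bis_def)
      then show "?c \<subseteq> \<Union> (bis ` carrier G)"
        using closure_of_subset_topspace[of "arr_top \<G>" ?s] by (simp add: topspace_HLS)
    qed
    then obtain \<F> where \<F>: "finite \<F>" "\<F> \<subseteq> bis ` carrier G" "?c \<subseteq> \<Union>\<F>" by blast
    obtain S where "S \<subseteq> carrier G" "finite S" "\<F> = bis ` S"
      using finite_subset_image[OF \<F>(1,2)] by blast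
    with \<F>(3) have S: "finite S" "S \<subseteq> carrier G" "?c \<subseteq> \<Union> (bis ` S)" by simp_all
    have "x \<in> q n ` S" if "f (n, x) \<noteq> 0" for n x
    proof -
      have "(n, x) \<in> ?s" using Z that by auto
      moreover have "?s \<subseteq> ?c"
        by (rule closure_of_subset) (auto simp: topspace_HLS)
      ultimately show ?thesis using S by (auto simp: bis_def)
    qed
    then show ?R using S by blast
  next
    assume ?R
    then obtain S where S: "finite S" "S \<subseteq> carrier G" "\<And>n x. f (n, x) \<noteq> 0 \<Longrightarrow> x \<in> q n ` S"
      by blast
    let ?K = "\<Union> (bis ` S)"
    have "compactin (arr_top \<G>) ?K"
      using S by (intro compactin_Union) (auto intro: compactin_bis)
    moreover have "closedin (arr_top \<G>) ?K"
      using S by (intro closedin_Union) (auto intro: closedin_bis)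
    moreover have "?s \<subseteq> ?K"
      using S(3) by (fastforce simp: bis_def)
    ultimately show "compactin (arr_top \<G>) (?c)"
      by (meson closed_compactin closedin_closure_of closure_of_minimal)
  qed
  then show ?thesis by (auto simp: Cc_def continuous_map_HLS_iff)
qed

lemma Cc_HLS_cases:
  assumes "f \<in> Cc \<G>"
  obtains S where "finite S" "S \<subseteq> carrier G" "\<And>n x. f (n, x) \<noteq> 0 \<Longrightarrow> x \<in> q n ` S"
proof -
  obtain S where "finite S \<and> S \<subseteq> carrier G \<and> (\<forall>n x. f (n, x) \<noteq> 0 \<longrightarrow> x \<in> q n ` S)"
    using assms unfolding Cc_HLS_iff by blast
  then show ?thesis by (intro that[of S]) simp_all
qed

lemma Cc_HLS_tends: "f \<in> Cc \<G> \<Longrightarrow> tends f"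
  by (simp add: Cc_HLS_iff)

lemma tendsD: "\<lbrakk>tends f; g \<in> carrier G\<rbrakk> \<Longrightarrow> (\<lambda>n. f (enat n, q (enat n) g)) \<longlonglongrightarrow> f (\<infinity>, q \<infinity> g)"
  by (simp add: tends_def)

lemma supp_restrict: "supp (HLS_restrict n f) = {x. f (n, x) \<noteq> 0}"
  by (simp add: supp_def HLS_restrict_def)

lemma restrict_closed:
  assumes "f \<in> Cc \<G>"
  shows "HLS_restrict n f \<in> Cc (\<K> n)"
proof -
  obtain S where S: "finite S" "S \<subseteq> carrier G" "\<And>n x. f (n, x) \<noteq> 0 \<Longrightarrow> x \<in> q n ` S"
    using assms by (rule Cc_HLS_cases) blast
  have "supp (HLS_restrict n f) \<subseteq> q n ` S" using S(3) by (auto simp: supp_restrict)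
  moreover have "finite (q n ` S)" "q n ` S \<subseteq> carrier (F n)"
    using S(1,2) by (auto simp: subset_iff)
  ultimately show ?thesis
    unfolding F.Cc_group_iff by (meson finite_subset order_trans)
qed

lemma restrict_add: "HLS_restrict n (\<lambda>\<gamma>. f \<gamma> + g \<gamma>) = (\<lambda>x. HLS_restrict n f x + HLS_restrict n g x)"
  and restrict_smult: "HLS_restrict n (\<lambda>\<gamma>. z * f \<gamma>) = (\<lambda>x. z * HLS_restrict n f x)"
  by (auto simp: HLS_restrict_def)

lemma groupoid_HLS [simp]:
  "src \<G> (n, x) = (n, \<one>\<^bsub>F n\<^esub>)" "rng \<G> (n, x) = (n, \<one>\<^bsub>F n\<^esub>)" "ginv \<G> (n, x) = (n, inv\<^bsub>F n\<^esub> x)"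
  "comp \<G> (n, x) (m, y) = (n, x \<otimes>\<^bsub>F n\<^esub> y)"
  by (simp_all add: HLS_def)

lemma gunits_HLS: "gunits \<G> = (\<lambda>n. (n, \<one>\<^bsub>F n\<^esub>)) ` UNIV"
proof
  show "gunits \<G> \<subseteq> (\<lambda>n. (n, \<one>\<^bsub>F n\<^esub>)) ` UNIV"
    by (auto simp: gunits_def arrows_HLS)
  have "(n, \<one>\<^bsub>F n\<^esub>) \<in> gunits \<G>" for n
    unfolding gunits_def by (rule image_eqI[of _ _ "(n, \<one>\<^bsub>F n\<^esub>)"]) (auto simp: arrows_HLS)
  then show "(\<lambda>n. (n, \<one>\<^bsub>F n\<^esub>)) ` UNIV \<subseteq> gunits \<G>" by blast
qed

lemma src_fibre_HLS: "src_fibre \<G> (n, \<one>\<^bsub>F n\<^esub>) = Pair n ` carrier (F n)"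
  and rng_fibre_HLS: "rng_fibre \<G> (n, \<one>\<^bsub>F n\<^esub>) = Pair n ` carrier (F n)"
  by (auto simp: src_fibre_def rng_fibre_def arrows_HLS)

lemma infsum_Pair: "(\<Sum>\<^sub>\<infinity>\<gamma>\<in>Pair n ` A. \<phi> \<gamma>) = (\<Sum>\<^sub>\<infinity>x\<in>A. \<phi> (n, x))"
  by (subst infsum_reindex) (auto simp: inj_on_def o_def)

lemma restrict_conv: "HLS_restrict n (conv \<G> f g) = conv (\<K> n) (HLS_restrict n f) (HLS_restrict n g)"
proof
  fix x
  show "HLS_restrict n (conv \<G> f g) x = conv (\<K> n) (HLS_restrict n f) (HLS_restrict n g) x"
  proof (cases "x \<in> carrier (F n)")
    case True
    then show ?thesis
      by (simp add: HLS_restrict_def conv_def arrows_HLS src_fibre_HLS infsum_Pair)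
  qed (simp add: HLS_restrict_def conv_def arrows_HLS)
qed

lemma restrict_gstar: "HLS_restrict n (gstar \<G> f) = gstar (\<K> n) (HLS_restrict n f)"
  by (auto simp: HLS_restrict_def gstar_def arrows_HLS)

lemma HLS_ext: "(\<And>n. HLS_restrict n f = HLS_restrict n g) \<Longrightarrow> f = g"
  by (auto simp: HLS_restrict_def fun_eq_iff)

lemma Cc_HLS_I:
  assumes "\<And>n x. x \<notin> carrier (F n) \<Longrightarrow> f (n, x) = 0" "tends f"
    "finite S" "S \<subseteq> carrier G" "\<And>n x. f (n, x) \<noteq> 0 \<Longrightarrow> x \<in> q n ` S"
  shows "f \<in> Cc \<G>"
  unfolding Cc_HLS_iff using assms by (auto simp: arrows_HLS)

lemma Cc_HLS_off: "\<lbrakk>f \<in> Cc \<G>; x \<notin> carrier (F n)\<rbrakk> \<Longrightarrow> f (n, x) = 0"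
  by (auto simp: Cc_HLS_iff arrows_HLS)

lemma HLS_add_closed:
  assumes f: "f \<in> Cc \<G>" and g: "g \<in> Cc \<G>"
  shows "(\<lambda>\<gamma>. f \<gamma> + g \<gamma>) \<in> Cc \<G>"
proof -
  obtain S where S: "finite S" "S \<subseteq> carrier G" "\<And>n x. f (n, x) \<noteq> 0 \<Longrightarrow> x \<in> q n ` S"
    using f by (rule Cc_HLS_cases) blast
  obtain T where T: "finite T" "T \<subseteq> carrier G" "\<And>n x. g (n, x) \<noteq> 0 \<Longrightarrow> x \<in> q n ` T"
    using g by (rule Cc_HLS_cases) blast
  show ?thesis
  proof (rule Cc_HLS_I[where S="S \<union> T"])
    show "tends (\<lambda>\<gamma>. f \<gamma> + g \<gamma>)"
      using Cc_HLS_tends[OF f] Cc_HLS_tends[OF g] by (auto simp: tends_def intro: tendsto_add)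
    show "x \<in> q n ` (S \<union> T)" if "f (n, x) + g (n, x) \<noteq> 0" for n x
      using that S(3)[of n x] T(3)[of n x] by (cases "f (n, x) = 0") (simp_all add: image_Un)
  qed (use S T Cc_HLS_off[OF f] Cc_HLS_off[OF g] in auto)
qed

lemma HLS_mult_closed:
  assumes f: "f \<in> Cc \<G>" and h: "continuous_map euclidean euclidean h"
  shows "(\<lambda>\<gamma>. h (fst \<gamma>) * f \<gamma>) \<in> Cc \<G>"
proof -
  obtain S where S: "finite S" "S \<subseteq> carrier G" "\<And>n x. f (n, x) \<noteq> 0 \<Longrightarrow> x \<in> q n ` S"
    using f by (rule Cc_HLS_cases) blast
  show ?thesis
  proof (rule Cc_HLS_I[where S=S])
    have "(\<lambda>n. h (enat n)) \<longlonglongrightarrow> h \<infinity>" using h by (simp only: continuous_map_enat_iff)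
    then show "tends (\<lambda>\<gamma>. h (fst \<gamma>) * f \<gamma>)"
      using Cc_HLS_tends[OF f] by (auto simp: tends_def intro!: tendsto_mult)
  qed (use S Cc_HLS_off[OF f] in auto)
qed

lemma HLS_smult_closed: "f \<in> Cc \<G> \<Longrightarrow> (\<lambda>\<gamma>. z * f \<gamma>) \<in> Cc \<G>"
  using HLS_mult_closed[of f "\<lambda>_. z"] by simp

lemma HLS_zero_closed: "(\<lambda>\<gamma>. 0) \<in> Cc \<G>"
  by (rule Cc_HLS_I[where S="{}"]) (auto simp: tends_def)

lemma tends_inv: "tends f \<Longrightarrow> g \<in> carrier G \<Longrightarrow>
    (\<lambda>n. f (enat n, inv\<^bsub>F (enat n)\<^esub> q (enat n) g)) \<longlonglongrightarrow> f (\<infinity>, inv\<^bsub>F \<infinity>\<^esub> q \<infinity> g)"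
  by (simp add: q_inv tends_def)

lemma HLS_gstar_closed:
  assumes f: "f \<in> Cc \<G>"
  shows "gstar \<G> f \<in> Cc \<G>"
proof -
  obtain S where S: "finite S" "S \<subseteq> carrier G" "\<And>n x. f (n, x) \<noteq> 0 \<Longrightarrow> x \<in> q n ` S"
    using f by (rule Cc_HLS_cases) blast
  show ?thesis
  proof (rule Cc_HLS_I[where S="(\<lambda>g. inv g) ` S"])
    show "tends (gstar \<G> f)"
      unfolding tends_def gstar_def
    proof
      fix g assume g: "g \<in> carrier G"
      have "(\<lambda>n. cnj (f (enat n, inv\<^bsub>F (enat n)\<^esub> q (enat n) g))) \<longlonglongrightarrow> cnj (f (\<infinity>, inv\<^bsub>F \<infinity>\<^esub> q \<infinity> g))"
        by (intro tendsto_cnj tends_inv Cc_HLS_tends f g)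
      then show "(\<lambda>n. if (enat n, q (enat n) g) \<in> arrows \<G> then cnj (f (ginv \<G> (enat n, q (enat n) g))) else 0)
          \<longlonglongrightarrow> (if (\<infinity>, q \<infinity> g) \<in> arrows \<G> then cnj (f (ginv \<G> (\<infinity>, q \<infinity> g))) else 0)"
        using g by (simp add: arrows_HLS_q)
    qed
    show "x \<in> q n ` (\<lambda>g. inv g) ` S" if "gstar \<G> f (n, x) \<noteq> 0" for n x
    proof -
      have x: "x \<in> carrier (F n)" "inv\<^bsub>F n\<^esub> x \<in> q n ` S"
        using that S(3) by (auto simp: gstar_def arrows_HLS_q split: if_splits)
      then obtain g where g: "g \<in> S" "inv\<^bsub>F n\<^esub> x = q n g" by blast
      then have "x = q n (inv g)"
        using x S(2) q_inv[of g n] F.inv_inv[of x n] by auto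
      then show ?thesis using g by blast
    qed
  qed (use S in \<open>auto simp: gstar_def arrows_HLS_q\<close>)
qed

text \<open>By \<open>tendsto_fibre_sum\<close> the finite sums that define the convolution converge along sections.\<close>

lemma HLS_conv_closed:
  assumes f: "f \<in> Cc \<G>" and g: "g \<in> Cc \<G>"
  shows "conv \<G> f g \<in> Cc \<G>"
proof -
  obtain S where S: "finite S" "S \<subseteq> carrier G" "\<And>n x. f (n, x) \<noteq> 0 \<Longrightarrow> x \<in> q n ` S"
    using f by (rule Cc_HLS_cases) blast
  obtain T where T: "finite T" "T \<subseteq> carrier G" "\<And>n x. g (n, x) \<noteq> 0 \<Longrightarrow> x \<in> q n ` T"
    using g by (rule Cc_HLS_cases) blast
  have app: "conv \<G> f g (n, x) = conv (\<K> n) (HLS_restrict n f) (HLS_restrict n g) x" for n x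
    using fun_cong[OF restrict_conv[of n f g], of x] by (simp add: HLS_restrict_def)
  have ss: "supp (HLS_restrict n f) \<subseteq> q n ` S" for n using S(3) by (auto simp: supp_restrict)
  have st: "supp (HLS_restrict n g) \<subseteq> q n ` T" for n using T(3) by (auto simp: supp_restrict)
  show ?thesis
  proof (rule Cc_HLS_I[where S="(\<lambda>(a, b). a \<otimes> b) ` (S \<times> T)"])
    show "conv \<G> f g (n, x) = 0" if "x \<notin> carrier (F n)" for n x
      using that by (simp add: app F.conv_off)
    show "finite ((\<lambda>(a, b). a \<otimes> b) ` (S \<times> T))" "(\<lambda>(a, b). a \<otimes> b) ` (S \<times> T) \<subseteq> carrier G"
      using S T by auto
    show "x \<in> q n ` (\<lambda>(a, b). a \<otimes> b) ` (S \<times> T)" if "conv \<G> f g (n, x) \<noteq> 0" for n x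
    proof -
      have "x \<in> supp (conv (\<K> n) (HLS_restrict n f) (HLS_restrict n g))"
        using that by (simp add: app supp_def)
      from subsetD[OF F.supp_conv[OF restrict_closed[OF f]] this]
      obtain z w where zw: "z \<in> supp (HLS_restrict n f)" "w \<in> supp (HLS_restrict n g)" "x = z \<otimes>\<^bsub>F n\<^esub> w"
        by auto
      obtain a where a: "a \<in> S" "z = q n a" using subsetD[OF ss zw(1)] by (rule imageE)
      obtain b where b: "b \<in> T" "w = q n b" using subsetD[OF st zw(2)] by (rule imageE)
      note ab = a(1) b(1) a(2) b(2)
      then have "x = q n (a \<otimes> b)"
        using zw S(2) T(2) by (auto simp: q_mult subset_iff)
      then show ?thesis using ab by force
    qed
    show "tends (conv \<G> f g)"
      unfolding tends_def
    proof
      fix a assume a: "a \<in> carrier G"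
      let ?\<phi> = "\<lambda>(n, z). f (n, z) * g (n, inv\<^bsub>F n\<^esub> z \<otimes>\<^bsub>F n\<^esub> q n a)"
      have eq: "conv \<G> f g (n, q n a) = (\<Sum>z\<in>q n ` S. ?\<phi> (n, z))" for n
      proof -
        have "q n ` S \<subseteq> carrier (F n)" using S(2) by auto
        then have "conv (\<K> n) (HLS_restrict n f) (HLS_restrict n g) (q n a)
            = (\<Sum>z\<in>q n ` S. HLS_restrict n f z * HLS_restrict n g (inv\<^bsub>F n\<^esub> z \<otimes>\<^bsub>F n\<^esub> q n a))"
          by (intro F.conv_eq ss) (use S(1) a in auto)
        then show ?thesis by (simp add: app HLS_restrict_def)
      qed
      show "(\<lambda>n. conv \<G> f g (enat n, q (enat n) a)) \<longlonglongrightarrow> conv \<G> f g (\<infinity>, q \<infinity> a)"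
        unfolding eq
      proof (rule tendsto_fibre_sum[OF S(1,2)])
        fix h assume "h \<in> S"
        then have h: "h \<in> carrier G" using S by blast
        have "(\<lambda>n. f (enat n, q (enat n) h) * g (enat n, q (enat n) (inv h \<otimes> a)))
            \<longlonglongrightarrow> f (\<infinity>, q \<infinity> h) * g (\<infinity>, q \<infinity> (inv h \<otimes> a))"
          using h a by (intro tendsto_mult tendsD Cc_HLS_tends f g) auto
        then show "(\<lambda>n. ?\<phi> (enat n, q (enat n) h)) \<longlonglongrightarrow> ?\<phi> (\<infinity>, q \<infinity> h)"
          using h a by (simp add: q_inv q_mult)
      qed
    qed
  qed
qed

lemma HLS_one_closed: "(\<lambda>\<gamma>. if \<gamma> \<in> gunits \<G> then 1 else 0) \<in> Cc \<G>"
proof (rule Cc_HLS_I[where S="{\<one>}"])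
  show "tends (\<lambda>\<gamma>. if \<gamma> \<in> gunits \<G> then 1 else 0 :: complex)"
    unfolding tends_def
  proof
    fix g assume g: "g \<in> carrier G"
    have eq: "(n, q n g) \<in> gunits \<G> \<longleftrightarrow> q n g = q n \<one>" for n
      by (auto simp: gunits_HLS q_one)
    show "(\<lambda>n. if (enat n, q (enat n) g) \<in> gunits \<G> then 1 else 0 :: complex)
        \<longlonglongrightarrow> (if (\<infinity>, q \<infinity> g) \<in> gunits \<G> then 1 else 0)"
    proof (cases "g = \<one>")
      case True
      then show ?thesis unfolding eq by simp
    next
      case False
      then have "q \<infinity> g \<noteq> q \<infinity> \<one>" using g by (simp add: q_infinity_eq_iff)
      then show ?thesis
        unfolding eq
        by (intro tendsto_eventually eventually_mono[OF eventually_q_neq[OF g one_closed False]]) simp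
    qed
  qed
qed (auto simp: gunits_HLS q_one split: if_splits)

lemma restrict_one: "HLS_restrict n (\<lambda>\<gamma>. if \<gamma> \<in> gunits \<G> then 1 else 0) = F.\<delta> n"
  by (auto simp: HLS_restrict_def gunits_HLS F.\<delta>_def)

subsection \<open>The reduced norm\<close>

text \<open>The regular representation at the unit over \<open>n\<close> is that of the group \<open>F n\<close>.\<close>

lemma reduced_norm_HLS: "reduced_norm \<G> f = (SUP n. reduced_norm (\<K> n) (HLS_restrict n f))"
proof -
  have "l2_opnorm (src_fibre \<G> (n, \<one>\<^bsub>F n\<^esub>)) (regular_rep \<G> (n, \<one>\<^bsub>F n\<^esub>) f) = reduced_norm (\<K> n) (HLS_restrict n f)" for n
  proof -
    let ?P = "Pair n ` carrier (F n)"
    define R where "R \<xi> = (\<lambda>x. \<xi> (n, x))" for \<xi> :: "enat \<times> 'a set \<Rightarrow> complex"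
    have R: "l2_norm ?P \<xi> = l2_norm (carrier (F n)) (R \<xi>)" for \<xi>
      by (simp add: l2_norm_def infsum_Pair R_def)
    have R2: "\<xi> \<in> l2_set ?P \<longleftrightarrow> R \<xi> \<in> l2_set (carrier (F n))" for \<xi>
      unfolding l2_set_def R_def by (subst mem_Collect_eq, subst summable_on_reindex) (auto simp: inj_on_def o_def)
    have R3: "l2_norm (carrier (F n)) (R (regular_rep \<G> (n, \<one>\<^bsub>F n\<^esub>) f \<xi>))
        = l2_norm (carrier (F n)) (regular_rep (\<K> n) \<one>\<^bsub>F n\<^esub> (HLS_restrict n f) (R \<xi>))" for \<xi>
      unfolding l2_norm_def R_def
      by (intro arg_cong[where f=sqrt] infsum_cong)
        (simp add: regular_rep_def src_fibre_HLS infsum_Pair HLS_restrict_def)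
    have "range R = UNIV"
      unfolding R_def by (rule surjI[of _ "\<lambda>\<eta> (m, x). \<eta> x"]) simp
    then have "{\<xi> \<in> l2_set (carrier (F n)). l2_norm (carrier (F n)) \<xi> \<le> 1}
        = R ` {\<xi> \<in> l2_set ?P. l2_norm ?P \<xi> \<le> 1}"
      unfolding R R2 by (auto simp: image_iff)
    then show ?thesis
      unfolding l2_opnorm_def F.reduced_norm_group src_fibre_HLS R R3 by (simp add: image_image)
  qed
  then show ?thesis
    unfolding reduced_norm_def[of \<G>] gunits_HLS by (simp add: image_image)
qed

lemma reduced_norm_le_sum:
  assumes f: "f \<in> Cc \<G>" and S: "finite S" "S \<subseteq> carrier G" "\<And>n x. f (n, x) \<noteq> 0 \<Longrightarrow> x \<in> q n ` S"
  shows "reduced_norm (\<K> n) (HLS_restrict n f) \<le> (\<Sum>g\<in>S. cmod (f (n, q n g)))"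
proof -
  have "reduced_norm (\<K> n) (HLS_restrict n f) \<le> (\<Sum>z\<in>supp (HLS_restrict n f). cmod (HLS_restrict n f z))"
    by (rule F.reduced_norm_le[OF restrict_closed[OF f]])
      (auto intro: sum_nonneg F.n2_conv_le_sum restrict_closed f)
  also have "\<dots> \<le> (\<Sum>x\<in>q n ` S. cmod (f (n, x)))"
    unfolding HLS_restrict_def using S by (intro sum_mono2) (auto simp: supp_def)
  also have "\<dots> \<le> (\<Sum>g\<in>S. cmod (f (n, q n g)))"
    using sum_image_le[OF S(1), of "\<lambda>x. cmod (f (n, x))" "q n"] by (simp add: o_def)
  finally show ?thesis .
qed

lemma tends_bounded:
  fixes f :: "enat \<times> 'a set \<Rightarrow> 'y::real_normed_vector"
  assumes "tends f" "g \<in> carrier G"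
  obtains B where "\<And>n. norm (f (n, q n g)) \<le> B"
proof -
  obtain B where B: "\<And>n. norm (f (enat n, q (enat n) g)) \<le> B"
    using convergent_imp_Bseq[OF convergentI[OF tendsD[OF assms]]] by (auto simp: Bseq_def)
  have "norm (f (n, q n g)) \<le> max B (norm (f (\<infinity>, q \<infinity> g)))" for n
    using B by (cases n) (auto simp: max.coboundedI1)
  then show ?thesis by (rule that)
qed

lemma bdd_reduced_norm:
  assumes f: "f \<in> Cc \<G>"
  shows "bdd_above (range (\<lambda>n. reduced_norm (\<K> n) (HLS_restrict n f)))"
proof -
  obtain S where S: "finite S" "S \<subseteq> carrier G" "\<And>n x. f (n, x) \<noteq> 0 \<Longrightarrow> x \<in> q n ` S"
    using f by (rule Cc_HLS_cases) blast
  have "\<forall>g\<in>S. \<exists>B. \<forall>n. cmod (f (n, q n g)) \<le> B"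
    using S(2) by (meson Cc_HLS_tends f subsetD tends_bounded)
  then obtain B where B: "\<And>g n. g \<in> S \<Longrightarrow> cmod (f (n, q n g)) \<le> B g" by metis
  have "reduced_norm (\<K> n) (HLS_restrict n f) \<le> (\<Sum>g\<in>S. B g)" for n
    using reduced_norm_le_sum[OF f S, of n] sum_mono[of S "\<lambda>g. cmod (f (n, q n g))" B] B by force
  then show ?thesis by (intro bdd_aboveI2)
qed

lemma reduced_norm_restrict_le: "f \<in> Cc \<G> \<Longrightarrow> reduced_norm (\<K> n) (HLS_restrict n f) \<le> reduced_norm \<G> f"
  unfolding reduced_norm_HLS by (rule cSUP_upper[OF UNIV_I bdd_reduced_norm])

lemma reduced_norm_HLS_le:
  "(\<And>n. reduced_norm (\<K> n) (HLS_restrict n f) \<le> c) \<Longrightarrow> reduced_norm \<G> f \<le> c"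
  unfolding reduced_norm_HLS by (rule cSUP_least) auto

lemma reduced_norm_HLS_nonneg: "f \<in> Cc \<G> \<Longrightarrow> 0 \<le> reduced_norm \<G> f"
  using reduced_norm_restrict_le[of f \<infinity>] F.reduced_norm_nonneg[OF restrict_closed, of f \<infinity>] by linarith

lemma reduced_norm_HLS_smult:
  assumes f: "f \<in> Cc \<G>"
  shows "reduced_norm \<G> (\<lambda>\<gamma>. z * f \<gamma>) = cmod z * reduced_norm \<G> f"
proof -
  have le: "reduced_norm \<G> (\<lambda>\<gamma>. z * f \<gamma>) \<le> cmod z * reduced_norm \<G> f" if f: "f \<in> Cc \<G>" for z f
    by (rule reduced_norm_HLS_le)
      (simp add: restrict_smult F.reduced_norm_smult restrict_closed f mult_left_mono reduced_norm_restrict_le)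
  show ?thesis
  proof (cases "z = 0")
    case True
    then show ?thesis
      using le[OF f, of z] reduced_norm_HLS_nonneg[OF HLS_zero_closed] by simp
  next
    case False
    have "reduced_norm \<G> f \<le> cmod (inverse z) * reduced_norm \<G> (\<lambda>x. z * f x)"
      using le[OF HLS_smult_closed[OF f, of z], of "inverse z"] False
      by (simp only: mult.assoc[symmetric]) simp
    then have "cmod z * reduced_norm \<G> f \<le> cmod z * (inverse (cmod z) * reduced_norm \<G> (\<lambda>x. z * f x))"
      by (intro mult_left_mono) (simp_all add: norm_inverse)
    then have "cmod z * reduced_norm \<G> f \<le> reduced_norm \<G> (\<lambda>x. z * f x)"
      using False by (simp add: mult.assoc[symmetric])
    then show ?thesis using le[OF f, of z] by simp
  qed
qed

lemma reduced_norm_HLS_cstar: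
  assumes f: "f \<in> Cc \<G>"
  shows "reduced_norm \<G> (conv \<G> (gstar \<G> f) f) = (reduced_norm \<G> f)\<^sup>2"
proof (rule antisym)
  have eq: "reduced_norm (\<K> n) (HLS_restrict n (conv \<G> (gstar \<G> f) f)) = (reduced_norm (\<K> n) (HLS_restrict n f))\<^sup>2" for n
    by (simp add: restrict_conv restrict_gstar F.reduced_norm_cstar restrict_closed f)
  show "reduced_norm \<G> (conv \<G> (gstar \<G> f) f) \<le> (reduced_norm \<G> f)\<^sup>2"
    by (rule reduced_norm_HLS_le)
      (simp add: eq power_mono reduced_norm_restrict_le F.reduced_norm_nonneg restrict_closed f)
  have C: "conv \<G> (gstar \<G> f) f \<in> Cc \<G>" by (intro HLS_conv_closed HLS_gstar_closed f)
  have "reduced_norm \<G> f \<le> sqrt (reduced_norm \<G> (conv \<G> (gstar \<G> f) f))"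
    by (rule reduced_norm_HLS_le) (metis C eq real_le_rsqrt reduced_norm_restrict_le)
  then have "(reduced_norm \<G> f)\<^sup>2 \<le> (sqrt (reduced_norm \<G> (conv \<G> (gstar \<G> f) f)))\<^sup>2"
    by (rule power_mono) (rule reduced_norm_HLS_nonneg[OF f])
  then show "(reduced_norm \<G> f)\<^sup>2 \<le> reduced_norm \<G> (conv \<G> (gstar \<G> f) f)"
    using C by (simp add: reduced_norm_HLS_nonneg)
qed

lemma pre_cstar_HLS: "pre_cstar (Cc_alg \<G>)"
proof (rule pre_cstar.intro, simp_all only: Cc_alg_simps)
  show "Module.module (ring_of_type_algebra :: complex ring) (Cc_alg \<G>)"
    by (rule module_Cc_alg) (simp_all add: HLS_add_closed HLS_smult_closed HLS_zero_closed)
  note restrict = restrict_conv restrict_gstar restrict_add restrict_smult restrict_one restrict_closed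
  fix f assume f: "f \<in> Cc \<G>"
  show "conv \<G> (\<lambda>\<gamma>. if \<gamma> \<in> gunits \<G> then 1 else 0) f = f" "conv \<G> f (\<lambda>\<gamma>. if \<gamma> \<in> gunits \<G> then 1 else 0) = f"
    by (rule HLS_ext, simp add: restrict f F.conv_delta_left F.conv_delta_right)+
  show "gstar \<G> (gstar \<G> f) = f"
    by (rule HLS_ext) (simp add: restrict f F.gstar_gstar)
  show "gstar \<G> (\<lambda>\<gamma>. z * f \<gamma>) = (\<lambda>\<gamma>. cnj z * gstar \<G> f \<gamma>)" for z
    by (auto simp: gstar_def)
  fix g assume g: "g \<in> Cc \<G>"
  show "conv \<G> (\<lambda>\<gamma>. z * f \<gamma>) g = (\<lambda>\<gamma>. z * conv \<G> f g \<gamma>)" "conv \<G> f (\<lambda>\<gamma>. z * g \<gamma>) = (\<lambda>\<gamma>. z * conv \<G> f g \<gamma>)" for z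
    by (rule HLS_ext, simp add: restrict f g F.conv_smult_left F.conv_smult_right)+
  show "gstar \<G> (\<lambda>\<gamma>. f \<gamma> + g \<gamma>) = (\<lambda>\<gamma>. gstar \<G> f \<gamma> + gstar \<G> g \<gamma>)"
    by (auto simp: gstar_def)
  show "gstar \<G> (conv \<G> f g) = conv \<G> (gstar \<G> g) (gstar \<G> f)"
    by (rule HLS_ext) (simp add: restrict f g F.gstar_conv)
  show "reduced_norm \<G> (\<lambda>\<gamma>. f \<gamma> + g \<gamma>) \<le> reduced_norm \<G> f + reduced_norm \<G> g"
    by (rule reduced_norm_HLS_le, unfold restrict_add,
        rule order_trans[OF F.reduced_norm_add[OF restrict_closed[OF f] restrict_closed[OF g]]],
        intro add_mono reduced_norm_restrict_le f g)
  show "reduced_norm \<G> (conv \<G> f g) \<le> reduced_norm \<G> f * reduced_norm \<G> g"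
    by (rule reduced_norm_HLS_le, unfold restrict_conv,
        rule order_trans[OF F.reduced_norm_conv[OF restrict_closed[OF f] restrict_closed[OF g]]],
        intro mult_mono reduced_norm_restrict_le reduced_norm_HLS_nonneg F.reduced_norm_nonneg restrict_closed f g)
  fix h assume h: "h \<in> Cc \<G>"
  show "conv \<G> (conv \<G> f g) h = conv \<G> f (conv \<G> g h)"
    by (rule HLS_ext) (simp add: restrict f g h F.conv_assoc)
  show "conv \<G> (\<lambda>\<gamma>. f \<gamma> + g \<gamma>) h = (\<lambda>\<gamma>. conv \<G> f h \<gamma> + conv \<G> g h \<gamma>)"
    by (rule HLS_ext) (simp add: restrict f g h F.conv_add_left)
  show "conv \<G> h (\<lambda>\<gamma>. f \<gamma> + g \<gamma>) = (\<lambda>\<gamma>. conv \<G> h f \<gamma> + conv \<G> h g \<gamma>)"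
    by (rule HLS_ext) (simp add: restrict f g h F.conv_add_right)
qed (simp_all add: HLS_conv_closed HLS_gstar_closed HLS_one_closed reduced_norm_HLS_nonneg
      reduced_norm_HLS_smult reduced_norm_HLS_cstar)

end

section \<open>Continuity of the norms under uniform rapid decay\<close>

context hls
begin

text \<open>The norm \<open>\<parallel>\<cdot>\<parallel>\<^sub>2\<^sub>,\<^sub>p\<close> of the restriction of \<open>f\<close> to the fibre over \<open>n\<close>. Source and range fibres of
  a group coincide, so the maximum in the definition of this norm disappears.\<close>

definition wnorm :: "(enat \<times> 'a set \<Rightarrow> real) \<Rightarrow> real \<Rightarrow> enat \<Rightarrow> (enat \<times> 'a set \<Rightarrow> complex) \<Rightarrow> real" where
  "wnorm l p n f = sqrt (\<Sum>\<^sub>\<infinity>x\<in>carrier (F n). (cmod (f (n, x)))\<^sup>2 * (1 + l (n, x)) powr (2 * p))"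

lemma norm2_group: "norm2 (\<K> n) (\<lambda>x. l (n, x)) p (HLS_restrict n f) = wnorm l p n f"
  by (simp add: norm2_def wnorm_def HLS_restrict_def)

lemma norm2_HLS: "norm2 \<G> l p f = (SUP n. wnorm l p n f)"
  unfolding norm2_def gunits_HLS
  by (simp add: image_image src_fibre_HLS rng_fibre_HLS infsum_Pair wnorm_def)

lemma wnorm_eq:
  assumes S: "finite S" "S \<subseteq> carrier G" "\<And>n x. f (n, x) \<noteq> 0 \<Longrightarrow> x \<in> q n ` S"
  shows "wnorm l p n f = sqrt (\<Sum>x\<in>q n ` S. (cmod (f (n, x)))\<^sup>2 * (1 + l (n, x)) powr (2 * p))"
proof -
  have "q n ` S \<subseteq> carrier (F n)" using S(2) by auto
  then have "(\<Sum>\<^sub>\<infinity>x\<in>carrier (F n). (cmod (f (n, x)))\<^sup>2 * (1 + l (n, x)) powr (2 * p))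
      = (\<Sum>\<^sub>\<infinity>x\<in>q n ` S. (cmod (f (n, x)))\<^sup>2 * (1 + l (n, x)) powr (2 * p))"
    by (intro infsum_cong_neutral) (use S(3) in auto)
  then show ?thesis using S(1) by (simp add: wnorm_def infsum_finite)
qed

lemma n2_restrict_eq:
  assumes S: "finite S" "S \<subseteq> carrier G" "\<And>n x. f (n, x) \<noteq> 0 \<Longrightarrow> x \<in> q n ` S"
  shows "n2 (HLS_restrict n f) = sqrt (\<Sum>x\<in>q n ` S. (cmod (f (n, x)))\<^sup>2)"
proof -
  have "n2 (HLS_restrict n f) = L2_set (\<lambda>x. cmod (HLS_restrict n f x)) (q n ` S)"
    by (rule n2_eq) (use S in \<open>auto simp: supp_restrict\<close>)
  then show ?thesis by (simp add: L2_set_def HLS_restrict_def)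
qed

lemma tendsto_n2:
  assumes f: "f \<in> Cc \<G>"
  shows "(\<lambda>n. n2 (HLS_restrict (enat n) f)) \<longlonglongrightarrow> n2 (HLS_restrict \<infinity> f)"
proof -
  obtain S where S: "finite S" "S \<subseteq> carrier G" "\<And>n x. f (n, x) \<noteq> 0 \<Longrightarrow> x \<in> q n ` S"
    using f by (rule Cc_HLS_cases) blast
  let ?\<phi> = "\<lambda>\<gamma>. (cmod (f \<gamma>))\<^sup>2"
  have "(\<lambda>n. \<Sum>x\<in>q (enat n) ` S. ?\<phi> (enat n, x)) \<longlonglongrightarrow> (\<Sum>x\<in>q \<infinity> ` S. ?\<phi> (\<infinity>, x))"
    by (rule tendsto_fibre_sum[OF S(1,2)])
      (use S(2) in \<open>auto intro!: tendsto_intros tendsD Cc_HLS_tends f\<close>)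
  then show ?thesis
    using n2_restrict_eq[of S f, OF S] by (simp add: tendsto_real_sqrt)
qed

lemma tendsto_wnorm:
  assumes f: "f \<in> Cc \<G>" and l: "tends l" and pos: "\<And>x. x \<in> carrier (F \<infinity>) \<Longrightarrow> l (\<infinity>, x) \<ge> 0"
  shows "(\<lambda>n. wnorm l p (enat n) f) \<longlonglongrightarrow> wnorm l p \<infinity> f"
proof -
  obtain S where S: "finite S" "S \<subseteq> carrier G" "\<And>n x. f (n, x) \<noteq> 0 \<Longrightarrow> x \<in> q n ` S"
    using f by (rule Cc_HLS_cases) blast
  let ?\<phi> = "\<lambda>\<gamma>. (cmod (f \<gamma>))\<^sup>2 * (1 + l \<gamma>) powr (2 * p)"
  have "(\<lambda>n. \<Sum>x\<in>q (enat n) ` S. ?\<phi> (enat n, x)) \<longlonglongrightarrow> (\<Sum>x\<in>q \<infinity> ` S. ?\<phi> (\<infinity>, x))"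
  proof (rule tendsto_fibre_sum[OF S(1,2)])
    fix g assume "g \<in> S"
    then have g: "g \<in> carrier G" using S(2) by blast
    have "1 + l (\<infinity>, q \<infinity> g) \<noteq> 0" using pos[of "q \<infinity> g"] g by auto
    then show "(\<lambda>n. ?\<phi> (enat n, q (enat n) g)) \<longlonglongrightarrow> ?\<phi> (\<infinity>, q \<infinity> g)"
      by (intro tendsto_intros tendsD Cc_HLS_tends f g l disjI1)
  qed
  then show ?thesis
    using wnorm_eq[of S f, OF S] by (simp add: tendsto_real_sqrt)
qed

subsection \<open>Lifts\<close>

text \<open>The point mass at \<open>g\<close> extends to the indicator of \<open>bis g\<close>; a finitely supported function extends
  linearly, which adds up the values over all \<open>g\<close> of its support that share a coset.\<close>

lemma lift_infinity:
  assumes x: "x \<in> Cc (\<K> \<infinity>)"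
  obtains f where "f \<in> Cc \<G>" "HLS_restrict \<infinity> f = x"
proof -
  define S where "S = {g \<in> carrier G. x {g} \<noteq> 0}"
  define f where "f = (\<lambda>(n, y). \<Sum>g\<in>{g\<in>S. q n g = y}. x {g})"
  have "inj_on (\<lambda>g. {g}) S" by (simp add: inj_on_def)
  moreover have "(\<lambda>g. {g}) ` S \<subseteq> supp x" by (auto simp: S_def supp_def)
  ultimately have S: "finite S" "S \<subseteq> carrier G"
    using F.CcD(1)[OF x] by (auto simp: S_def dest: finite_subset finite_imageD)
  have fq: "f (\<infinity>, q \<infinity> g) = x (q \<infinity> g)" if g: "g \<in> carrier G" for g
  proof -
    have "{h\<in>S. q \<infinity> h = q \<infinity> g} = (if g \<in> S then {g} else {})"
      using S(2) g by (auto simp: q_infinity)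
    then show ?thesis using g by (auto simp: f_def q_infinity S_def)
  qed
  have "f \<in> Cc \<G>"
  proof (rule Cc_HLS_I[where S=S])
    show "y \<in> q n ` S" if "f (n, y) \<noteq> 0" for n y
    proof (rule ccontr)
      assume "y \<notin> q n ` S"
      then have "{g\<in>S. q n g = y} = {}" by blast
      then have "f (n, y) = 0" by (simp only: f_def case_prod_conv sum.empty)
      then show False using that by simp
    qed
    show "f (n, y) = 0" if "y \<notin> carrier (F n)" for n y
    proof -
      have "{g\<in>S. q n g = y} = {}" using that S(2) by auto
      then show ?thesis by (simp only: f_def case_prod_conv sum.empty)
    qed
    show "tends f"
      unfolding tends_def
    proof
      fix g assume g: "g \<in> carrier G"
      have ev: "\<forall>\<^sub>F n in sequentially. \<forall>h\<in>S. h \<noteq> g \<longrightarrow> q (enat n) h \<noteq> q (enat n) g"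
        using S g by (intro eventually_ball_finite ballI)
          (auto intro: eventually_q_neq simp: subset_iff eventually_const_iff)
      then have "\<forall>\<^sub>F n in sequentially. f (enat n, q (enat n) g) = f (\<infinity>, q \<infinity> g)"
      proof (rule eventually_mono)
        fix n assume n: "\<forall>h\<in>S. h \<noteq> g \<longrightarrow> q (enat n) h \<noteq> q (enat n) g"
        have "{h\<in>S. q (enat n) h = q (enat n) g} = (if g \<in> S then {g} else {})"
          using n by auto
        then show "f (enat n, q (enat n) g) = f (\<infinity>, q \<infinity> g)"
          using g unfolding fq[OF g] by (auto simp: f_def q_infinity S_def)
      qed
      then show "(\<lambda>n. f (enat n, q (enat n) g)) \<longlonglongrightarrow> f (\<infinity>, q \<infinity> g)"
        by (rule tendsto_eventually)
    qed
  qed (use S in auto)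
  moreover have "HLS_restrict \<infinity> f = x"
  proof
    fix y
    show "HLS_restrict \<infinity> f y = x y"
    proof (cases "y \<in> carrier (F \<infinity>)")
      case True
      then show ?thesis using fq by (auto simp: carrier_F HLS_restrict_def)
    next
      case False
      then show ?thesis
        using Cc_HLS_off[OF \<open>f \<in> Cc \<G>\<close>] F.CcD(3)[OF x] by (simp add: HLS_restrict_def)
    qed
  qed
  ultimately show ?thesis by (rule that)
qed

lemma lift_enat:
  assumes x: "x \<in> Cc (\<K> (enat k))"
  obtains f where "f \<in> Cc \<G>" "HLS_restrict (enat k) f = x"
proof -
  have "supp x \<subseteq> q (enat k) ` carrier G"
    using F.CcD(2)[OF x] by (simp add: carrier_F)
  from finite_subset_image[OF F.CcD(1)[OF x] this]
  obtain S where S: "S \<subseteq> carrier G" "finite S" "supp x = q (enat k) ` S" by blast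
  define f where "f = (\<lambda>(n, y). if n = enat k then x y else 0)"
  have "f \<in> Cc \<G>"
  proof (rule Cc_HLS_I[where S=S])
    show "tends f"
      unfolding tends_def
    proof
      fix g assume g: "g \<in> carrier G"
      have "\<forall>\<^sub>F n in sequentially. f (enat n, q (enat n) g) = f (\<infinity>, q \<infinity> g)"
        by (rule eventually_mono[OF eventually_gt_at_top[of k]]) (simp add: f_def)
      then show "(\<lambda>n. f (enat n, q (enat n) g)) \<longlonglongrightarrow> f (\<infinity>, q \<infinity> g)"
        by (rule tendsto_eventually)
    qed
    show "y \<in> q n ` S" if "f (n, y) \<noteq> 0" for n y
      using that S(3) by (auto simp: f_def supp_def split: if_splits)
  qed (use S F.CcD(3)[OF x] in \<open>auto simp: f_def\<close>)
  moreover have "HLS_restrict (enat k) f = x" by (auto simp: HLS_restrict_def f_def)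
  ultimately show ?thesis by (rule that)
qed

lemma lift_exists:
  assumes x: "x \<in> Cc (\<K> n)"
  obtains f where "f \<in> Cc \<G>" "HLS_restrict n f = x"
  using assms lift_infinity lift_enat by (cases n) metis+

subsection \<open>Lower semicontinuity\<close>

text \<open>A finitely supported vector that nearly attains the norm at \<open>\<infinity>\<close> lifts to a section, and the
  \<open>l\<^sup>2\<close> norms of sections converge.\<close>

lemma reduced_norm_lower:
  assumes f: "f \<in> Cc \<G>" and c: "c < reduced_norm (\<K> \<infinity>) (HLS_restrict \<infinity> f)"
  shows "\<forall>\<^sub>F n in sequentially. c < reduced_norm (\<K> (enat n)) (HLS_restrict (enat n) f)"
proof (cases "c < 0")
  case True
  have "c < reduced_norm (\<K> (enat n)) (HLS_restrict (enat n) f)" for n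
    using F.reduced_norm_nonneg[OF restrict_closed[OF f, of "enat n"]] True by linarith
  then show ?thesis by simp
next
  case False
  note f0 = restrict_closed[OF f, of \<infinity>]
  obtain g where g: "g \<in> Cc (\<K> \<infinity>)" "c * n2 g < n2 (conv (\<K> \<infinity>) (HLS_restrict \<infinity> f) g)"
    using F.reduced_norm_le[OF f0, of c] c False by (meson leI not_le)
  obtain h where h: "h \<in> Cc \<G>" "HLS_restrict \<infinity> h = g" using g(1) by (rule lift_exists)
  have fh: "conv \<G> f h \<in> Cc \<G>" by (rule HLS_conv_closed[OF f h(1)])
  have lim1: "(\<lambda>n. n2 (HLS_restrict (enat n) (conv \<G> f h))) \<longlonglongrightarrow> n2 (HLS_restrict \<infinity> (conv \<G> f h))"
    by (rule tendsto_n2[OF fh])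
  have lim2: "(\<lambda>n. c * n2 (HLS_restrict (enat n) h)) \<longlonglongrightarrow> c * n2 (HLS_restrict \<infinity> h)"
    by (intro tendsto_intros tendsto_n2 h)
  have "c * n2 (HLS_restrict \<infinity> h) < n2 (HLS_restrict \<infinity> (conv \<G> f h))"
    using g(2) by (simp add: h(2) restrict_conv)
  then obtain m where m: "c * n2 (HLS_restrict \<infinity> h) < m" "m < n2 (HLS_restrict \<infinity> (conv \<G> f h))"
    using dense by blast
  have "\<forall>\<^sub>F n in sequentially. c * n2 (HLS_restrict (enat n) h) < n2 (HLS_restrict (enat n) (conv \<G> f h))"
    using order_tendstoD(1)[OF lim1 m(2)] order_tendstoD(2)[OF lim2 m(1)]
    by eventually_elim simp
  then show ?thesis
  proof (rule eventually_mono)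
    fix n assume "c * n2 (HLS_restrict (enat n) h) < n2 (HLS_restrict (enat n) (conv \<G> f h))"
    also have "\<dots> \<le> reduced_norm (\<K> (enat n)) (HLS_restrict (enat n) f) * n2 (HLS_restrict (enat n) h)"
      unfolding restrict_conv by (intro F.n2_conv_le restrict_closed f h)
    finally show "c < reduced_norm (\<K> (enat n)) (HLS_restrict (enat n) f)"
      using n2_nonneg by (rule mult_less_cancel_right_pos[THEN iffD1, rotated] mult_right_less_imp_less)
  qed
qed

subsection \<open>Upper semicontinuity\<close>

text \<open>Passing from \<open>f\<close> to \<open>f\<^sup>*f\<close> squares the norm exactly, by the \<open>C\<^sup>*\<close>-identity, but only doubles the
  length of the support.\<close>

primrec sq_iter :: "(enat \<times> 'a set \<Rightarrow> complex) \<Rightarrow> nat \<Rightarrow> enat \<times> 'a set \<Rightarrow> complex" where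
  "sq_iter f 0 = f"
| "sq_iter f (Suc j) = conv \<G> (gstar \<G> (sq_iter f j)) (sq_iter f j)"

lemma sq_iter_closed: "f \<in> Cc \<G> \<Longrightarrow> sq_iter f j \<in> Cc \<G>"
  by (induction j) (auto intro: HLS_conv_closed HLS_gstar_closed)

lemma reduced_norm_sq_iter:
  assumes f: "f \<in> Cc \<G>"
  shows "reduced_norm (\<K> n) (HLS_restrict n (sq_iter f j)) = (reduced_norm (\<K> n) (HLS_restrict n f)) ^ (2 ^ j)"
proof (induction j)
  case (Suc j)
  then show ?case
    by (simp add: restrict_conv restrict_gstar F.reduced_norm_cstar restrict_closed sq_iter_closed f
        power_mult[symmetric] mult.commute)
qed simp

lemma length_sq_iter:
  assumes l: "length_function \<G> l" and f: "f \<in> Cc \<G>"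
    and R: "\<And>x. f (\<infinity>, x) \<noteq> 0 \<Longrightarrow> l (\<infinity>, x) \<le> R"
  shows "sq_iter f j (\<infinity>, x) \<noteq> 0 \<Longrightarrow> l (\<infinity>, x) \<le> 2 ^ j * R"
proof (induction j arbitrary: x)
  case 0
  then show ?case using R by simp
next
  case (Suc j)
  let ?t = "HLS_restrict \<infinity> (sq_iter f j)"
  have t: "?t \<in> Cc (\<K> \<infinity>)" by (rule restrict_closed[OF sq_iter_closed[OF f]])
  have "x \<in> supp (conv (\<K> \<infinity>) (gstar (\<K> \<infinity>) ?t) ?t)"
    using Suc.prems fun_cong[OF restrict_conv[of \<infinity> "gstar \<G> (sq_iter f j)" "sq_iter f j"], of x]
    by (simp add: restrict_gstar supp_def) (simp add: HLS_restrict_def)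
  from subsetD[OF F.supp_conv[OF F.gstar_closed[OF t]] this]
  obtain z w where zw: "z \<in> supp (gstar (\<K> \<infinity>) ?t)" "w \<in> supp ?t" "w \<in> carrier (F \<infinity>)" "x = z \<otimes>\<^bsub>F \<infinity>\<^esub> w"
    by auto
  then obtain v where v: "v \<in> supp ?t" "z = inv\<^bsub>F \<infinity>\<^esub> v"
    using F.supp_gstar[OF t] by auto
  have vG: "v \<in> carrier (F \<infinity>)" using F.CcD(2)[OF t] v by blast
  have lv: "l (\<infinity>, v) \<le> 2 ^ j * R" and lw: "l (\<infinity>, w) \<le> 2 ^ j * R"
    using v(1) zw(2) by (auto simp: supp_restrict intro: Suc.IH)
  have "l (\<infinity>, x) = l (comp \<G> (\<infinity>, z) (\<infinity>, w))" by (simp add: zw(4))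
  also have "\<dots> \<le> l (\<infinity>, z) + l (\<infinity>, w)"
  proof -
    have "(\<infinity>, z) \<in> arrows \<G>" "(\<infinity>, w) \<in> arrows \<G>" using zw(3) v vG by (auto simp: arrows_HLS)
    moreover have "src \<G> (\<infinity>, z) = rng \<G> (\<infinity>, w)" by simp
    ultimately show ?thesis using l unfolding length_function_def by blast
  qed
  also have "l (\<infinity>, z) = l (ginv \<G> (\<infinity>, v))" by (simp add: v(2))
  also have "\<dots> = l (\<infinity>, v)"
  proof -
    have "(\<infinity>, v) \<in> arrows \<G>" using vG by (simp add: arrows_HLS)
    then show ?thesis using l unfolding length_function_def by blast
  qed
  finally show ?case using lv lw by simp
qed

lemma wnorm_infinity_le:
  assumes h: "h \<in> Cc \<G>" and pos: "\<And>x. x \<in> carrier (F \<infinity>) \<Longrightarrow> l (\<infinity>, x) \<ge> 0" and p: "p \<ge> 0"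
    and R: "\<And>x. h (\<infinity>, x) \<noteq> 0 \<Longrightarrow> l (\<infinity>, x) \<le> R" and R0: "R \<ge> 0"
  shows "wnorm l p \<infinity> h \<le> (1 + R) powr p * n2 (HLS_restrict \<infinity> h)"
proof -
  obtain S where S: "finite S" "S \<subseteq> carrier G" "\<And>n x. h (n, x) \<noteq> 0 \<Longrightarrow> x \<in> q n ` S"
    using h by (rule Cc_HLS_cases) blast
  have "(\<Sum>x\<in>q \<infinity> ` S. (cmod (h (\<infinity>, x)))\<^sup>2 * (1 + l (\<infinity>, x)) powr (2 * p))
      \<le> (\<Sum>x\<in>q \<infinity> ` S. (cmod (h (\<infinity>, x)))\<^sup>2 * (1 + R) powr (2 * p))"
  proof (rule sum_mono)
    fix x assume "x \<in> q \<infinity> ` S"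
    then have x: "x \<in> carrier (F \<infinity>)" using S(2) by auto
    show "(cmod (h (\<infinity>, x)))\<^sup>2 * (1 + l (\<infinity>, x)) powr (2 * p) \<le> (cmod (h (\<infinity>, x)))\<^sup>2 * (1 + R) powr (2 * p)"
      using pos[OF x] R[of x] p by (cases "h (\<infinity>, x) = 0") (auto intro!: mult_left_mono powr_mono2)
  qed
  also have "\<dots> = ((1 + R) powr p)\<^sup>2 * (\<Sum>x\<in>q \<infinity> ` S. (cmod (h (\<infinity>, x)))\<^sup>2)"
    using R0 by (simp add: sum_distrib_left mult.commute powr_power)
  finally have "wnorm l p \<infinity> h \<le> sqrt (((1 + R) powr p)\<^sup>2 * (\<Sum>x\<in>q \<infinity> ` S. (cmod (h (\<infinity>, x)))\<^sup>2))"
    using wnorm_eq[of S h, OF S] by simp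
  also have "\<dots> = (1 + R) powr p * n2 (HLS_restrict \<infinity> h)"
    using n2_restrict_eq[of S h, OF S] by (simp add: real_sqrt_mult)
  finally show ?thesis .
qed

end

text \<open>High powers of \<open>a < \<nu>\<close> absorb a factor that grows polynomially in the exponent.\<close>

lemma exists_power_dominates:
  fixes a \<nu> C p R :: real
  assumes "0 \<le> a" "a < \<nu>" "C > 0" "p > 0" "R \<ge> 0"
  obtains j :: nat where "C * ((1 + 2 ^ j * R) powr p * a ^ (2 ^ j)) < \<nu> ^ (2 ^ j)"
proof -
  \<comment> \<open>The maximum keeps \<open>r\<close> positive, so that \<open>ln r\<close> makes sense, also for \<open>a = 0\<close>.\<close>
  define r where "r = max (a / \<nu>) (1 / 2)"
  have r: "0 < r" "r < 1" using assms by (auto simp: r_def)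
  define b where "b = - ln r"
  have b: "b > 0" using r by (simp add: b_def)
  have "((\<lambda>x. C * (1 + x * (R + 1)) powr p * exp (- b * x)) \<longlongrightarrow> 0) at_top"
    using assms b by real_asymp
  moreover have "filterlim (\<lambda>j::nat. 2 ^ j :: real) at_top sequentially"
    by real_asymp
  ultimately have "(\<lambda>j::nat. C * (1 + 2 ^ j * (R + 1)) powr p * exp (- b * 2 ^ j)) \<longlonglongrightarrow> 0"
    by (rule filterlim_compose)
  then have "\<forall>\<^sub>F j in sequentially. C * (1 + 2 ^ j * (R + 1)) powr p * exp (- b * 2 ^ j) < 1"
    by (rule order_tendstoD) simp
  then obtain j where j: "C * (1 + 2 ^ j * (R + 1)) powr p * exp (- b * 2 ^ j) < 1"
    by (auto simp: eventually_sequentially)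
  have e: "exp (- (b * 2 ^ j)) = r ^ (2 ^ j)"
    using exp_of_nat_mult[of "2 ^ j" "ln r"] r by (simp add: b_def mult.commute)
  have "a ^ (2 ^ j) = (a / \<nu>) ^ (2 ^ j) * \<nu> ^ (2 ^ j)"
    using assms by (simp add: power_divide)
  also have "\<dots> \<le> r ^ (2 ^ j) * \<nu> ^ (2 ^ j)"
    using assms by (intro mult_right_mono power_mono) (auto simp: r_def)
  finally have "C * ((1 + 2 ^ j * R) powr p * a ^ (2 ^ j)) \<le> C * ((1 + 2 ^ j * (R + 1)) powr p * (r ^ (2 ^ j) * \<nu> ^ (2 ^ j)))"
    using assms by (intro mult_left_mono mult_mono powr_mono2) auto
  also have "\<dots> = (C * (1 + 2 ^ j * (R + 1)) powr p * exp (- b * 2 ^ j)) * \<nu> ^ (2 ^ j)"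
    by (simp add: e mult_ac)
  also have "\<dots> < 1 * \<nu> ^ (2 ^ j)"
    using assms j by (intro mult_strict_right_mono) auto
  finally show ?thesis using that by simp
qed

locale hls_rd = hls +
  fixes l :: "enat \<times> 'a set \<Rightarrow> real"
  assumes length_function: "length_function \<G> l"
    and uniform_rd: "\<exists>C>0. \<exists>p>0. \<forall>f\<in>Cc \<G>. \<forall>n. reduced_norm (\<K> n) (HLS_restrict n f) \<le> C * wnorm l p n f"
begin

lemma tends_length: "tends l"
  using length_function by (simp add: length_function_def continuous_map_HLS_iff)

lemma length_nonneg: "x \<in> carrier (F n) \<Longrightarrow> l (n, x) \<ge> 0"
  using length_function by (auto simp: length_function_def arrows_HLS)

text \<open>This is where rapid decay enters. With \<open>t = sq_iter f j\<close> and \<open>m = 2\<^sup>j\<close> it bounds \<open>\<parallel>f\<^sub>n\<parallel>\<^sup>m = \<parallel>t\<^sub>n\<parallel>\<close> by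
  \<open>C \<parallel>t\<^sub>n\<parallel>\<^sub>2\<^sub>,\<^sub>p\<close>. The latter is a finite sum, hence converges to its value at \<open>\<infinity>\<close>, which is at most
  \<open>C (1 + m R)\<^sup>p \<parallel>t\<^sub>\<infinity>\<parallel>\<^sub>2 \<le> C (1 + m R)\<^sup>p \<parallel>f\<^sub>\<infinity>\<parallel>\<^sup>m\<close>. Taking \<open>m\<close>-th roots for large \<open>m\<close> removes
  the polynomial factor.\<close>

lemma reduced_norm_upper:
  assumes f: "f \<in> Cc \<G>" and \<nu>: "reduced_norm (\<K> \<infinity>) (HLS_restrict \<infinity> f) < \<nu>"
  shows "\<forall>\<^sub>F n in sequentially. reduced_norm (\<K> (enat n)) (HLS_restrict (enat n) f) < \<nu>"
proof -
  let ?a = "reduced_norm (\<K> \<infinity>) (HLS_restrict \<infinity> f)"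
  have a: "?a \<ge> 0" by (intro F.reduced_norm_nonneg restrict_closed f)
  obtain C p where C: "C > 0" and p: "p > 0"
    and rd: "\<And>f n. f \<in> Cc \<G> \<Longrightarrow> reduced_norm (\<K> n) (HLS_restrict n f) \<le> C * wnorm l p n f"
    using uniform_rd by blast
  have fin: "finite (supp (HLS_restrict \<infinity> f))"
    by (rule F.CcD(1)[OF restrict_closed[OF f]])
  define R where "R = Max (insert 0 ((\<lambda>x. l (\<infinity>, x)) ` supp (HLS_restrict \<infinity> f)))"
  have R0: "R \<ge> 0" unfolding R_def using fin by (intro Max_ge) auto
  have R: "l (\<infinity>, x) \<le> R" if "f (\<infinity>, x) \<noteq> 0" for x
    unfolding R_def using fin that by (intro Max_ge) (auto simp: supp_restrict)
  obtain j where j: "C * ((1 + 2 ^ j * R) powr p * ?a ^ (2 ^ j)) < \<nu> ^ (2 ^ j)"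
    using exists_power_dominates[OF a \<nu> C p R0] by blast
  let ?t = "sq_iter f j"
  have t: "?t \<in> Cc \<G>" by (rule sq_iter_closed[OF f])
  have "wnorm l p \<infinity> ?t \<le> (1 + 2 ^ j * R) powr p * n2 (HLS_restrict \<infinity> ?t)"
    by (rule wnorm_infinity_le[OF t]) (use p R0 length_nonneg length_sq_iter[OF length_function f R] in auto)
  also have "\<dots> \<le> (1 + 2 ^ j * R) powr p * ?a ^ (2 ^ j)"
    unfolding reduced_norm_sq_iter[OF f, symmetric]
    by (intro mult_left_mono F.n2_le_reduced_norm restrict_closed t) auto
  finally have "C * wnorm l p \<infinity> ?t \<le> C * ((1 + 2 ^ j * R) powr p * ?a ^ (2 ^ j))"
    by (rule mult_left_mono) (use C in simp)
  also note j
  finally have "C * wnorm l p \<infinity> ?t < \<nu> ^ (2 ^ j)" .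
  moreover have "(\<lambda>n. C * wnorm l p (enat n) ?t) \<longlonglongrightarrow> C * wnorm l p \<infinity> ?t"
    by (intro tendsto_intros tendsto_wnorm t tends_length length_nonneg)
  ultimately have "\<forall>\<^sub>F n in sequentially. C * wnorm l p (enat n) ?t < \<nu> ^ (2 ^ j)"
    by (rule order_tendstoD[rotated])
  then show ?thesis
  proof (rule eventually_mono)
    fix n assume n: "C * wnorm l p (enat n) ?t < \<nu> ^ (2 ^ j)"
    have "(reduced_norm (\<K> (enat n)) (HLS_restrict (enat n) f)) ^ (2 ^ j) < \<nu> ^ (2 ^ j)"
      using rd[OF t, of "enat n"] n unfolding reduced_norm_sq_iter[OF f] by linarith
    then show "reduced_norm (\<K> (enat n)) (HLS_restrict (enat n) f) < \<nu>"
      by (rule power_less_imp_less_base) (use a \<nu> in linarith)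
  qed
qed

lemma tendsto_reduced_norm:
  assumes f: "f \<in> Cc \<G>"
  shows "(\<lambda>n. reduced_norm (\<K> (enat n)) (HLS_restrict (enat n) f)) \<longlonglongrightarrow> reduced_norm (\<K> \<infinity>) (HLS_restrict \<infinity> f)"
  by (rule order_tendstoI) (rule reduced_norm_lower[OF f] reduced_norm_upper[OF f], assumption)+

lemma rapid_decay_HLS: "rapid_decay \<G> l"
proof -
  obtain C p where C: "C > 0" and p: "p > 0"
    and rd: "\<And>f n. f \<in> Cc \<G> \<Longrightarrow> reduced_norm (\<K> n) (HLS_restrict n f) \<le> C * wnorm l p n f"
    using uniform_rd by blast
  have "reduced_norm \<G> f \<le> C * norm2 \<G> l p f" if f: "f \<in> Cc \<G>" for f
  proof (rule reduced_norm_HLS_le)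
    fix n
    have "Bseq (\<lambda>n. wnorm l p (enat n) f)"
      by (rule convergent_imp_Bseq[OF convergentI[OF tendsto_wnorm[OF f tends_length length_nonneg]]])
    then obtain B where B: "\<And>n. \<bar>wnorm l p (enat n) f\<bar> \<le> B" by (auto simp: Bseq_def)
    have "wnorm l p n f \<le> max B (wnorm l p \<infinity> f)" for n
      using B by (cases n) (auto simp: max.coboundedI1 abs_le_iff)
    then have "bdd_above (range (\<lambda>n. wnorm l p n f))" by (intro bdd_aboveI2)
    then have "wnorm l p n f \<le> norm2 \<G> l p f" unfolding norm2_HLS by (rule cSUP_upper[OF UNIV_I])
    then show "reduced_norm (\<K> n) (HLS_restrict n f) \<le> C * norm2 \<G> l p f"
      using rd[OF f, of n] C by (meson mult_left_mono less_imp_le order_trans)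
  qed
  then show ?thesis unfolding rapid_decay_def using C p by (meson less_imp_le)
qed

lemma cut_off:
  assumes f: "f \<in> Cc \<G>" and U: "open U"  "closed U" "n \<in> U"
    and le: "\<And>m. m \<in> U \<Longrightarrow> reduced_norm (\<K> m) (HLS_restrict m f) \<le> c"
  obtains h where "h \<in> Cc \<G>" "HLS_restrict n h = HLS_restrict n f" "reduced_norm \<G> h \<le> c"
proof -
  define u :: "enat \<Rightarrow> complex" where "u = (\<lambda>m. if m \<in> U then 1 else 0)"
  have "continuous_on (U \<union> - U) u"
    unfolding u_def using U by (intro continuous_on_cases) auto
  then have u: "continuous_map euclidean euclidean u" by (simp add: Un_commute)
  let ?h = "\<lambda>\<gamma>. u (fst \<gamma>) * f \<gamma>"
  have res: "HLS_restrict m ?h = (\<lambda>x. u m * HLS_restrict m f x)" for m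
    by (simp add: HLS_restrict_def)
  have "0 \<le> c"
    using le[OF U(3)] F.reduced_norm_nonneg[OF restrict_closed[OF f, of n]] by linarith
  then have "reduced_norm (\<K> m) (HLS_restrict m ?h) \<le> c" for m
    unfolding res F.reduced_norm_smult[OF restrict_closed[OF f]] using le[of m] by (simp add: u_def)
  then have "reduced_norm \<G> ?h \<le> c" by (rule reduced_norm_HLS_le)
  moreover have "HLS_restrict n ?h = HLS_restrict n f" unfolding res using U by (simp add: u_def)
  ultimately show ?thesis using that HLS_mult_closed[OF f u] by blast
qed

text \<open>The norm of a section is a supremum over the base, so a lift is cut off to a clopen neighbourhood of
  \<open>n\<close> on which upper semicontinuity controls its fibre norms.\<close>

lemma lift_norm:
  assumes x: "x \<in> Cc (\<K> n)" and e: "e > 0"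
  obtains f where "f \<in> Cc \<G>" "HLS_restrict n f = x" "reduced_norm \<G> f \<le> reduced_norm (\<K> n) x + e"
proof -
  obtain f where f: "f \<in> Cc \<G>" "HLS_restrict n f = x" using x by (rule lift_exists)
  have "\<exists>U. open U \<and> closed U \<and> n \<in> U \<and> (\<forall>m\<in>U. reduced_norm (\<K> m) (HLS_restrict m f) \<le> reduced_norm (\<K> n) x + e)"
  proof (cases n)
    case (enat k)
    then show ?thesis using e f(2) open_enat[of k] by (intro exI[of _ "{n}"]) auto
  next
    case infinity
    have "\<forall>\<^sub>F m in sequentially. reduced_norm (\<K> (enat m)) (HLS_restrict (enat m) f) < reduced_norm (\<K> n) x + e"
      by (rule reduced_norm_upper[OF f(1)]) (use e f(2) infinity in simp)
    then obtain k where k: "\<And>m. m \<ge> k \<Longrightarrow> reduced_norm (\<K> (enat m)) (HLS_restrict (enat m) f) < reduced_norm (\<K> n) x + e"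
      by (auto simp: eventually_sequentially)
    have "reduced_norm (\<K> m) (HLS_restrict m f) \<le> reduced_norm (\<K> n) x + e" if "m \<in> {enat k..}" for m
      using that k e f(2) infinity by (cases m) (auto simp: less_imp_le)
    moreover have "open {enat k..}" unfolding open_enat_iff by (auto intro!: exI[of _ k])
    ultimately show ?thesis using infinity by (intro exI[of _ "{enat k..}"]) auto
  qed
  then obtain U where U: "open U" "closed U" "n \<in> U"
      "\<And>m. m \<in> U \<Longrightarrow> reduced_norm (\<K> m) (HLS_restrict m f) \<le> reduced_norm (\<K> n) x + e"
    by blast
  from cut_off[OF f(1) U] show ?thesis using that f(2) by metis
qed

end

section \<open>The continuous field\<close>

context pre_cstar
begin

lemma geometric_cauchy:
  assumes x: "\<And>k. x k \<in> carrier A" and r: "0 \<le> r" "r < 1"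
    and le: "\<And>k. nrm A (x (Suc k) \<ominus> x k) \<le> c * r ^ k"
  shows "x \<in> cauchy_seqs A"
  unfolding cauchy_seqs_def
proof (intro CollectI conjI allI impI x)
  fix e :: real assume e: "e > 0"
  have c: "c \<ge> 0" using le[of 0] nrm_nonneg[OF minus_closed[OF x x], of "Suc 0" 0] by simp
  have step: "nrm A (x (k + m) \<ominus> x k) \<le> c * r ^ k * (1 - r ^ m) / (1 - r)" for k m
  proof (induction m)
    case 0
    then show ?case using x by (simp add: minus_eq r_neg nrm_zero)
  next
    case (Suc m)
    have "nrm A (x (k + Suc m) \<ominus> x k) \<le> nrm A (x (k + Suc m) \<ominus> x (k + m)) + nrm A (x (k + m) \<ominus> x k)"
      by (rule nrm_triangle[OF x x x])
    also have "\<dots> \<le> c * r ^ (k + m) + c * r ^ k * (1 - r ^ m) / (1 - r)"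
      using le[of "k + m"] Suc by simp
    also have "\<dots> = c * r ^ k * (1 - r ^ Suc m) / (1 - r)"
      using r by (simp add: field_simps power_add)
    finally show ?case .
  qed
  have step': "nrm A (x (k + m) \<ominus> x k) \<le> c * r ^ k / (1 - r)" for k m
    by (rule order_trans[OF step]) (use c r in \<open>auto intro!: divide_right_mono mult_left_le\<close>)
  have "(\<lambda>k. c * r ^ k / (1 - r)) \<longlonglongrightarrow> c * 0 / (1 - r)"
    using r by (intro tendsto_intros LIMSEQ_realpow_zero) auto
  then have "\<forall>\<^sub>F k in sequentially. c * r ^ k / (1 - r) < e / 2"
    using e by (intro order_tendstoD(2)) auto
  then obtain N where N: "c * r ^ N / (1 - r) < e / 2"
    by (auto simp: eventually_sequentially)
  have "nrm A (x i \<ominus> x j) < e" if "i \<ge> N" "j \<ge> N" for i j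
  proof -
    have "nrm A (x i \<ominus> x N) \<le> c * r ^ N / (1 - r)" "nrm A (x j \<ominus> x N) \<le> c * r ^ N / (1 - r)"
      using step'[of N "i - N"] step'[of N "j - N"] that by simp_all
    then show ?thesis
      using nrm_triangle[OF x x x, of i j N] nrm_minus_commute[OF x x, of N j] N by linarith
  qed
  then show "\<exists>N. \<forall>i\<ge>N. \<forall>j\<ge>N. nrm A (x i \<ominus> x j) < e" by blast
qed

end

lemma (in bounded_map) additive:
  assumes "a \<in> carrier A" "b \<in> carrier A"
  shows "\<phi> (a \<oplus>\<^bsub>A\<^esub> b) = \<phi> a \<oplus>\<^bsub>B\<^esub> \<phi> b"
proof -
  have "a \<oplus>\<^bsub>A\<^esub> b \<ominus>\<^bsub>A\<^esub> b = a"
    using assms by (simp add: a_minus_def A.a_assoc A.r_neg)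
  then have "\<phi> (a \<oplus>\<^bsub>A\<^esub> b) \<ominus>\<^bsub>B\<^esub> \<phi> b = \<phi> a"
    using assms minus[of "a \<oplus>\<^bsub>A\<^esub> b" b] by simp
  then show ?thesis
    using assms B.minus_add_cancel[of "\<phi> (a \<oplus>\<^bsub>A\<^esub> b)" "\<phi> b"] by (simp add: closed)
qed

text \<open>A Cauchy sequence with summable increments is lifted increment by increment.\<close>

lemma (in bounded_map) completion_map_surj:
  assumes lift: "\<And>y e. y \<in> carrier B \<Longrightarrow> e > 0 \<Longrightarrow> \<exists>x\<in>carrier A. \<phi> x = y \<and> nrm A x \<le> nrm B y + e"
    and b: "b \<in> carrier (completion B)"
  shows "\<exists>a\<in>carrier (completion A). completion_map B \<phi> a = b"
proof -
  obtain y where y: "y \<in> cauchy_seqs B" "b = B.cls y" using b by (rule B.completion_cases)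
  have "\<forall>k. \<exists>N. \<forall>i\<ge>N. \<forall>j\<ge>N. nrm B (y i \<ominus>\<^bsub>B\<^esub> y j) < (1 / 2) ^ k"
    using y(1) unfolding cauchy_seqs_def by simp
  then obtain N where N: "\<And>k i j. i \<ge> N k \<Longrightarrow> j \<ge> N k \<Longrightarrow> nrm B (y i \<ominus>\<^bsub>B\<^esub> y j) < (1 / 2) ^ k"
    by metis
  define s where "s k = k + (\<Sum>i\<le>k. N i)" for k
  have s: "s k \<ge> k" "s k \<ge> N k" "s (Suc k) \<ge> N k" for k
    unfolding s_def using member_le_sum[of k "{..k}" N] by auto
  have yB: "y k \<in> carrier B" for k using y(1) by simp
  have "\<exists>x\<in>carrier A. \<phi> x = y (s (Suc k)) \<ominus>\<^bsub>B\<^esub> y (s k) \<and> nrm A x \<le> 2 * (1 / 2) ^ k" for k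
  proof -
    have "nrm B (y (s (Suc k)) \<ominus>\<^bsub>B\<^esub> y (s k)) < (1 / 2) ^ k" using N s by blast
    then show ?thesis
      using lift[of "y (s (Suc k)) \<ominus>\<^bsub>B\<^esub> y (s k)" "(1 / 2) ^ k"] yB by force
  qed
  then obtain D where D: "\<And>k. D k \<in> carrier A" "\<And>k. \<phi> (D k) = y (s (Suc k)) \<ominus>\<^bsub>B\<^esub> y (s k)"
      "\<And>k. nrm A (D k) \<le> 2 * (1 / 2) ^ k"
    by metis
  obtain x0 where x0: "x0 \<in> carrier A" "\<phi> x0 = y (s 0)"
    using lift[of "y (s 0)" 1] yB by auto
  define x where "x = rec_nat x0 (\<lambda>k a. a \<oplus>\<^bsub>A\<^esub> D k)"
  have x_Suc: "x (Suc k) = x k \<oplus>\<^bsub>A\<^esub> D k" and x_0: "x 0 = x0" for k by (simp_all add: x_def)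
  have xA: "x k \<in> carrier A" for k by (induction k) (auto simp: x_0 x_Suc x0 D)
  have \<phi>x: "\<phi> (x k) = y (s k)" for k
  proof (induction k)
    case (Suc k)
    then show ?case
      using B.minus_add_cancel[of "y (s (Suc k))" "y (s k)"] yB xA D
      by (simp add: x_Suc additive B.a_comm)
  qed (simp add: x_0 x0)
  have "x (Suc k) \<ominus>\<^bsub>A\<^esub> x k = D k" for k
    using xA D(1) by (simp add: x_Suc a_minus_def A.a_ac A.r_neg A.l_neg)
  then have xC: "x \<in> cauchy_seqs A"
    using D(3) by (intro A.geometric_cauchy[where c=2 and r="1/2"] xA) auto
  have "(\<lambda>k. nrm B (y (s k) \<ominus>\<^bsub>B\<^esub> y k)) \<longlonglongrightarrow> 0"
  proof (rule LIMSEQ_I)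
    fix e :: real assume "e > 0"
    then obtain M where M: "\<And>i j. i \<ge> M \<Longrightarrow> j \<ge> M \<Longrightarrow> nrm B (y i \<ominus>\<^bsub>B\<^esub> y j) < e"
      using B.cauchy_seqsD[OF y(1)] by blast
    have "norm (nrm B (y (s k) \<ominus>\<^bsub>B\<^esub> y k) - 0) < e" if "k \<ge> M" for k
      using M[of "s k" k] s(1)[of k] that yB by simp
    then show "\<exists>no. \<forall>n\<ge>no. norm (nrm B (y (s n) \<ominus>\<^bsub>B\<^esub> y n) - 0) < e" by blast
  qed
  then have "B.cls (\<lambda>k. \<phi> (x k)) = B.cls y"
    using cauchy[OF xC] y(1) by (simp add: B.cls_eq_iff \<phi>x)
  then have "completion_map B \<phi> (A.cls x) = b"
    using xC y by (simp add: completion_map_cls)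
  then show ?thesis using xC A.cls_closed by blast
qed

context hls
begin

sublocale A: pre_cstar "Cc_alg \<G>"
  by (rule pre_cstar_HLS)

sublocale B: pre_cstar "Cc_alg (\<K> n)" for n
  by (rule F.pre_cstar_group)

sublocale C: unital_cstar "Cr \<G>"
  unfolding Cr_def by (rule A.unital_cstar_completion)

sublocale D: unital_cstar "Cr (\<K> n)" for n
  unfolding Cr_def by (rule B.unital_cstar_completion)

lemma A_minus: "\<lbrakk>f \<in> Cc \<G>; g \<in> Cc \<G>\<rbrakk> \<Longrightarrow> f \<ominus>\<^bsub>Cc_alg \<G>\<^esub> g = (\<lambda>\<gamma>. f \<gamma> - g \<gamma>)"
  by (simp add: A.minus_conv)

lemma B_minus: "\<lbrakk>f \<in> Cc (\<K> n); g \<in> Cc (\<K> n)\<rbrakk> \<Longrightarrow> f \<ominus>\<^bsub>Cc_alg (\<K> n)\<^esub> g = (\<lambda>\<gamma>. f \<gamma> - g \<gamma>)"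
  by (simp add: B.minus_conv)

sublocale res: bounded_map "Cc_alg \<G>" "Cc_alg (\<K> n)" "HLS_restrict n" 1 for n
proof
  fix f g
  assume "f \<in> carrier (Cc_alg \<G>)"
  then have f: "f \<in> Cc \<G>" by simp
  show "HLS_restrict n f \<in> carrier (Cc_alg (\<K> n))" using f by (simp add: restrict_closed)
  show "nrm (Cc_alg (\<K> n)) (HLS_restrict n f) \<le> 1 * nrm (Cc_alg \<G>) f"
    using f by (simp add: reduced_norm_restrict_le)
  assume "g \<in> carrier (Cc_alg \<G>)"
  then have g: "g \<in> Cc \<G>" by simp
  show "HLS_restrict n (f \<ominus>\<^bsub>Cc_alg \<G>\<^esub> g) = HLS_restrict n f \<ominus>\<^bsub>Cc_alg (\<K> n)\<^esub> HLS_restrict n g"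
    using f g by (simp add: A_minus B_minus restrict_closed) (simp add: HLS_restrict_def)
qed

abbreviation "ev n \<equiv> HLS_ev G H n"

lemma HLS_ev_eq: "ev n = completion_map (Cc_alg (\<K> n)) (HLS_restrict n)"
  by (simp add: HLS_ev_def HLS_group_def)

lemma star_hom_ev: "star_hom (Cr \<G>) (Cr (\<K> n)) (ev n)"
  unfolding HLS_ev_eq Cr_def
  by (rule res.star_hom_completion_map)
    (auto simp: star_hom_def restrict_closed restrict_conv restrict_add restrict_smult restrict_gstar)

lemma ev_closed: "a \<in> carrier (Cr \<G>) \<Longrightarrow> ev n a \<in> carrier (Cr (\<K> n))"
  unfolding HLS_ev_eq Cr_def by (rule res.completion_map_closed)

lemma ev_minus: "\<lbrakk>a \<in> carrier (Cr \<G>); b \<in> carrier (Cr \<G>)\<rbrakk> \<Longrightarrow> ev n (a \<ominus>\<^bsub>Cr \<G>\<^esub> b) = ev n a \<ominus>\<^bsub>Cr (\<K> n)\<^esub> ev n b"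
  unfolding HLS_ev_eq Cr_def by (rule res.completion_map_minus)

lemma ev_hom:
  assumes "a \<in> carrier (Cr \<G>)" "b \<in> carrier (Cr \<G>)"
  shows "ev n (a \<oplus>\<^bsub>Cr \<G>\<^esub> b) = ev n a \<oplus>\<^bsub>Cr (\<K> n)\<^esub> ev n b"
    "ev n (a \<otimes>\<^bsub>Cr \<G>\<^esub> b) = ev n a \<otimes>\<^bsub>Cr (\<K> n)\<^esub> ev n b"
    "ev n (z \<odot>\<^bsub>Cr \<G>\<^esub> a) = z \<odot>\<^bsub>Cr (\<K> n)\<^esub> ev n a"
    "ev n (star (Cr \<G>) a) = star (Cr (\<K> n)) (ev n a)"
  using star_hom_ev[of n] assms by (auto simp: star_hom_def)

lemma ev_nrm_le: "a \<in> carrier (Cr \<G>) \<Longrightarrow> nrm (Cr (\<K> n)) (ev n a) \<le> nrm (Cr \<G>) a"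
  using res.completion_map_bounded[of a n] unfolding HLS_ev_eq Cr_def by simp

lemma ev_one: "ev n \<one>\<^bsub>Cr \<G>\<^esub> = \<one>\<^bsub>Cr (\<K> n)\<^esub>"
proof -
  have "(\<lambda>k. \<one>\<^bsub>Cc_alg \<G>\<^esub>) \<in> cauchy_seqs (Cc_alg \<G>)"
    by (rule A.cauchy_seqs_const) (rule A.one_closed)
  moreover have "HLS_restrict n \<one>\<^bsub>Cc_alg \<G>\<^esub> = \<one>\<^bsub>Cc_alg (\<K> n)\<^esub>"
    by (auto simp: restrict_one F.\<delta>_def fun_eq_iff)
  ultimately show ?thesis
    unfolding HLS_ev_eq Cr_def A.completion_one B.completion_one by (simp only: res.completion_map_cls)
qed

text \<open>The canonical image of the compactly supported functions in the completion.\<close>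

definition embed :: "(enat \<times> 'a set \<Rightarrow> complex) \<Rightarrow> (nat \<Rightarrow> enat \<times> 'a set \<Rightarrow> complex) set" where
  "embed f = A.cls (\<lambda>k. f)"

abbreviation embed_fibre :: "enat \<Rightarrow> ('a set \<Rightarrow> complex) \<Rightarrow> (nat \<Rightarrow> 'a set \<Rightarrow> complex) set" where
  "embed_fibre n \<equiv> F.const_class n"

lemma Cc_const: "f \<in> Cc \<G> \<Longrightarrow> (\<lambda>k. f) \<in> cauchy_seqs (Cc_alg \<G>)"
  by (rule A.cauchy_seqs_const) simp

lemma Cc_const_fibre: "f \<in> Cc (\<K> n) \<Longrightarrow> (\<lambda>k. f) \<in> cauchy_seqs (Cc_alg (\<K> n))"
  by (rule B.cauchy_seqs_const) simp

lemma embed_closed: "f \<in> Cc \<G> \<Longrightarrow> embed f \<in> carrier (Cr \<G>)"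
  unfolding embed_def Cr_def by (rule A.cls_closed[OF Cc_const])

lemma embed_fibre_closed: "f \<in> Cc (\<K> n) \<Longrightarrow> embed_fibre n f \<in> carrier (Cr (\<K> n))"
  unfolding F.const_class_def Cr_def by (rule B.cls_closed[OF Cc_const_fibre])

lemma ev_embed: "f \<in> Cc \<G> \<Longrightarrow> ev n (embed f) = embed_fibre n (HLS_restrict n f)"
  unfolding HLS_ev_eq embed_def F.const_class_def by (rule res.completion_map_cls[OF Cc_const])

lemma nrm_embed: "f \<in> Cc \<G> \<Longrightarrow> nrm (Cr \<G>) (embed f) = reduced_norm \<G> f"
  unfolding Cr_def embed_def using A.nrm_cls_const[of f] by simp

lemma nrm_embed_fibre: "f \<in> Cc (\<K> n) \<Longrightarrow> nrm (Cr (\<K> n)) (embed_fibre n f) = reduced_norm (\<K> n) f"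
  unfolding Cr_def F.const_class_def using B.nrm_cls_const[of f n] by simp

lemma embed_dense:
  assumes "a \<in> carrier (Cr \<G>)" "e > 0"
  obtains f where "f \<in> Cc \<G>" "nrm (Cr \<G>) (a \<ominus>\<^bsub>Cr \<G>\<^esub> embed f) < e"
  using A.completion_dense[of a e] assms unfolding Cr_def embed_def by auto

lemma ev_approx:
  assumes a: "a \<in> carrier (Cr \<G>)" and f: "f \<in> Cc \<G>" and e: "nrm (Cr \<G>) (a \<ominus>\<^bsub>Cr \<G>\<^esub> embed f) < e"
  shows "nrm (Cr (\<K> n)) (ev n a \<ominus>\<^bsub>Cr (\<K> n)\<^esub> embed_fibre n (HLS_restrict n f)) < e"
    and "\<bar>nrm (Cr (\<K> n)) (ev n a) - reduced_norm (\<K> n) (HLS_restrict n f)\<bar> < e"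
proof -
  have "nrm (Cr (\<K> n)) (ev n (a \<ominus>\<^bsub>Cr \<G>\<^esub> embed f)) < e"
    using ev_nrm_le[of "a \<ominus>\<^bsub>Cr \<G>\<^esub> embed f" n] C.minus_closed[OF a embed_closed[OF f]] e by simp
  then show *: "nrm (Cr (\<K> n)) (ev n a \<ominus>\<^bsub>Cr (\<K> n)\<^esub> embed_fibre n (HLS_restrict n f)) < e"
    using a f by (simp add: ev_minus embed_closed ev_embed)
  show "\<bar>nrm (Cr (\<K> n)) (ev n a) - reduced_norm (\<K> n) (HLS_restrict n f)\<bar> < e"
    using * D.nrm_diff_le[OF ev_closed[OF a] embed_fibre_closed[OF restrict_closed[OF f]], of n]
    by (simp add: nrm_embed_fibre restrict_closed f)
qed

text \<open>This holds on the dense subalgebra by definition of the norm. The evaluations are contractions, so it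
  passes to limits.\<close>

lemma nrm_eq_SUP:
  assumes a: "a \<in> carrier (Cr \<G>)"
  shows "nrm (Cr \<G>) a = (SUP n. nrm (Cr (\<K> n)) (ev n a))"
proof (rule antisym)
  have bdd: "bdd_above (range (\<lambda>n. nrm (Cr (\<K> n)) (ev n a)))"
    using ev_nrm_le[OF a] by (intro bdd_aboveI2)
  show "(SUP n. nrm (Cr (\<K> n)) (ev n a)) \<le> nrm (Cr \<G>) a"
    by (rule cSUP_least) (auto simp: ev_nrm_le a)
  show "nrm (Cr \<G>) a \<le> (SUP n. nrm (Cr (\<K> n)) (ev n a))" (is "_ \<le> ?s")
  proof (rule field_le_epsilon)
    fix e :: real assume e: "e > 0"
    obtain f where f: "f \<in> Cc \<G>" "nrm (Cr \<G>) (a \<ominus>\<^bsub>Cr \<G>\<^esub> embed f) < e / 2"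
      using embed_dense[OF a, of "e / 2"] e by auto
    have "reduced_norm (\<K> n) (HLS_restrict n f) \<le> ?s + e / 2" for n
      using ev_approx(2)[OF a f, of n] cSUP_upper[OF UNIV_I bdd, of n] by linarith
    then have "reduced_norm \<G> f \<le> ?s + e / 2" by (rule reduced_norm_HLS_le)
    then show "nrm (Cr \<G>) a \<le> ?s + e"
      using C.nrm_diff_le[OF a embed_closed[OF f(1)]] f(2) nrm_embed[OF f(1)] by linarith
  qed
qed

lemma C0_enat_iff: "g \<in> C0 (euclidean :: enat topology) \<longleftrightarrow> (\<lambda>n. g (enat n)) \<longlonglongrightarrow> g \<infinity>"
proof -
  have "\<exists>K. compactin (euclidean :: enat topology) K \<and> (\<forall>t\<in>topspace euclidean - K. cmod (g t) < e)" for e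
    by (rule exI[of _ UNIV]) (simp add: compact_UNIV)
  then show ?thesis by (simp only: C0_def mem_Collect_eq continuous_map_enat_iff) blast
qed

lemma C0_bounded:
  assumes "g \<in> C0 (euclidean :: enat topology)"
  obtains B where "\<And>n. cmod (g n) \<le> B"
proof -
  have lim: "(\<lambda>n. g (enat n)) \<longlonglongrightarrow> g \<infinity>" using assms by (simp only: C0_enat_iff)
  obtain B where B: "\<And>n. cmod (g (enat n)) \<le> B"
    using convergent_imp_Bseq[OF convergentI[OF lim]] by (auto simp: Bseq_def)
  have "cmod (g n) \<le> max B (cmod (g \<infinity>))" for n
    using B by (cases n) (auto simp: max.coboundedI1)
  then show ?thesis by (rule that)
qed

abbreviation mul :: "(enat \<Rightarrow> complex) \<Rightarrow> (enat \<times> 'a set \<Rightarrow> complex) \<Rightarrow> enat \<times> 'a set \<Rightarrow> complex" where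
  "mul g f \<equiv> (\<lambda>\<gamma>. g (fst \<gamma>) * f \<gamma>)"

lemma restrict_mul: "HLS_restrict n (mul g f) = (\<lambda>x. g n * HLS_restrict n f x)"
  by (simp add: HLS_restrict_def)

lemma mul_closed: "\<lbrakk>g \<in> C0 euclidean; f \<in> Cc \<G>\<rbrakk> \<Longrightarrow> mul g f \<in> Cc \<G>"
  by (rule HLS_mult_closed) (auto simp: C0_def)

lemma bounded_map_mul:
  assumes g: "g \<in> C0 euclidean"
  obtains K where "bounded_map (Cc_alg \<G>) (Cc_alg \<G>) (mul g) K"
proof -
  obtain K where K: "\<And>n. cmod (g n) \<le> K" using C0_bounded[OF g] by blast
  have "bounded_map (Cc_alg \<G>) (Cc_alg \<G>) (mul g) K"
  proof (intro bounded_map.intro bounded_map_axioms.intro A.pre_cstar_axioms)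
    fix f h assume "f \<in> carrier (Cc_alg \<G>)"
    then have f: "f \<in> Cc \<G>" by simp
    show "mul g f \<in> carrier (Cc_alg \<G>)" using mul_closed[OF g f] by simp
    have "reduced_norm (\<K> n) (HLS_restrict n (mul g f)) \<le> K * reduced_norm \<G> f" for n
      unfolding restrict_mul F.reduced_norm_smult[OF restrict_closed[OF f]]
      by (rule mult_mono[OF K reduced_norm_restrict_le[OF f]])
        (use order_trans[OF norm_ge_zero K[of n]] in \<open>auto simp: F.reduced_norm_nonneg restrict_closed f\<close>)
    then show "nrm (Cc_alg \<G>) (mul g f) \<le> K * nrm (Cc_alg \<G>) f"
      by (simp add: reduced_norm_HLS_le)
    assume "h \<in> carrier (Cc_alg \<G>)"
    then have h: "h \<in> Cc \<G>" by simp
    show "mul g (f \<ominus>\<^bsub>Cc_alg \<G>\<^esub> h) = mul g f \<ominus>\<^bsub>Cc_alg \<G>\<^esub> mul g h"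
      by (simp add: A_minus f h mul_closed[OF g] right_diff_distrib)
  qed
  then show ?thesis by (rule that)
qed

lemma action_cls:
  assumes g: "g \<in> C0 euclidean" and x: "x \<in> cauchy_seqs (Cc_alg \<G>)"
  shows "HLS_action G H g (A.cls x) = A.cls (\<lambda>k. mul g (x k))"
    and "(\<lambda>k. mul g (x k)) \<in> cauchy_seqs (Cc_alg \<G>)"
proof -
  obtain K where K: "bounded_map (Cc_alg \<G>) (Cc_alg \<G>) (mul g) K" using bounded_map_mul[OF g] .
  show "HLS_action G H g (A.cls x) = A.cls (\<lambda>k. mul g (x k))"
    unfolding HLS_action_def by (rule bounded_map.completion_map_cls[OF K x])
  show "(\<lambda>k. mul g (x k)) \<in> cauchy_seqs (Cc_alg \<G>)"
    by (rule bounded_map.cauchy[OF K x])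
qed

lemma C0_closed:
  assumes "g \<in> C0 (euclidean :: enat topology)" "h \<in> C0 (euclidean :: enat topology)"
  shows "(\<lambda>t. g t + h t) \<in> C0 (euclidean :: enat topology)" "(\<lambda>t. z * g t) \<in> C0 (euclidean :: enat topology)"
    "(\<lambda>t. g t * h t) \<in> C0 (euclidean :: enat topology)" "(\<lambda>t. cnj (g t)) \<in> C0 (euclidean :: enat topology)"
  using assms unfolding C0_enat_iff by (auto intro: tendsto_intros)

lemma C0_action_HLS: "C0_action (euclidean :: enat topology) (Cr \<G>) (HLS_action G H)"
  unfolding C0_action_def
proof (intro ballI allI)
  fix g h :: "enat \<Rightarrow> complex" and z a b
  assume g: "g \<in> C0 euclidean" and h: "h \<in> C0 euclidean"
    and a: "a \<in> carrier (Cr \<G>)" and b: "b \<in> carrier (Cr \<G>)"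
  obtain x where x: "x \<in> cauchy_seqs (Cc_alg \<G>)" "a = A.cls x"
    using a unfolding Cr_def by (rule A.completion_cases)
  obtain y where y: "y \<in> cauchy_seqs (Cc_alg \<G>)" "b = A.cls y"
    using b unfolding Cr_def by (rule A.completion_cases)
  have X: "x k \<in> Cc \<G>" "y k \<in> Cc \<G>" for k
    using A.cauchy_seqs_carrier[OF x(1), of k] A.cauchy_seqs_carrier[OF y(1), of k] by simp_all
  note rules = A.completion_add_cls A.completion_mult_cls A.completion_smult_cls A.completion_star_cls
    A.cauchy_seqs_add A.cauchy_seqs_mult A.cauchy_seqs_smult A.cauchy_seqs_star
  note act = action_cls(1)[OF g] action_cls(1)[OF h] action_cls(2)[OF g] action_cls(2)[OF h]
    action_cls(1)[OF C0_closed(1)[OF g h]] action_cls(1)[OF C0_closed(2)[OF g g]]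
    action_cls(1)[OF C0_closed(3)[OF g h]] action_cls(1)[OF C0_closed(4)[OF g g]]
  have c1: "mul g (conv \<G> (x k) (y k)) = conv \<G> (mul g (x k)) (y k)"
    and c2: "mul g (conv \<G> (x k) (y k)) = conv \<G> (x k) (mul g (y k))" for k
    using X by (auto intro!: HLS_ext simp: restrict_mul restrict_conv F.conv_smult_left F.conv_smult_right
        restrict_closed)
  have c3: "mul (\<lambda>t. cnj (g t)) (gstar \<G> (x k)) = gstar \<G> (mul g (x k))" for k
    by (auto simp: gstar_def fun_eq_iff)
  show "HLS_action G H g a \<in> carrier (Cr \<G>) \<and>
     HLS_action G H g (a \<oplus>\<^bsub>Cr \<G>\<^esub> b) = HLS_action G H g a \<oplus>\<^bsub>Cr \<G>\<^esub> HLS_action G H g b \<and>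
     HLS_action G H g (z \<odot>\<^bsub>Cr \<G>\<^esub> a) = z \<odot>\<^bsub>Cr \<G>\<^esub> HLS_action G H g a \<and>
     HLS_action G H g (a \<otimes>\<^bsub>Cr \<G>\<^esub> b) = HLS_action G H g a \<otimes>\<^bsub>Cr \<G>\<^esub> b \<and>
     HLS_action G H g (a \<otimes>\<^bsub>Cr \<G>\<^esub> b) = a \<otimes>\<^bsub>Cr \<G>\<^esub> HLS_action G H g b \<and>
     HLS_action G H (\<lambda>t. g t + h t) a = HLS_action G H g a \<oplus>\<^bsub>Cr \<G>\<^esub> HLS_action G H h a \<and>
     HLS_action G H (\<lambda>t. z * g t) a = z \<odot>\<^bsub>Cr \<G>\<^esub> HLS_action G H g a \<and>
     HLS_action G H (\<lambda>t. g t * h t) a = HLS_action G H g (HLS_action G H h a) \<and>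
     HLS_action G H (\<lambda>t. cnj (g t)) (star (Cr \<G>) a) = star (Cr \<G>) (HLS_action G H g a)"
    unfolding Cr_def x(2) y(2)
  proof (intro conjI)
    show "HLS_action G H g (A.cls x) \<in> carrier (completion (Cc_alg \<G>))"
      unfolding act(1)[OF x(1)] by (rule A.cls_closed[OF act(3)[OF x(1)]])
    show "HLS_action G H g (A.cls x \<oplus>\<^bsub>completion (Cc_alg \<G>)\<^esub> A.cls y)
        = HLS_action G H g (A.cls x) \<oplus>\<^bsub>completion (Cc_alg \<G>)\<^esub> HLS_action G H g (A.cls y)"
      by (simp only: rules act x y) (simp add: distrib_left)
    show "HLS_action G H g (z \<odot>\<^bsub>completion (Cc_alg \<G>)\<^esub> A.cls x)
        = z \<odot>\<^bsub>completion (Cc_alg \<G>)\<^esub> HLS_action G H g (A.cls x)"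
      by (simp only: rules act x) (simp add: mult.left_commute)
    show "HLS_action G H g (A.cls x \<otimes>\<^bsub>completion (Cc_alg \<G>)\<^esub> A.cls y)
        = HLS_action G H g (A.cls x) \<otimes>\<^bsub>completion (Cc_alg \<G>)\<^esub> A.cls y"
      by (simp only: rules act x y) (simp only: Cc_alg_simps c1)
    show "HLS_action G H g (A.cls x \<otimes>\<^bsub>completion (Cc_alg \<G>)\<^esub> A.cls y)
        = A.cls x \<otimes>\<^bsub>completion (Cc_alg \<G>)\<^esub> HLS_action G H g (A.cls y)"
      by (simp only: rules act x y) (simp only: Cc_alg_simps c2)
    show "HLS_action G H (\<lambda>t. g t + h t) (A.cls x)
        = HLS_action G H g (A.cls x) \<oplus>\<^bsub>completion (Cc_alg \<G>)\<^esub> HLS_action G H h (A.cls x)"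
      by (simp only: rules act x) (simp add: distrib_right)
    show "HLS_action G H (\<lambda>t. z * g t) (A.cls x)
        = z \<odot>\<^bsub>completion (Cc_alg \<G>)\<^esub> HLS_action G H g (A.cls x)"
      by (simp only: rules act x) (simp add: mult.assoc)
    show "HLS_action G H (\<lambda>t. g t * h t) (A.cls x) = HLS_action G H g (HLS_action G H h (A.cls x))"
      by (simp only: rules act x) (simp add: mult.assoc)
    show "HLS_action G H (\<lambda>t. cnj (g t)) (star (completion (Cc_alg \<G>)) (A.cls x))
        = star (completion (Cc_alg \<G>)) (HLS_action G H g (A.cls x))"
      by (simp only: rules act x) (simp only: Cc_alg_simps c3)
  qed
qed

lemma ev_action:
  assumes g: "g \<in> C0 euclidean" and a: "a \<in> carrier (Cr \<G>)"
  shows "ev n (HLS_action G H g a) = g n \<odot>\<^bsub>Cr (\<K> n)\<^esub> ev n a"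
proof -
  obtain x where x: "x \<in> cauchy_seqs (Cc_alg \<G>)" "a = A.cls x"
    using a unfolding Cr_def by (rule A.completion_cases)
  show ?thesis
    unfolding x(2) HLS_ev_eq Cr_def action_cls(1)[OF g x(1)] res.completion_map_cls[OF action_cls(2)[OF g x(1)]]
      res.completion_map_cls[OF x(1)] B.completion_smult_cls[OF res.cauchy[OF x(1)]]
    by (simp add: restrict_mul)
qed

end

context hls_rd
begin

lemma ev_surj:
  assumes "b \<in> carrier (Cr (\<K> n))"
  obtains a where "a \<in> carrier (Cr \<G>)" "ev n a = b"
proof -
  have "\<exists>x\<in>carrier (Cc_alg \<G>). HLS_restrict n x = y \<and> nrm (Cc_alg \<G>) x \<le> nrm (Cc_alg (\<K> n)) y + e"
    if y: "y \<in> carrier (Cc_alg (\<K> n))" and e: "e > 0" for y e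
  proof -
    have "y \<in> Cc (\<K> n)" using y by simp
    from lift_norm[OF this e] show ?thesis by (metis Cc_alg_simps(1,8))
  qed
  from res.completion_map_surj[OF this, of b] show ?thesis
    using that assms unfolding HLS_ev_eq Cr_def by blast
qed

text \<open>A uniform limit of the functions \<open>n \<mapsto> \<parallel>f\<^sub>n\<parallel>\<close>, which are continuous at \<open>\<infinity>\<close> by \<open>tendsto_reduced_norm\<close>.\<close>

lemma tendsto_nrm_ev:
  assumes a: "a \<in> carrier (Cr \<G>)"
  shows "(\<lambda>n. nrm (Cr (\<K> (enat n))) (ev (enat n) a)) \<longlonglongrightarrow> nrm (Cr (\<K> \<infinity>)) (ev \<infinity> a)"
proof (rule LIMSEQ_I)
  fix e :: real assume e: "e > 0"
  obtain f where f: "f \<in> Cc \<G>" "nrm (Cr \<G>) (a \<ominus>\<^bsub>Cr \<G>\<^esub> embed f) < e / 3"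
    using embed_dense[OF a, of "e / 3"] e by auto
  obtain M where M: "\<And>n. n \<ge> M \<Longrightarrow>
      \<bar>reduced_norm (\<K> (enat n)) (HLS_restrict (enat n) f) - reduced_norm (\<K> \<infinity>) (HLS_restrict \<infinity> f)\<bar> < e / 3"
    using LIMSEQ_D[OF tendsto_reduced_norm[OF f(1)], of "e / 3"] e by auto
  have "norm (nrm (Cr (\<K> (enat n))) (ev (enat n) a) - nrm (Cr (\<K> \<infinity>)) (ev \<infinity> a)) < e" if "n \<ge> M" for n
    using M[OF that] ev_approx(2)[OF a f, of "enat n"] ev_approx(2)[OF a f, of \<infinity>]
    unfolding real_norm_def by linarith
  then show "\<exists>no. \<forall>n\<ge>no. norm (nrm (Cr (\<K> (enat n))) (ev (enat n) a) - nrm (Cr (\<K> \<infinity>)) (ev \<infinity> a)) < e"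
    by blast
qed

lemma continuous_field_HLS:
  "continuous_field (euclidean :: enat topology) (Cr \<G>) (\<lambda>n. Cr (\<K> n)) (HLS_ev G H) (HLS_action G H)"
  unfolding continuous_field_def
proof (intro conjI ballI)
  have "compact_space (euclidean :: enat topology)"
    by (simp add: compact_space_def compact_UNIV)
  then show "locally_compact_space (euclidean :: enat topology)"
    by (simp add: compact_imp_locally_compact_space)
  show "Hausdorff_space (euclidean :: enat topology)"
    unfolding Hausdorff_space_def
  proof (intro allI impI)
    fix x y :: enat assume "x \<in> topspace euclidean \<and> y \<in> topspace euclidean \<and> x \<noteq> y"
    then show "\<exists>U V. openin euclidean U \<and> openin euclidean V \<and> x \<in> U \<and> y \<in> V \<and> disjnt U V"
      using hausdorff[of x y] by (simp add: disjnt_def)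
  qed
  show "cstar_algebra (Cr \<G>)" by (rule C.cstar_algebra)
  show "C0_action (euclidean :: enat topology) (Cr \<G>) (HLS_action G H)" by (rule C0_action_HLS)
  fix t :: enat
  show "cstar_algebra (Cr (\<K> t))" by (rule D.cstar_algebra)
  show "star_hom (Cr \<G>) (Cr (\<K> t)) (ev t)" by (rule star_hom_ev)
  show "ev t ` carrier (Cr \<G>) = carrier (Cr (\<K> t))"
    using ev_closed ev_surj by (metis (no_types, lifting) image_eqI image_subsetI subsetI subset_antisym)
next
  fix g a t assume "g \<in> C0 (euclidean :: enat topology)" "a \<in> carrier (Cr \<G>)"
  then show "ev t (HLS_action G H g a) = g t \<odot>\<^bsub>Cr (\<K> t)\<^esub> ev t a" by (rule ev_action)
next
  fix a assume a: "a \<in> carrier (Cr \<G>)"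
  show "nrm (Cr \<G>) a = (SUP t\<in>topspace euclidean. nrm (Cr (\<K> t)) (ev t a))"
    using nrm_eq_SUP[OF a] by simp
  show "(\<lambda>t. complex_of_real (nrm (Cr (\<K> t)) (ev t a))) \<in> C0 euclidean"
    unfolding C0_enat_iff by (intro tendsto_of_real tendsto_nrm_ev a)
qed

end

section \<open>Spectra in unital \<open>C\<^sup>*\<close>-algebras\<close>

context unital_cstar
begin

lemma eqI_nrm:
  assumes "a \<in> carrier A" "b \<in> carrier A" "\<And>k. nrm A (a \<ominus> b) \<le> u k" "u \<longlonglongrightarrow> (0::real)"
  shows "a = b"
proof -
  have "nrm A (a \<ominus> b) \<le> 0"
    by (rule LIMSEQ_le_const[OF assms(4)]) (use assms(3) in blast)
  then have "nrm A (a \<ominus> b) = 0" using nrm_nonneg[OF minus_closed[OF assms(1,2)]] by simp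
  then have "a \<ominus> b = \<zero>" using assms by (simp add: nrm_eq_zero_iff)
  then show ?thesis using assms minus_add_cancel[of a b] by simp
qed

lemma add_minus_cancel:
  assumes "a \<in> carrier A" "b \<in> carrier A" "c \<in> carrier A"
  shows "(c \<oplus> a) \<ominus> (c \<oplus> b) = a \<ominus> b" "(a \<oplus> c) \<ominus> (b \<oplus> c) = a \<ominus> b"
  using assms add_minus_add[of c a c b] add_minus_add[of a c b c] by (simp_all add: minus_eq r_neg)

text \<open>Inverses are obtained from the Neumann series, written as the recursion \<open>S\<^sub>k\<^sub>+\<^sub>1 = 1 + b S\<^sub>k\<close>.\<close>

lemma neumann:
  assumes b: "b \<in> carrier A" and b1: "nrm A b < 1"
  shows "\<one> \<ominus> b \<in> Units A"
proof -
  define S where "S = rec_nat \<zero> (\<lambda>k s. \<one> \<oplus> b \<otimes> s)"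
  have S0: "S 0 = \<zero>" and SS: "S (Suc k) = \<one> \<oplus> b \<otimes> S k" for k by (simp_all add: S_def)
  have SA: "S k \<in> carrier A" for k by (induction k) (auto simp: S0 SS b)
  have r0: "nrm A b \<ge> 0" using b by simp
  have "nrm A (S (Suc k) \<ominus> S k) \<le> 1 * nrm A b ^ k" for k
  proof (induction k)
    case 0
    show ?case using b nrm_one_le by (simp add: S0 SS a_minus_def)
  next
    case (Suc k)
    have "S (Suc (Suc k)) \<ominus> S (Suc k) = (\<one> \<oplus> b \<otimes> S (Suc k)) \<ominus> (\<one> \<oplus> b \<otimes> S k)"
      by (rule arg_cong2[where f="\<lambda>u v. u \<ominus> v", OF SS SS])
    also have "\<dots> = b \<otimes> (S (Suc k) \<ominus> S k)"
      using SA b by (simp add: add_minus_cancel mult_minus_right)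
    finally have "nrm A (S (Suc (Suc k)) \<ominus> S (Suc k)) \<le> nrm A b * nrm A (S (Suc k) \<ominus> S k)"
      using nrm_mult[of b "S (Suc k) \<ominus> S k"] b SA by simp
    also have "\<dots> \<le> nrm A b * nrm A b ^ k" using Suc r0 by (intro mult_left_mono) auto
    finally show ?case by simp
  qed
  then have "S \<in> cauchy_seqs A" by (rule geometric_cauchy[OF SA r0 b1])
  then obtain y where y: "y \<in> carrier A" and lim: "(\<lambda>k. nrm A (S k \<ominus> y)) \<longlonglongrightarrow> 0" using complete by blast
  have lim2: "(\<lambda>k. nrm A (S (Suc k) \<ominus> y)) \<longlonglongrightarrow> 0" using LIMSEQ_Suc[OF lim] .
  have comm: "S k \<otimes> b = b \<otimes> S k" for k
    by (induction k) (auto simp: S0 SS b SA l_distr r_distr m_assoc)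
  have u: "(\<lambda>k. 2 * nrm A b * nrm A (S k \<ominus> y) + nrm A (S (Suc k) \<ominus> y)) \<longlonglongrightarrow> 0"
    using tendsto_add[OF tendsto_mult[OF tendsto_const lim, of "2 * nrm A b"] lim2] by simp
  have eq: "y = \<one> \<oplus> b \<otimes> y"
  proof (rule eqI_nrm[OF _ _ _ u])
    fix k
    have "nrm A (y \<ominus> (\<one> \<oplus> b \<otimes> y)) \<le> nrm A (y \<ominus> S (Suc k)) + nrm A (S (Suc k) \<ominus> (\<one> \<oplus> b \<otimes> y))"
      by (rule nrm_triangle) (use y b SA in auto)
    also have "S (Suc k) \<ominus> (\<one> \<oplus> b \<otimes> y) = b \<otimes> (S k \<ominus> y)"
      using SA b y by (simp add: SS add_minus_cancel mult_minus_right)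
    also have "nrm A (b \<otimes> (S k \<ominus> y)) \<le> nrm A b * nrm A (S k \<ominus> y)"
      using SA b y by (simp add: nrm_mult)
    also have "\<dots> \<le> 2 * nrm A b * nrm A (S k \<ominus> y)"
      using SA y r0 by (simp add: mult_right_mono)
    finally show "nrm A (y \<ominus> (\<one> \<oplus> b \<otimes> y)) \<le> 2 * nrm A b * nrm A (S k \<ominus> y) + nrm A (S (Suc k) \<ominus> y)"
      using nrm_minus_commute[OF y SA, of "Suc k"] by simp
  qed (use y b in auto)
  have yb: "y \<otimes> b = b \<otimes> y"
  proof (rule eqI_nrm[OF _ _ _ u])
    fix k
    have "nrm A (y \<otimes> b \<ominus> b \<otimes> y) \<le> nrm A (y \<otimes> b \<ominus> S k \<otimes> b) + nrm A (S k \<otimes> b \<ominus> b \<otimes> y)"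
      by (rule nrm_triangle) (use y b SA in auto)
    also have "y \<otimes> b \<ominus> S k \<otimes> b = (y \<ominus> S k) \<otimes> b" using y b SA by (simp add: mult_minus_left)
    also have "S k \<otimes> b \<ominus> b \<otimes> y = b \<otimes> (S k \<ominus> y)" using y b SA by (simp add: comm mult_minus_right)
    also have "nrm A ((y \<ominus> S k) \<otimes> b) \<le> nrm A (y \<ominus> S k) * nrm A b" using y b SA by (simp add: nrm_mult)
    also have "nrm A (b \<otimes> (S k \<ominus> y)) \<le> nrm A b * nrm A (S k \<ominus> y)" using y b SA by (simp add: nrm_mult)
    finally show "nrm A (y \<otimes> b \<ominus> b \<otimes> y) \<le> 2 * nrm A b * nrm A (S k \<ominus> y) + nrm A (S (Suc k) \<ominus> y)"
      using nrm_minus_commute[OF y SA, of k] nrm_nonneg[OF minus_closed[OF SA y], of "Suc k"]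
      by (simp add: mult_ac)
  qed (use y b in auto)
  have "(\<one> \<ominus> b) \<otimes> y = y \<ominus> b \<otimes> y" "y \<otimes> (\<one> \<ominus> b) = y \<ominus> b \<otimes> y"
    using y b by (simp_all add: mult_minus_left mult_minus_right yb)
  moreover have "y \<ominus> b \<otimes> y = \<one>"
    using eq y b by (metis add.inv_solve_right m_closed minus_eq one_closed a_inv_closed a_closed)
  ultimately show ?thesis
    using y b unfolding Units_def by auto
qed

lemma units_near_one:
  assumes "c \<in> carrier A" "nrm A (c \<ominus> \<one>) < 1"
  shows "c \<in> Units A"
proof -
  have "\<one> \<ominus> (\<one> \<ominus> c) = c"
    using assms(1) by (simp add: a_minus_def minus_add a_assoc[symmetric] r_neg)
  then show ?thesis
    using neumann[of "\<one> \<ominus> c"] assms nrm_minus_commute[of \<one> c] by simp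
qed

lemma unit_from_products:
  assumes a: "a \<in> carrier A" "b \<in> carrier A" "c \<in> carrier A" and "a \<otimes> b \<in> Units A" "c \<otimes> a \<in> Units A"
  shows "a \<in> Units A"
proof -
  obtain u where u: "u \<in> carrier A" "(a \<otimes> b) \<otimes> u = \<one>" using assms(4) unfolding Units_def by blast
  obtain v where v: "v \<in> carrier A" "v \<otimes> (c \<otimes> a) = \<one>" using assms(5) unfolding Units_def by blast
  have 1: "a \<otimes> (b \<otimes> u) = \<one>" "(v \<otimes> c) \<otimes> a = \<one>" using u v a by (simp_all add: m_assoc)
  have "v \<otimes> c = (v \<otimes> c) \<otimes> (a \<otimes> (b \<otimes> u))" using 1 a v u by simp
  also have "\<dots> = ((v \<otimes> c) \<otimes> a) \<otimes> (b \<otimes> u)" using a u(1) v(1) by (simp add: m_assoc)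
  also have "\<dots> = b \<otimes> u" unfolding 1(2) using a u by simp
  finally have "(b \<otimes> u) \<otimes> a = \<one>" using 1 by simp
  then show ?thesis using 1 a u unfolding Units_def by auto
qed

lemma unit_from_approximate_inverse:
  assumes "a \<in> carrier A" "b \<in> carrier A" "nrm A (a \<otimes> b \<ominus> \<one>) < 1" "nrm A (b \<otimes> a \<ominus> \<one>) < 1"
  shows "a \<in> Units A"
  using assms by (intro unit_from_products[of a b b] units_near_one) auto

lemma unit_smult:
  assumes a: "a \<in> Units A" and z: "z \<noteq> 0"
  shows "z \<odot> a \<in> Units A"
proof -
  obtain u where u: "u \<in> carrier A" "u \<otimes> a = \<one>" "a \<otimes> u = \<one>" "a \<in> carrier A"
    using a unfolding Units_def by blast
  then have "(z \<odot> a) \<otimes> (inverse z \<odot> u) = \<one>" "(inverse z \<odot> u) \<otimes> (z \<odot> a) = \<one>"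
    using z by (simp_all add: smult_mult_l smult_mult_r smult_smult)
  then show ?thesis
    using u unfolding Units_def by (intro CollectI conjI bexI[of _ "inverse z \<odot> u"]) auto
qed

lemma spectrum_iff: "z \<in> spectrum A a \<longleftrightarrow> z \<odot> \<one> \<ominus> a \<notin> Units A"
  by (simp add: spectrum_def)

lemma spectrum_le_nrm:
  assumes a: "a \<in> carrier A" and z: "z \<in> spectrum A a"
  shows "cmod z \<le> nrm A a"
proof (rule ccontr)
  assume "\<not> cmod z \<le> nrm A a"
  then have lt: "nrm A a < cmod z" by simp
  then have z0: "z \<noteq> 0" using nrm_nonneg[OF a] by auto
  have "nrm A (inverse z \<odot> a) = nrm A a / cmod z"
    using a by (simp add: nrm_smult norm_divide inverse_eq_divide)
  then have "nrm A (inverse z \<odot> a) < 1"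
    using lt z0 by simp
  then have "\<one> \<ominus> inverse z \<odot> a \<in> Units A" using a by (intro neumann) auto
  then have "z \<odot> (\<one> \<ominus> inverse z \<odot> a) \<in> Units A" by (rule unit_smult[OF _ z0])
  then have "z \<odot> \<one> \<ominus> a \<in> Units A"
    using a z0 by (simp add: smult_minus_right smult_smult)
  then show False using z by (simp add: spectrum_iff)
qed

lemma resolvent_shift:
  assumes a: "a \<in> carrier A" and r: "r \<in> carrier A"
  shows "(w \<odot> \<one> \<ominus> a) \<otimes> r \<ominus> (z \<odot> \<one> \<ominus> a) \<otimes> r = (w - z) \<odot> r"
    and "r \<otimes> (w \<odot> \<one> \<ominus> a) \<ominus> r \<otimes> (z \<odot> \<one> \<ominus> a) = (w - z) \<odot> r"
proof -
  have "(w \<odot> \<one> \<ominus> a) \<ominus> (z \<odot> \<one> \<ominus> a) = (w - z) \<odot> \<one>"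
    using a by (simp add: smult_diff_left) (simp add: a_minus_def minus_add a_ac r_neg2 l_neg r_neg)
  then show "(w \<odot> \<one> \<ominus> a) \<otimes> r \<ominus> (z \<odot> \<one> \<ominus> a) \<otimes> r = (w - z) \<odot> r"
    "r \<otimes> (w \<odot> \<one> \<ominus> a) \<ominus> r \<otimes> (z \<odot> \<one> \<ominus> a) = (w - z) \<odot> r"
    using a r by (simp_all add: mult_minus_left[symmetric] mult_minus_right[symmetric] smult_mult_l smult_mult_r)
qed

text \<open>Invertibility is stable, with a radius controlled by an approximate inverse \<open>r\<close>.\<close>

lemma not_in_spectrum_near:
  assumes a: "a \<in> carrier A" and r: "r \<in> carrier A"
    and 1: "nrm A ((z \<odot> \<one> \<ominus> a) \<otimes> r \<ominus> \<one>) \<le> 1 / 2" "nrm A (r \<otimes> (z \<odot> \<one> \<ominus> a) \<ominus> \<one>) \<le> 1 / 2"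
    and w: "cmod (w - z) * nrm A r < 1 / 2"
  shows "w \<notin> spectrum A a"
proof -
  let ?x = "w \<odot> \<one> \<ominus> a" and ?y = "z \<odot> \<one> \<ominus> a"
  have C: "?x \<in> carrier A" "?y \<in> carrier A" using a by auto
  have "nrm A (?x \<otimes> r \<ominus> \<one>) \<le> nrm A (?x \<otimes> r \<ominus> ?y \<otimes> r) + nrm A (?y \<otimes> r \<ominus> \<one>)"
    "nrm A (r \<otimes> ?x \<ominus> \<one>) \<le> nrm A (r \<otimes> ?x \<ominus> r \<otimes> ?y) + nrm A (r \<otimes> ?y \<ominus> \<one>)"
    using C r by (intro nrm_triangle; simp)+
  then have "nrm A (?x \<otimes> r \<ominus> \<one>) < 1" "nrm A (r \<otimes> ?x \<ominus> \<one>) < 1"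
    using 1 w resolvent_shift[OF a r, of w z] r by (auto simp: nrm_smult)
  then have "?x \<in> Units A" using C r by (intro unit_from_approximate_inverse)
  then show ?thesis by (simp add: spectrum_iff)
qed

lemma compact_spectrum:
  assumes a: "a \<in> carrier A"
  shows "compact (spectrum A a)"
proof -
  have "open (- spectrum A a)"
    unfolding open_dist
  proof
    fix z assume "z \<in> - spectrum A a"
    then have "z \<odot> \<one> \<ominus> a \<in> Units A" by (simp add: spectrum_iff)
    then obtain r where r: "r \<in> carrier A" "r \<otimes> (z \<odot> \<one> \<ominus> a) = \<one>" "(z \<odot> \<one> \<ominus> a) \<otimes> r = \<one>"
      unfolding Units_def by blast
    have R: "nrm A r + 1 > 0" using nrm_nonneg[OF r(1)] by linarith
    have "w \<in> - spectrum A a" if "dist w z < 1 / (2 * (nrm A r + 1))" for w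
    proof -
      have "cmod (w - z) * nrm A r \<le> cmod (w - z) * (nrm A r + 1)" by (intro mult_left_mono) auto
      also have "\<dots> < 1 / 2" using that R by (simp add: dist_norm field_simps)
      finally show ?thesis
        using not_in_spectrum_near[OF a r(1), of z w] r by (simp add: minus_eq r_neg nrm_zero)
    qed
    then show "\<exists>e>0. \<forall>y. dist y z < e \<longrightarrow> y \<in> - spectrum A a"
      using R by (intro exI[of _ "1 / (2 * (nrm A r + 1))"]) auto
  qed
  then have "closed (spectrum A a)" by (simp add: closed_def)
  moreover have "bounded (spectrum A a)"
    using spectrum_le_nrm[OF a] by (auto simp: bounded_iff)
  ultimately show ?thesis by (simp add: compact_eq_bounded_closed)
qed

text \<open>For self-adjoint \<open>a\<close> the translates \<open>a + it\<close> have norm \<open>\<surd>(\<parallel>a\<parallel>\<^sup>2 + t\<^sup>2)\<close> at most, which for large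
  \<open>t\<close> leaves no room for nonreal points of the spectrum.\<close>

lemma spectrum_selfadjoint_real:
  assumes a: "a \<in> carrier A" and sa: "star A a = a" and z: "z \<in> spectrum A a"
  shows "Im z = 0"
proof -
  have *: "(Re z)\<^sup>2 + (Im z + t)\<^sup>2 \<le> (nrm A a)\<^sup>2 + t\<^sup>2" for t :: real
  proof -
    define s where "s = \<i> * of_real t"
    let ?b = "a \<oplus> s \<odot> \<one>"
    have b: "?b \<in> carrier A" using a by simp
    have "(z + s) \<odot> \<one> \<ominus> ?b = z \<odot> \<one> \<ominus> a"
      using a by (simp add: smult_add_left add_minus_cancel)
    then have "z + s \<in> spectrum A ?b" using z by (simp add: spectrum_iff)
    then have "cmod (z + s) \<le> nrm A ?b" by (rule spectrum_le_nrm[OF b])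
    then have "(cmod (z + s))\<^sup>2 \<le> (nrm A ?b)\<^sup>2" by (rule power_mono) simp
    also have "\<dots> = nrm A (star A ?b \<otimes> ?b)" using b by (simp add: cstar_identity)
    also have "star A ?b \<otimes> ?b = a \<otimes> a \<oplus> (of_real (t\<^sup>2)) \<odot> \<one>"
    proof -
      have "star A ?b = a \<oplus> (- s) \<odot> \<one>"
        using a sa by (simp add: star_add star_smult star_one s_def)
      then have "star A ?b \<otimes> ?b = (a \<otimes> a \<oplus> s \<odot> a) \<oplus> ((- s) \<odot> a \<oplus> (- s * s) \<odot> \<one>)"
        using a by (simp add: l_distr r_distr smult_mult_l smult_mult_r smult_smult smult_add_right a_ac)
      also have "\<dots> = a \<otimes> a \<oplus> ((s \<odot> a \<oplus> (- s) \<odot> a) \<oplus> (- s * s) \<odot> \<one>)"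
        using a by (simp add: a_assoc)
      also have "s \<odot> a \<oplus> (- s) \<odot> a = \<zero>"
        using a smult_add_left[of a s "-s"] by (simp add: smult_0)
      also have "- s * s = of_real (t\<^sup>2)" by (simp add: s_def power2_eq_square mult_ac)
      finally show ?thesis using a by simp
    qed
    also have "nrm A (a \<otimes> a \<oplus> of_real (t\<^sup>2) \<odot> \<one>) \<le> nrm A (a \<otimes> a) + nrm A (of_real (t\<^sup>2) \<odot> \<one>)"
      using a by (intro nrm_add) auto
    also have "\<dots> \<le> (nrm A a)\<^sup>2 + t\<^sup>2"
      using nrm_mult[OF a a] nrm_one_le mult_left_mono[of "nrm A \<one>" 1 "t\<^sup>2"]
      by (simp add: nrm_smult power2_eq_square norm_mult)
    finally show ?thesis by (simp add: cmod_power2 s_def)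
  qed
  show ?thesis
  proof (rule ccontr)
    assume i: "Im z \<noteq> 0"
    define t where "t = ((nrm A a)\<^sup>2 + 1) / (2 * Im z)"
    have "2 * Im z * t = (nrm A a)\<^sup>2 + 1" using i by (simp add: t_def)
    then show False
      using *[of t] zero_le_power2[of "Re z"] zero_le_power2[of "Im z"]
      by (simp add: power2_sum)
  qed
qed

text \<open>The relevant instance of the spectral mapping theorem, for the polynomial \<open>1 - (z - s)\<^sup>2 / M\<close>.\<close>

lemma spectrum_quadratic:
  assumes b: "b \<in> carrier A" and M: "M \<noteq> 0"
    and k: "k \<in> spectrum A (\<one> \<ominus> inverse M \<odot> ((b \<ominus> s \<odot> \<one>) \<otimes> (b \<ominus> s \<odot> \<one>)))"
  obtains z where "z \<in> spectrum A b" "k = 1 - (z - s)\<^sup>2 / M"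
proof -
  define c where "c = b \<ominus> s \<odot> \<one>"
  have c: "c \<in> carrier A" using b by (simp add: c_def)
  \<comment> \<open>\<open>t\<close> is a root of the polynomial \<open>t\<^sup>2 = M (1 - k)\<close>, so the resolvent of the quadratic expression factors
    through those of \<open>b\<close> at \<open>s + t\<close> and \<open>s - t\<close>.\<close>
  define t where "t = csqrt (M * (1 - k))"
  have t2: "t * t = M * (1 - k)" by (simp add: t_def power2_eq_square[symmetric])
  have shift: "(s + u) \<odot> \<one> \<ominus> b = u \<odot> \<one> \<ominus> c" for u
    using b by (simp add: c_def smult_add_left) (simp add: a_minus_def minus_add a_ac)
  have prod: "(t \<odot> \<one> \<ominus> c) \<otimes> ((- t) \<odot> \<one> \<ominus> c) = c \<otimes> c \<ominus> (t * t) \<odot> \<one>"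
  proof -
    have "(t \<odot> \<one> \<oplus> (-1) \<odot> c) \<otimes> ((- t) \<odot> \<one> \<oplus> (-1) \<odot> c)
        = ((- (t * t)) \<odot> \<one> \<oplus> (- t) \<odot> c) \<oplus> (t \<odot> c \<oplus> c \<otimes> c)"
      using c by (simp add: l_distr r_distr smult_mult_l smult_mult_r smult_smult smult_add_right a_ac)
    also have "\<dots> = (- (t * t)) \<odot> \<one> \<oplus> (((- t) \<odot> c \<oplus> t \<odot> c) \<oplus> c \<otimes> c)"
      using c by (simp add: a_assoc)
    also have "(- t) \<odot> c \<oplus> t \<odot> c = \<zero>" using c smult_add_left[of c "-t" t] by (simp add: smult_0)
    finally show ?thesis
      using c by (simp add: minus_conv smult_smult a_comm)
  qed
  have "k \<odot> \<one> \<ominus> (\<one> \<ominus> inverse M \<odot> (c \<otimes> c)) = inverse M \<odot> (c \<otimes> c \<ominus> (t * t) \<odot> \<one>)"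
  proof -
    have "k \<odot> \<one> \<oplus> (-1) \<odot> (\<one> \<oplus> (-1) \<odot> (inverse M \<odot> (c \<otimes> c)))
        = (k \<odot> \<one> \<oplus> (-1) \<odot> \<one>) \<oplus> inverse M \<odot> (c \<otimes> c)"
      using c by (simp add: smult_add_right smult_smult a_assoc)
    also have "k \<odot> \<one> \<oplus> (-1) \<odot> \<one> = (- inverse M * (t * t)) \<odot> \<one>"
    proof -
      have "- inverse M * (t * t) = k + (- 1)" using M by (simp add: t2 algebra_simps)
      then show ?thesis using smult_add_left[of \<one> k "-1"] by simp
    qed
    finally show ?thesis
      using c by (simp add: minus_conv smult_add_right smult_smult a_comm)
  qed
  then have "inverse M \<odot> ((t \<odot> \<one> \<ominus> c) \<otimes> ((- t) \<odot> \<one> \<ominus> c)) \<notin> Units A"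
    using k unfolding prod c_def[symmetric] by (simp add: spectrum_iff)
  then have "\<not> (t \<odot> \<one> \<ominus> c \<in> Units A \<and> (- t) \<odot> \<one> \<ominus> c \<in> Units A)"
    using unit_smult[OF Units_m_closed, of "t \<odot> \<one> \<ominus> c" "(- t) \<odot> \<one> \<ominus> c" "inverse M"] M by auto
  then have "s + t \<in> spectrum A b \<or> s + (- t) \<in> spectrum A b"
    unfolding spectrum_iff shift by blast
  moreover have "k = 1 - (t * t) / M" using M by (simp add: t2)
  ultimately show ?thesis
    using that[of "s + t"] that[of "s - t"] by (auto simp: power2_eq_square)
qed

end

section \<open>The canonical trace\<close>

context group
begin

interpretation R: pre_cstar "Cc_alg \<Gamma>"
  by (rule pre_cstar_group)

interpretation RC: unital_cstar "Cr \<Gamma>"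
  unfolding Cr_def by (rule R.unital_cstar_completion)

lemma R_minus: "\<lbrakk>f \<in> Cc \<Gamma>; g \<in> Cc \<Gamma>\<rbrakk> \<Longrightarrow> f \<ominus>\<^bsub>Cc_alg \<Gamma>\<^esub> g = (\<lambda>\<gamma>. f \<gamma> - g \<gamma>)"
  by (simp add: R.minus_conv)

lemma R_cauchy_carrier: "x \<in> cauchy_seqs (Cc_alg \<Gamma>) \<Longrightarrow> x k \<in> Cc \<Gamma>"
  using R.cauchy_seqs_carrier[of x k] by simp

lemma cmod_diff_le:
  assumes "f \<in> Cc \<Gamma>" "g \<in> Cc \<Gamma>"
  shows "cmod (f t - g t) \<le> nrm (Cc_alg \<Gamma>) (f \<ominus>\<^bsub>Cc_alg \<Gamma>\<^esub> g)"
proof -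
  have d: "(\<lambda>\<gamma>. f \<gamma> - g \<gamma>) \<in> Cc \<Gamma>"
    using R.minus_closed[of f g] assms by (simp add: R_minus)
  show ?thesis
    using cmod_le_n2[OF CcD(1)[OF d], of t] n2_le_reduced_norm[OF d] assms by (simp add: R_minus)
qed

text \<open>The continuous extension of \<open>f \<mapsto> f(1)\<close> to the completion, as the limit along any representative.\<close>

definition tau :: "(nat \<Rightarrow> 'a \<Rightarrow> complex) set \<Rightarrow> complex" where
  "tau a = (THE t. \<exists>x\<in>a. (\<lambda>k. x k \<one>) \<longlonglongrightarrow> t)"

lemma cauchy_pointwise:
  assumes x: "x \<in> cauchy_seqs (Cc_alg \<Gamma>)"
  shows "convergent (\<lambda>k. x k t)"
proof (rule Cauchy_convergent, rule metric_CauchyI)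
  fix e :: real assume "e > 0"
  then obtain M where M: "\<And>i j. i \<ge> M \<Longrightarrow> j \<ge> M \<Longrightarrow> nrm (Cc_alg \<Gamma>) (x i \<ominus>\<^bsub>Cc_alg \<Gamma>\<^esub> x j) < e"
    using R.cauchy_seqsD[OF x] by blast
  have "dist (x i t) (x j t) < e" if "i \<ge> M" "j \<ge> M" for i j
    using cmod_diff_le[OF R_cauchy_carrier[OF x] R_cauchy_carrier[OF x], of i t j] M[OF that]
    by (simp add: dist_norm)
  then show "\<exists>M. \<forall>m\<ge>M. \<forall>n\<ge>M. dist (x m t) (x n t) < e" by blast
qed

lemma tendsto_tau_cls:
  assumes x: "x \<in> cauchy_seqs (Cc_alg \<Gamma>)"
  shows "(\<lambda>k. x k \<one>) \<longlonglongrightarrow> tau (R.cls x)"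
proof -
  obtain t where t: "(\<lambda>k. x k \<one>) \<longlonglongrightarrow> t"
    using cauchy_pointwise[OF x] by (auto simp: convergent_def)
  have "s = t" if y: "y \<in> R.cls x" and s: "(\<lambda>k. y k \<one>) \<longlonglongrightarrow> s" for y s
  proof -
    have y: "y \<in> cauchy_seqs (Cc_alg \<Gamma>)" "(\<lambda>k. nrm (Cc_alg \<Gamma>) (x k \<ominus>\<^bsub>Cc_alg \<Gamma>\<^esub> y k)) \<longlonglongrightarrow> 0"
      using y by (auto simp: R.cls_def R.cauchy_rel_iff)
    have "(\<lambda>k. x k \<one> - y k \<one>) \<longlonglongrightarrow> 0"
      by (rule Lim_null_comparison[OF always_eventually y(2)])
        (intro allI cmod_diff_le R_cauchy_carrier x y(1))
    moreover have "(\<lambda>k. x k \<one> - y k \<one>) \<longlonglongrightarrow> t - s" using t s by (rule tendsto_diff)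
    ultimately have "t - s = 0" by (rule LIMSEQ_unique[rotated])
    then show ?thesis by simp
  qed
  moreover have "x \<in> R.cls x"
    using equiv_class_self[OF R.equiv_cauchy_rel x] by (simp add: R.cls_def)
  ultimately have "tau (R.cls x) = t"
    unfolding tau_def using t by (intro the_equality) blast+
  then show ?thesis using t by simp
qed

lemma Cr_cases [consumes 1]:
  assumes "a \<in> carrier (Cr \<Gamma>)"
  obtains x where "x \<in> cauchy_seqs (Cc_alg \<Gamma>)" "a = R.cls x"
  using assms unfolding Cr_def by (rule R.completion_cases)

lemma Cr_nrm_tendsto: "x \<in> cauchy_seqs (Cc_alg \<Gamma>) \<Longrightarrow> (\<lambda>k. reduced_norm \<Gamma> (x k)) \<longlonglongrightarrow> nrm (Cr \<Gamma>) (R.cls x)"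
  using R.tendsto_nrm_cls[of x] unfolding Cr_def by simp

lemma Cr_mult_cls: "\<lbrakk>x \<in> cauchy_seqs (Cc_alg \<Gamma>); y \<in> cauchy_seqs (Cc_alg \<Gamma>)\<rbrakk>
    \<Longrightarrow> R.cls x \<otimes>\<^bsub>Cr \<Gamma>\<^esub> R.cls y = R.cls (\<lambda>k. conv \<Gamma> (x k) (y k))"
  using R.completion_mult_cls[of x y] unfolding Cr_def by simp

lemma Cr_star_cls: "x \<in> cauchy_seqs (Cc_alg \<Gamma>) \<Longrightarrow> star (Cr \<Gamma>) (R.cls x) = R.cls (\<lambda>k. gstar \<Gamma> (x k))"
  using R.completion_star_cls[of x] unfolding Cr_def by simp

lemma cauchy_conv: "\<lbrakk>x \<in> cauchy_seqs (Cc_alg \<Gamma>); y \<in> cauchy_seqs (Cc_alg \<Gamma>)\<rbrakk>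
    \<Longrightarrow> (\<lambda>k. conv \<Gamma> (x k) (y k)) \<in> cauchy_seqs (Cc_alg \<Gamma>)"
  using R.cauchy_seqs_mult[of x y] by simp

lemma cauchy_gstar: "x \<in> cauchy_seqs (Cc_alg \<Gamma>) \<Longrightarrow> (\<lambda>k. gstar \<Gamma> (x k)) \<in> cauchy_seqs (Cc_alg \<Gamma>)"
  using R.cauchy_seqs_star[of x] by simp

lemma tau_le_nrm:
  assumes "a \<in> carrier (Cr \<Gamma>)"
  shows "cmod (tau a) \<le> nrm (Cr \<Gamma>) a"
proof -
  obtain x where x: "x \<in> cauchy_seqs (Cc_alg \<Gamma>)" "a = R.cls x" using assms by (rule Cr_cases)
  have "cmod (x k \<one>) \<le> reduced_norm \<Gamma> (x k)" for k
    using cmod_le_n2[OF CcD(1), of "x k" \<one>] n2_le_reduced_norm[of "x k"] R_cauchy_carrier[OF x(1), of k]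
    by fastforce
  then show ?thesis
    unfolding x(2)
    by (intro LIMSEQ_le[OF tendsto_norm[OF tendsto_tau_cls[OF x(1)]] Cr_nrm_tendsto[OF x(1)]]) blast
qed

lemma tau_minus:
  assumes "a \<in> carrier (Cr \<Gamma>)" "b \<in> carrier (Cr \<Gamma>)"
  shows "tau (a \<ominus>\<^bsub>Cr \<Gamma>\<^esub> b) = tau a - tau b"
proof -
  obtain x where x: "x \<in> cauchy_seqs (Cc_alg \<Gamma>)" "a = R.cls x" using assms(1) by (rule Cr_cases)
  obtain y where y: "y \<in> cauchy_seqs (Cc_alg \<Gamma>)" "b = R.cls y" using assms(2) by (rule Cr_cases)
  let ?d = "\<lambda>k. x k \<ominus>\<^bsub>Cc_alg \<Gamma>\<^esub> y k"
  have ab: "a \<ominus>\<^bsub>Cr \<Gamma>\<^esub> b = R.cls ?d"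
    unfolding x(2) y(2) Cr_def by (rule R.completion_minus_cls[OF x(1) y(1)])
  have "(\<lambda>k. ?d k \<one>) \<longlonglongrightarrow> tau (a \<ominus>\<^bsub>Cr \<Gamma>\<^esub> b)"
    unfolding ab by (rule tendsto_tau_cls[OF R.cauchy_seqs_minus[OF x(1) y(1)]])
  then have "(\<lambda>k. x k \<one> - y k \<one>) \<longlonglongrightarrow> tau (a \<ominus>\<^bsub>Cr \<Gamma>\<^esub> b)"
    using R_cauchy_carrier[OF x(1)] R_cauchy_carrier[OF y(1)] by (simp add: R_minus)
  moreover have "(\<lambda>k. x k \<one> - y k \<one>) \<longlonglongrightarrow> tau a - tau b"
    unfolding x(2) y(2) by (intro tendsto_diff tendsto_tau_cls x y)
  ultimately show ?thesis by (rule LIMSEQ_unique)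
qed

lemma conv_one_commute:
  assumes "f \<in> Cc \<Gamma>" "g \<in> Cc \<Gamma>"
  shows "conv \<Gamma> f g \<one> = conv \<Gamma> g f \<one>"
proof -
  have "conv \<Gamma> f g \<one> = (\<Sum>\<^sub>\<infinity>z\<in>carrier G. f z * g (inv z))"
    by (simp add: conv_infsum) (rule infsum_cong, simp)
  also have "\<dots> = (\<Sum>\<^sub>\<infinity>y\<in>carrier G. g y * f (inv y))"
    using infsum_reindex_bij_betw[OF bij_betw_inv, of "\<lambda>z. f z * g (inv z)"]
    by (simp add: mult.commute cong: infsum_cong)
  also have "\<dots> = conv \<Gamma> g f \<one>"
    by (simp add: conv_infsum) (rule infsum_cong, simp)
  finally show ?thesis .
qed

lemma tau_commute:
  assumes "a \<in> carrier (Cr \<Gamma>)" "b \<in> carrier (Cr \<Gamma>)"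
  shows "tau (a \<otimes>\<^bsub>Cr \<Gamma>\<^esub> b) = tau (b \<otimes>\<^bsub>Cr \<Gamma>\<^esub> a)"
proof -
  obtain x where x: "x \<in> cauchy_seqs (Cc_alg \<Gamma>)" "a = R.cls x" using assms(1) by (rule Cr_cases)
  obtain y where y: "y \<in> cauchy_seqs (Cc_alg \<Gamma>)" "b = R.cls y" using assms(2) by (rule Cr_cases)
  have "(\<lambda>k. conv \<Gamma> (y k) (x k) \<one>) \<longlonglongrightarrow> tau (a \<otimes>\<^bsub>Cr \<Gamma>\<^esub> b)"
    using tendsto_tau_cls[OF cauchy_conv[OF x(1) y(1)]]
    unfolding x(2) y(2) Cr_mult_cls[OF x(1) y(1)]
    by (simp add: conv_one_commute[OF R_cauchy_carrier[OF x(1)] R_cauchy_carrier[OF y(1)]])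
  moreover have "(\<lambda>k. conv \<Gamma> (y k) (x k) \<one>) \<longlonglongrightarrow> tau (b \<otimes>\<^bsub>Cr \<Gamma>\<^esub> a)"
    using tendsto_tau_cls[OF cauchy_conv[OF y(1) x(1)]]
    unfolding x(2) y(2) Cr_mult_cls[OF y(1) x(1)] .
  ultimately show ?thesis by (rule LIMSEQ_unique)
qed

text \<open>The seminorm \<open>a \<mapsto> \<surd>(\<tau>(a\<^sup>*a))\<close>, the limit of the \<open>l\<^sup>2\<close> norms of representatives.\<close>

definition tau2 :: "(nat \<Rightarrow> 'a \<Rightarrow> complex) set \<Rightarrow> real" where
  "tau2 a = sqrt (Re (tau (star (Cr \<Gamma>) a \<otimes>\<^bsub>Cr \<Gamma>\<^esub> a)))"

lemma tau2_cls:
  assumes x: "x \<in> cauchy_seqs (Cc_alg \<Gamma>)"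
  shows "(\<lambda>k. n2 (x k)) \<longlonglongrightarrow> tau2 (R.cls x)"
    and "tau (star (Cr \<Gamma>) (R.cls x) \<otimes>\<^bsub>Cr \<Gamma>\<^esub> R.cls x) = of_real ((tau2 (R.cls x))\<^sup>2)"
proof -
  let ?t = "tau (star (Cr \<Gamma>) (R.cls x) \<otimes>\<^bsub>Cr \<Gamma>\<^esub> R.cls x)"
  have lim: "(\<lambda>k. of_real ((n2 (x k))\<^sup>2) :: complex) \<longlonglongrightarrow> ?t"
    using tendsto_tau_cls[OF cauchy_conv[OF cauchy_gstar[OF x] x]]
    unfolding Cr_star_cls[OF x] Cr_mult_cls[OF cauchy_gstar[OF x] x]
    by (simp add: conv_gstar_one_self R_cauchy_carrier x)
  have re: "(\<lambda>k. (n2 (x k))\<^sup>2) \<longlonglongrightarrow> Re ?t" using tendsto_Re[OF lim] by simp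
  then have "(\<lambda>k. sqrt ((n2 (x k))\<^sup>2)) \<longlonglongrightarrow> sqrt (Re ?t)" by (rule tendsto_real_sqrt)
  then show *: "(\<lambda>k. n2 (x k)) \<longlonglongrightarrow> tau2 (R.cls x)" by (simp add: tau2_def)
  have "Im ?t = 0" using tendsto_Im[OF lim] LIMSEQ_unique[OF tendsto_const, of 0 "Im ?t"] by simp
  moreover have "Re ?t = (tau2 (R.cls x))\<^sup>2" by (rule LIMSEQ_unique[OF re tendsto_power[OF *]])
  ultimately show "?t = of_real ((tau2 (R.cls x))\<^sup>2)" by (simp add: complex_eq_iff)
qed

lemma tau2_sq: "a \<in> carrier (Cr \<Gamma>) \<Longrightarrow> tau (star (Cr \<Gamma>) a \<otimes>\<^bsub>Cr \<Gamma>\<^esub> a) = of_real ((tau2 a)\<^sup>2)"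
  by (erule Cr_cases) (simp add: tau2_cls)

lemma tau2_nonneg: "a \<in> carrier (Cr \<Gamma>) \<Longrightarrow> 0 \<le> tau2 a"
  by (erule Cr_cases) (auto intro: LIMSEQ_le_const[OF tau2_cls(1)])

lemma tau2_mult_le:
  assumes "a \<in> carrier (Cr \<Gamma>)" "b \<in> carrier (Cr \<Gamma>)"
  shows "tau2 (a \<otimes>\<^bsub>Cr \<Gamma>\<^esub> b) \<le> nrm (Cr \<Gamma>) a * tau2 b"
proof -
  obtain x where x: "x \<in> cauchy_seqs (Cc_alg \<Gamma>)" "a = R.cls x" using assms(1) by (rule Cr_cases)
  obtain y where y: "y \<in> cauchy_seqs (Cc_alg \<Gamma>)" "b = R.cls y" using assms(2) by (rule Cr_cases)
  show ?thesis
    unfolding x(2) y(2) Cr_mult_cls[OF x(1) y(1)]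
    by (intro LIMSEQ_le[OF tau2_cls(1)[OF cauchy_conv[OF x(1) y(1)]]
          tendsto_mult[OF Cr_nrm_tendsto[OF x(1)] tau2_cls(1)[OF y(1)]]])
      (auto intro: n2_conv_le R_cauchy_carrier x y)
qed

lemma tau_cauchy_schwarz:
  assumes "a \<in> carrier (Cr \<Gamma>)" "b \<in> carrier (Cr \<Gamma>)"
  shows "cmod (tau (star (Cr \<Gamma>) b \<otimes>\<^bsub>Cr \<Gamma>\<^esub> a)) \<le> tau2 b * tau2 a"
proof -
  obtain x where x: "x \<in> cauchy_seqs (Cc_alg \<Gamma>)" "a = R.cls x" using assms(1) by (rule Cr_cases)
  obtain y where y: "y \<in> cauchy_seqs (Cc_alg \<Gamma>)" "b = R.cls y" using assms(2) by (rule Cr_cases)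
  show ?thesis
    unfolding x(2) y(2) Cr_star_cls[OF y(1)] Cr_mult_cls[OF cauchy_gstar[OF y(1)] x(1)]
    by (intro LIMSEQ_le[OF tendsto_norm[OF tendsto_tau_cls[OF cauchy_conv[OF cauchy_gstar[OF y(1)] x(1)]]]
          tendsto_mult[OF tau2_cls(1)[OF y(1)] tau2_cls(1)[OF x(1)]]])
      (auto intro: conv_gstar_one_le R_cauchy_carrier x y)
qed

lemma tau2_triangle:
  assumes "a \<in> carrier (Cr \<Gamma>)" "b \<in> carrier (Cr \<Gamma>)"
  shows "tau2 (a \<oplus>\<^bsub>Cr \<Gamma>\<^esub> b) \<le> tau2 a + tau2 b"
proof -
  obtain x where x: "x \<in> cauchy_seqs (Cc_alg \<Gamma>)" "a = R.cls x" using assms(1) by (rule Cr_cases)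
  obtain y where y: "y \<in> cauchy_seqs (Cc_alg \<Gamma>)" "b = R.cls y" using assms(2) by (rule Cr_cases)
  have xy: "(\<lambda>k \<gamma>. x k \<gamma> + y k \<gamma>) \<in> cauchy_seqs (Cc_alg \<Gamma>)"
    using R.cauchy_seqs_add[OF x(1) y(1)] by simp
  have ab: "R.cls x \<oplus>\<^bsub>Cr \<Gamma>\<^esub> R.cls y = R.cls (\<lambda>k \<gamma>. x k \<gamma> + y k \<gamma>)"
    using R.completion_add_cls[OF x(1) y(1)] unfolding Cr_def by simp
  show ?thesis
    unfolding x(2) y(2) ab
    by (intro LIMSEQ_le[OF tau2_cls(1)[OF xy] tendsto_add[OF tau2_cls(1)[OF x(1)] tau2_cls(1)[OF y(1)]]])
      (auto intro!: n2_add CcD(1) R_cauchy_carrier x y)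
qed

text \<open>Left multiplication on \<open>l\<^sup>2\<close> computes the norm, by definition on the dense subalgebra and by
  approximation in general.\<close>

lemma nrm_le_by_tau2:
  assumes a: "a \<in> carrier (Cr \<Gamma>)" and c: "c \<ge> 0"
    and le: "\<And>y. y \<in> carrier (Cr \<Gamma>) \<Longrightarrow> tau2 (a \<otimes>\<^bsub>Cr \<Gamma>\<^esub> y) \<le> c * tau2 y"
  shows "nrm (Cr \<Gamma>) a \<le> c"
proof (rule field_le_epsilon)
  fix e :: real assume e: "e > 0"
  let ?\<iota> = "\<lambda>f. R.cls (\<lambda>k. f)"
  have cc: "(\<lambda>k. f) \<in> cauchy_seqs (Cc_alg \<Gamma>)" if "f \<in> Cc \<Gamma>" for f
    using that by (intro R.cauchy_seqs_const) simp
  have \<iota>: "?\<iota> f \<in> carrier (Cr \<Gamma>)" if "f \<in> Cc \<Gamma>" for f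
    unfolding Cr_def by (rule R.cls_closed[OF cc[OF that]])
  have t2: "tau2 (?\<iota> f) = n2 f" if "f \<in> Cc \<Gamma>" for f
    using LIMSEQ_unique[OF tau2_cls(1)[OF cc[OF that]] tendsto_const] .
  obtain f where f: "f \<in> Cc \<Gamma>" "nrm (Cr \<Gamma>) (a \<ominus>\<^bsub>Cr \<Gamma>\<^esub> ?\<iota> f) < e / 2"
    using R.completion_dense[of a "e / 2"] a e unfolding Cr_def by auto
  note \<iota>f = \<iota>[OF f(1)]
  have "reduced_norm \<Gamma> f \<le> e / 2 + c"
  proof (rule reduced_norm_le[OF f(1)])
    fix g assume g: "g \<in> Cc \<Gamma>"
    note \<iota>g = \<iota>[OF g]
    have "n2 (conv \<Gamma> f g) = tau2 (?\<iota> f \<otimes>\<^bsub>Cr \<Gamma>\<^esub> ?\<iota> g)"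
      using t2[OF conv_closed[OF f(1) g]] Cr_mult_cls[OF cc[OF f(1)] cc[OF g]] by simp
    also have "?\<iota> f \<otimes>\<^bsub>Cr \<Gamma>\<^esub> ?\<iota> g = (?\<iota> f \<ominus>\<^bsub>Cr \<Gamma>\<^esub> a) \<otimes>\<^bsub>Cr \<Gamma>\<^esub> ?\<iota> g \<oplus>\<^bsub>Cr \<Gamma>\<^esub> a \<otimes>\<^bsub>Cr \<Gamma>\<^esub> ?\<iota> g"
      using \<iota>f \<iota>g a by (simp add: RC.mult_minus_left RC.minus_add_cancel)
    also have "tau2 \<dots> \<le> tau2 ((?\<iota> f \<ominus>\<^bsub>Cr \<Gamma>\<^esub> a) \<otimes>\<^bsub>Cr \<Gamma>\<^esub> ?\<iota> g) + tau2 (a \<otimes>\<^bsub>Cr \<Gamma>\<^esub> ?\<iota> g)"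
      using \<iota>f \<iota>g a by (intro tau2_triangle) auto
    also have "tau2 ((?\<iota> f \<ominus>\<^bsub>Cr \<Gamma>\<^esub> a) \<otimes>\<^bsub>Cr \<Gamma>\<^esub> ?\<iota> g) \<le> nrm (Cr \<Gamma>) (?\<iota> f \<ominus>\<^bsub>Cr \<Gamma>\<^esub> a) * tau2 (?\<iota> g)"
      using \<iota>f \<iota>g a by (intro tau2_mult_le) auto
    also have "\<dots> \<le> e / 2 * tau2 (?\<iota> g)"
      using f(2) RC.nrm_minus_commute[OF \<iota>f a] by (intro mult_right_mono tau2_nonneg \<iota>g) auto
    also have "tau2 (a \<otimes>\<^bsub>Cr \<Gamma>\<^esub> ?\<iota> g) \<le> c * tau2 (?\<iota> g)" by (rule le[OF \<iota>g])
    finally show "n2 (conv \<Gamma> f g) \<le> (e / 2 + c) * n2 g"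
      by (simp add: t2[OF g] distrib_right)
  qed (use c e in simp)
  moreover have "nrm (Cr \<Gamma>) (?\<iota> f) = reduced_norm \<Gamma> f"
    using R.nrm_cls_const[of f] f(1) unfolding Cr_def by simp
  ultimately show "nrm (Cr \<Gamma>) a \<le> c + e"
    using RC.nrm_diff_le[OF a \<iota>f] f(2) by linarith
qed

text \<open>The trace is faithful in the strong sense that the moments of a self-adjoint element control its norm.
  By the trace property \<open>\<parallel>w\<^sup>jy\<parallel>\<^sub>2 = \<parallel>y\<^sup>*w\<^sup>j\<parallel>\<^sub>2 \<le> \<parallel>y\<parallel> \<parallel>w\<^sup>j\<parallel>\<^sub>2\<close>, and log-convexity of
  \<open>j \<mapsto> \<parallel>w\<^sup>jy\<parallel>\<^sub>2\<close> turns the growth rate into a bound for \<open>j = 1\<close>.\<close>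

lemma nrm_le_by_moments:
  assumes w: "w \<in> carrier (Cr \<Gamma>)" and sa: "star (Cr \<Gamma>) w = w" and \<rho>: "\<rho> > 0"
    and mom: "\<And>m. cmod (tau (w [^]\<^bsub>Cr \<Gamma>\<^esub> (m::nat))) \<le> \<rho> ^ m"
  shows "nrm (Cr \<Gamma>) w \<le> \<rho>"
proof (rule nrm_le_by_tau2[OF w less_imp_le[OF \<rho>]])
  fix y assume y: "y \<in> carrier (Cr \<Gamma>)"
  let ?C = "Cr \<Gamma>"
  let ?p = "\<lambda>j::nat. w [^]\<^bsub>?C\<^esub> j"
  have p: "?p j \<in> carrier ?C" for j using w by simp
  have psa: "star ?C (?p j) = ?p j" for j
  proof (induction j)
    case (Suc j)
    have "star ?C (?p (Suc j)) = star ?C w \<otimes>\<^bsub>?C\<^esub> star ?C (?p j)" using w p by (simp add: RC.star_mult)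
    also have "\<dots> = ?p (Suc j)" unfolding sa Suc using w RC.nat_pow_Suc2[of w j] by simp
    finally show ?case .
  qed (simp add: RC.star_one)
  have pp: "?p i \<otimes>\<^bsub>?C\<^esub> ?p j = ?p (i + j)" for i j using w by (simp add: RC.nat_pow_mult)
  have moment: "(tau2 (?p j))\<^sup>2 \<le> \<rho> ^ (2 * j)" for j
  proof -
    have "of_real ((tau2 (?p j))\<^sup>2) = tau (?p (2 * j))"
      using tau2_sq[OF p, of j] by (simp add: psa pp mult_2)
    then have "(tau2 (?p j))\<^sup>2 = cmod (tau (?p (2 * j)))"
      by (metis norm_of_real abs_of_nonneg zero_le_power2)
    then show ?thesis using mom[of "2 * j"] by simp
  qed
  have swap: "tau2 (?p j \<otimes>\<^bsub>?C\<^esub> y) = tau2 (star ?C y \<otimes>\<^bsub>?C\<^esub> ?p j)" for j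
  proof -
    have "star ?C (?p j \<otimes>\<^bsub>?C\<^esub> y) \<otimes>\<^bsub>?C\<^esub> (?p j \<otimes>\<^bsub>?C\<^esub> y)
        = (star ?C y \<otimes>\<^bsub>?C\<^esub> ?p j) \<otimes>\<^bsub>?C\<^esub> (?p j \<otimes>\<^bsub>?C\<^esub> y)"
      using y p by (simp add: RC.star_mult psa)
    moreover have "star ?C (star ?C y \<otimes>\<^bsub>?C\<^esub> ?p j) \<otimes>\<^bsub>?C\<^esub> (star ?C y \<otimes>\<^bsub>?C\<^esub> ?p j)
        = (?p j \<otimes>\<^bsub>?C\<^esub> y) \<otimes>\<^bsub>?C\<^esub> (star ?C y \<otimes>\<^bsub>?C\<^esub> ?p j)"
      using y p by (simp add: RC.star_mult psa)
    ultimately show ?thesis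
      unfolding tau2_def using tau_commute[of "star ?C y \<otimes>\<^bsub>?C\<^esub> ?p j" "?p j \<otimes>\<^bsub>?C\<^esub> y"] y p by simp
  qed
  define t where "t j = tau2 (?p j \<otimes>\<^bsub>?C\<^esub> y)" for j
  have t0: "t j \<ge> 0" for j unfolding t_def using y p by (intro tau2_nonneg) auto
  have growth: "t j \<le> nrm ?C y * \<rho> ^ j" for j
  proof -
    have "t j \<le> nrm ?C (star ?C y) * tau2 (?p j)"
      unfolding t_def swap using y p by (intro tau2_mult_le) auto
    moreover have "tau2 (?p j) \<le> \<rho> ^ j"
      by (rule power2_le_imp_le) (use moment[of j] \<rho> in \<open>simp_all add: power_mult[symmetric] mult.commute\<close>)
    ultimately show ?thesis
      using y RC.nrm_star[OF y] mult_left_mono[of "tau2 (?p j)" "\<rho> ^ j" "nrm ?C y"] by simp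
  qed
  have convex: "(t j)\<^sup>2 \<le> t 0 * t (2 * j)" for j
  proof -
    have "of_real ((t j)\<^sup>2) = tau (star ?C y \<otimes>\<^bsub>?C\<^esub> (?p (2 * j) \<otimes>\<^bsub>?C\<^esub> y))"
    proof -
      have "star ?C (?p j \<otimes>\<^bsub>?C\<^esub> y) \<otimes>\<^bsub>?C\<^esub> (?p j \<otimes>\<^bsub>?C\<^esub> y) = star ?C y \<otimes>\<^bsub>?C\<^esub> ((?p j \<otimes>\<^bsub>?C\<^esub> ?p j) \<otimes>\<^bsub>?C\<^esub> y)"
        using y p by (simp add: RC.star_mult psa RC.m_assoc)
      then show ?thesis
        unfolding t_def using tau2_sq[of "?p j \<otimes>\<^bsub>?C\<^esub> y"] y p by (simp add: pp mult_2)
    qed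
    then have "(t j)\<^sup>2 = cmod (tau (star ?C y \<otimes>\<^bsub>?C\<^esub> (?p (2 * j) \<otimes>\<^bsub>?C\<^esub> y)))"
      by (metis norm_of_real abs_of_nonneg zero_le_power2)
    also have "\<dots> \<le> tau2 y * t (2 * j)"
      unfolding t_def using y p by (intro tau_cauchy_schwarz) auto
    also have "tau2 y = t 0" using y by (simp add: t_def)
    finally show ?thesis .
  qed
  have "t 1 \<le> \<rho> * t 0"
  proof (cases "t 0 = 0")
    case True
    then show ?thesis using convex[of 1] by simp
  next
    case False
    then have s: "t 0 > 0" using t0[of 0] by simp
    define u where "u j = t j / (t 0 * \<rho> ^ j)" for j
    have u0: "u j \<ge> 0" for j using t0 s \<rho> by (simp add: u_def)
    have u2: "(u j)\<^sup>2 \<le> u (2 * j)" for j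
    proof -
      have "(u j)\<^sup>2 = (t j)\<^sup>2 / (t 0 * t 0 * \<rho> ^ (2 * j))"
      proof -
        have "\<rho> ^ (2 * j) = \<rho> ^ j * \<rho> ^ j" by (simp add: mult_2 power_add)
        then show ?thesis by (simp add: u_def power2_eq_square mult_ac)
      qed
      also have "\<dots> \<le> (t 0 * t (2 * j)) / (t 0 * t 0 * \<rho> ^ (2 * j))"
        using convex[of j] s \<rho> by (intro divide_right_mono) auto
      also have "\<dots> = u (2 * j)" using s by (simp add: u_def)
      finally show ?thesis .
    qed
    have pow: "(u 1) ^ (2 ^ i) \<le> u (2 ^ i)" for i
    proof (induction i)
      case (Suc i)
      have "(u 1) ^ (2 ^ Suc i) = ((u 1) ^ (2 ^ i))\<^sup>2" by (simp add: power_mult[symmetric] mult.commute)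
      also have "\<dots> \<le> (u (2 ^ i))\<^sup>2" using Suc u0 by (intro power_mono) auto
      also have "\<dots> \<le> u (2 ^ Suc i)" using u2[of "2 ^ i"] by simp
      finally show ?case .
    qed simp
    have bound: "(u 1) ^ (2 ^ i) \<le> nrm ?C y / t 0" for i
    proof -
      have "u (2 ^ i) \<le> (nrm ?C y * \<rho> ^ (2 ^ i)) / (t 0 * \<rho> ^ (2 ^ i))"
        unfolding u_def using growth[of "2 ^ i"] s \<rho> by (intro divide_right_mono) auto
      then show ?thesis using pow[of i] \<rho> by simp
    qed
    have "u 1 \<le> 1"
    proof (rule ccontr)
      assume "\<not> u 1 \<le> 1"
      then obtain n where n: "nrm ?C y / t 0 < (u 1) ^ n" using real_arch_pow[of "u 1"] by auto
      have "(u 1) ^ n \<le> (u 1) ^ (2 ^ n)"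
        using \<open>\<not> u 1 \<le> 1\<close> by (intro power_increasing) (auto simp: less_imp_le)
      then show False using n bound[of n] by linarith
    qed
    then show ?thesis using s \<rho> by (simp add: u_def divide_le_eq mult.commute)
  qed
  then show "tau2 (w \<otimes>\<^bsub>?C\<^esub> y) \<le> \<rho> * tau2 y"
    using y w by (simp add: t_def)
qed

end

section \<open>Moments over finite groups\<close>

definition mtrace :: "complex mat \<Rightarrow> complex" where
  "mtrace A = (\<Sum>i<dim_row A. A $$ (i, i))"

lemma mtrace_mult_commute:
  assumes "A \<in> carrier_mat n n" "B \<in> carrier_mat n n"
  shows "mtrace (A * B) = mtrace (B * A)"
proof -
  have "mtrace (A * B) = (\<Sum>i<n. \<Sum>j<n. A $$ (i, j) * B $$ (j, i))"
    using assms by (auto simp: mtrace_def scalar_prod_def atLeast0LessThan intro!: sum.cong)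
  also have "\<dots> = (\<Sum>j<n. \<Sum>i<n. B $$ (j, i) * A $$ (i, j))"
    by (subst sum.swap) (simp add: mult.commute)
  also have "\<dots> = mtrace (B * A)"
    using assms by (auto simp: mtrace_def scalar_prod_def atLeast0LessThan intro!: sum.cong)
  finally show ?thesis .
qed

lemma upper_triangular_mult:
  fixes A B :: "complex mat"
  assumes A: "A \<in> carrier_mat n n" "upper_triangular A" and B: "B \<in> carrier_mat n n" "upper_triangular B"
  shows "upper_triangular (A * B)" and "i < n \<Longrightarrow> (A * B) $$ (i, i) = A $$ (i, i) * B $$ (i, i)"
proof -
  have ent: "(A * B) $$ (i, j) = (\<Sum>k<n. A $$ (i, k) * B $$ (k, j))" if "i < n" "j < n" for i j
    using A B that by (simp add: scalar_prod_def atLeast0LessThan)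
  have zero: "A $$ (i, k) * B $$ (k, j) = 0" if "i < n" "k < n" "j < n" "k < i \<or> j < k" for i j k
    using A B that by (auto dest: upper_triangularD)
  show "upper_triangular (A * B)"
  proof (rule upper_triangularI)
    fix i j assume "j < i" "i < dim_row (A * B)"
    then have i: "i < n" "j < n" "j < i" using A by auto
    have "(\<Sum>k<n. A $$ (i, k) * B $$ (k, j)) = 0"
    proof (rule sum.neutral, rule ballI)
      fix k assume "k \<in> {..<n}"
      moreover have "k < i \<or> j < k" using i(3) by linarith
      ultimately show "A $$ (i, k) * B $$ (k, j) = 0" using zero i(1,2) by simp
    qed
    then show "(A * B) $$ (i, j) = 0" using ent i by simp
  qed
  show "(A * B) $$ (i, i) = A $$ (i, i) * B $$ (i, i)" if i: "i < n"
  proof -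
    have "(\<Sum>k<n. A $$ (i, k) * B $$ (k, i)) = (\<Sum>k\<in>{i}. A $$ (i, k) * B $$ (k, i))"
      by (rule sum.mono_neutral_right) (use i zero[OF i _ i] in \<open>auto simp: neq_iff\<close>)
    then show ?thesis using ent[OF i i] by simp
  qed
qed

lemma upper_triangular_pow:
  fixes A :: "complex mat"
  assumes A: "A \<in> carrier_mat n n" "upper_triangular A"
  shows "upper_triangular (A ^\<^sub>m m) \<and> (\<forall>i<n. (A ^\<^sub>m m) $$ (i, i) = (A $$ (i, i)) ^ m)"
proof (induction m)
  case 0
  then show ?case using A by auto
next
  case (Suc m)
  have "A ^\<^sub>m m \<in> carrier_mat n n" using A by simp
  from upper_triangular_mult[OF this _ A] Suc show ?case by (simp add: mult.commute)
qed

text \<open>By Schur triangularization the trace of a power is the sum of the powers of the eigenvalues.\<close>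

lemma mtrace_pow_bound:
  assumes A: "A \<in> carrier_mat n n" and ev: "\<And>k. eigenvalue A k \<Longrightarrow> cmod k \<le> \<rho>"
  shows "cmod (mtrace (A ^\<^sub>m m)) \<le> n * \<rho> ^ m"
proof -
  obtain es where es: "char_poly A = (\<Prod>a\<leftarrow>es. [:- a, 1:])"
    using char_poly_factorized[OF A] by blast
  obtain B P Q where "schur_decomposition A es = (B, P, Q)" by (metis prod_cases3)
  from schur_decomposition[OF A es this]
  have sim: "similar_mat_wit A B P Q" and B: "upper_triangular B" by blast+
  note D = similar_mat_witD2[OF A sim]
  have Bm: "B ^\<^sub>m m \<in> carrier_mat n n" using D by simp
  have "A ^\<^sub>m m = (P * B ^\<^sub>m m) * Q" by (rule similar_mat_wit_pow_id[OF sim])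
  then have "mtrace (A ^\<^sub>m m) = mtrace (Q * (P * B ^\<^sub>m m))"
    using mtrace_mult_commute[of "P * B ^\<^sub>m m" n Q] D Bm by simp
  also have "Q * (P * B ^\<^sub>m m) = B ^\<^sub>m m"
    using assoc_mult_mat[of Q n n P n "B ^\<^sub>m m" n] D Bm by simp
  finally have "mtrace (A ^\<^sub>m m) = (\<Sum>i<n. (B $$ (i, i)) ^ m)"
    using upper_triangular_pow[OF D(5) B, of m] D(5) by (simp add: mtrace_def)
  moreover have "cmod ((B $$ (i, i)) ^ m) \<le> \<rho> ^ m" if i: "i < n" for i
  proof -
    have "similar_mat A B" using sim unfolding similar_mat_def by blast
    then have "char_poly A = (\<Prod>a\<leftarrow>diag_mat B. [:- a, 1:])"
      using char_poly_similar char_poly_upper_triangular[OF D(5) B] by metis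
    moreover have "B $$ (i, i) \<in> set (diag_mat B)" using i D(5) by (auto simp: diag_mat_def)
    ultimately have "poly (char_poly A) (B $$ (i, i)) = 0"
      by (auto simp: poly_prod_list prod_list_zero_iff image_iff intro!: bexI[of _ "B $$ (i, i)"])
    then have "cmod (B $$ (i, i)) \<le> \<rho>"
      using ev eigenvalue_root_char_poly[OF A] by blast
    then show ?thesis by (simp add: norm_power power_mono)
  qed
  ultimately show ?thesis
    using norm_sum[of "\<lambda>i. (B $$ (i, i)) ^ m" "{..<n}"]
      sum_mono[of "{..<n}" "\<lambda>i. cmod ((B $$ (i, i)) ^ m)" "\<lambda>i. \<rho> ^ m"] by simp
qed

lemma eigenvalue_exists:
  assumes A: "(A :: complex mat) \<in> carrier_mat n n" and n: "n > 0"
  obtains k where "eigenvalue A k"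
proof -
  obtain es where es: "char_poly A = (\<Prod>a\<leftarrow>es. [:- a, 1:])" "length es = n"
    using char_poly_factorized[OF A] by blast
  then have "poly (char_poly A) (hd es) = 0"
    using n by (cases es) auto
  then show ?thesis using that eigenvalue_root_char_poly[OF A] by blast
qed

context group
begin

interpretation R: pre_cstar "Cc_alg \<Gamma>"
  by (rule pre_cstar_group)

interpretation RC: unital_cstar "Cr \<Gamma>"
  unfolding Cr_def by (rule R.unital_cstar_completion)

lemma const_cauchy: "f \<in> Cc \<Gamma> \<Longrightarrow> (\<lambda>k. f) \<in> cauchy_seqs (Cc_alg \<Gamma>)"
  by (rule R.cauchy_seqs_const) simp

lemma const_class_closed: "f \<in> Cc \<Gamma> \<Longrightarrow> const_class f \<in> carrier (Cr \<Gamma>)"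
  unfolding Cr_def const_class_def by (rule R.cls_closed[OF const_cauchy])

lemma const_class_mult: "\<lbrakk>f \<in> Cc \<Gamma>; g \<in> Cc \<Gamma>\<rbrakk> \<Longrightarrow> const_class f \<otimes>\<^bsub>Cr \<Gamma>\<^esub> const_class g = const_class (conv \<Gamma> f g)"
  unfolding const_class_def by (rule Cr_mult_cls[OF const_cauchy const_cauchy])

lemma const_class_one: "\<one>\<^bsub>Cr \<Gamma>\<^esub> = const_class \<delta>"
proof -
  have "\<one>\<^bsub>Cc_alg \<Gamma>\<^esub> = \<delta>" by (auto simp: \<delta>_def fun_eq_iff)
  then show ?thesis unfolding Cr_def const_class_def R.completion_one by simp
qed

lemma const_class_smult: "f \<in> Cc \<Gamma> \<Longrightarrow> z \<odot>\<^bsub>Cr \<Gamma>\<^esub> const_class f = const_class (\<lambda>x. z * f x)"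
  unfolding Cr_def const_class_def using R.completion_smult_cls[OF const_cauchy, of f z] by simp

lemma tau_const_class: "f \<in> Cc \<Gamma> \<Longrightarrow> tau (const_class f) = f \<one>"
  unfolding const_class_def using LIMSEQ_unique[OF tendsto_tau_cls[OF const_cauchy] tendsto_const] by blast

lemma const_class_eq_zero: "f \<in> Cc \<Gamma> \<Longrightarrow> const_class f = \<zero>\<^bsub>Cr \<Gamma>\<^esub> \<Longrightarrow> f = (\<lambda>x. 0)"
proof
  fix x assume f: "f \<in> Cc \<Gamma>" and 0: "const_class f = \<zero>\<^bsub>Cr \<Gamma>\<^esub>"
  have "reduced_norm \<Gamma> f = nrm (Cr \<Gamma>) (const_class f)"
    unfolding Cr_def const_class_def using R.nrm_cls_const[of f] f by simp
  then have "n2 f \<le> 0" using n2_le_reduced_norm[OF f] 0 RC.nrm_zero by simp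
  then have "cmod (f x) \<le> 0" by (rule order_trans[OF cmod_le_n2[OF CcD(1)[OF f]]])
  then show "f x = 0" by simp
qed

text \<open>An inverse of \<open>z - f\<close> in the completion would annihilate, hence exclude, the eigenvector.\<close>

lemma eigenvalue_in_spectrum:
  assumes f: "f \<in> Cc \<Gamma>" and v: "v \<in> Cc \<Gamma>" "v \<noteq> (\<lambda>x. 0)" and eig: "conv \<Gamma> f v = (\<lambda>x. z * v x)"
  shows "z \<in> spectrum (Cr \<Gamma>) (const_class f)"
proof (rule ccontr)
  let ?C = "Cr \<Gamma>"
  assume "z \<notin> spectrum ?C (const_class f)"
  then obtain r where r: "r \<in> carrier ?C" "r \<otimes>\<^bsub>?C\<^esub> (z \<odot>\<^bsub>?C\<^esub> \<one>\<^bsub>?C\<^esub> \<ominus>\<^bsub>?C\<^esub> const_class f) = \<one>\<^bsub>?C\<^esub>"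
    unfolding spectrum_def Units_def by blast
  note c = const_class_closed[OF f] const_class_closed[OF v(1)]
  have "(z \<odot>\<^bsub>?C\<^esub> \<one>\<^bsub>?C\<^esub> \<ominus>\<^bsub>?C\<^esub> const_class f) \<otimes>\<^bsub>?C\<^esub> const_class v = z \<odot>\<^bsub>?C\<^esub> const_class v \<ominus>\<^bsub>?C\<^esub> const_class (\<lambda>x. z * v x)"
    using c by (simp add: RC.mult_minus_left RC.smult_mult_l const_class_mult f v eig)
  also have "\<dots> = \<zero>\<^bsub>?C\<^esub>"
    using c const_class_closed[OF smult_closed[OF v(1), of z]] by (simp add: const_class_smult v RC.minus_eq RC.r_neg)
  finally have "r \<otimes>\<^bsub>?C\<^esub> ((z \<odot>\<^bsub>?C\<^esub> \<one>\<^bsub>?C\<^esub> \<ominus>\<^bsub>?C\<^esub> const_class f) \<otimes>\<^bsub>?C\<^esub> const_class v) = \<zero>\<^bsub>?C\<^esub>"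
    using r by simp
  moreover have "r \<otimes>\<^bsub>?C\<^esub> ((z \<odot>\<^bsub>?C\<^esub> \<one>\<^bsub>?C\<^esub> \<ominus>\<^bsub>?C\<^esub> const_class f) \<otimes>\<^bsub>?C\<^esub> const_class v)
      = (r \<otimes>\<^bsub>?C\<^esub> (z \<odot>\<^bsub>?C\<^esub> \<one>\<^bsub>?C\<^esub> \<ominus>\<^bsub>?C\<^esub> const_class f)) \<otimes>\<^bsub>?C\<^esub> const_class v"
    by (rule RC.m_assoc[symmetric]) (use r c in auto)
  ultimately have "const_class v = \<zero>\<^bsub>?C\<^esub>" using r(2) c by simp
  then show False using const_class_eq_zero[OF v(1)] v(2) by blast
qed

text \<open>The group algebra of a finite group is finite-dimensional, hence complete.\<close>

lemma const_class_surj: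
  assumes fin: "finite (carrier G)" and a: "a \<in> carrier (Cr \<Gamma>)"
  obtains f where "f \<in> Cc \<Gamma>" "a = const_class f"
proof -
  obtain x where x: "x \<in> cauchy_seqs (Cc_alg \<Gamma>)" "a = R.cls x" using a by (rule Cr_cases)
  obtain f where f: "\<And>t. (\<lambda>k. x k t) \<longlonglongrightarrow> f t"
    using cauchy_pointwise[OF x(1)] unfolding convergent_def by metis
  note xC = R_cauchy_carrier[OF x(1)]
  have "f t = 0" if "t \<notin> carrier G" for t
    using f[of t] CcD(3)[OF xC that] LIMSEQ_unique[OF tendsto_const] by fastforce
  then have "supp f \<subseteq> carrier G" by (auto simp: supp_def)
  then have fC: "f \<in> Cc \<Gamma>" using fin by (auto simp: Cc_group_iff intro: finite_subset)
  have dC: "(\<lambda>t. x k t - f t) \<in> Cc \<Gamma>" for k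
    using R.minus_closed[of "x k" f] xC fC by (simp add: R_minus)
  have "(\<lambda>k. \<Sum>t\<in>carrier G. cmod (x k t - f t)) \<longlonglongrightarrow> (\<Sum>t\<in>carrier G. cmod (f t - f t))"
    by (intro tendsto_sum tendsto_norm tendsto_diff f tendsto_const)
  then have lim: "(\<lambda>k. \<Sum>t\<in>carrier G. cmod (x k t - f t)) \<longlonglongrightarrow> 0" by simp
  have "norm (nrm (Cc_alg \<Gamma>) (x k \<ominus>\<^bsub>Cc_alg \<Gamma>\<^esub> f)) \<le> (\<Sum>t\<in>carrier G. cmod (x k t - f t))" for k
  proof -
    have "reduced_norm \<Gamma> (\<lambda>t. x k t - f t) \<le> (\<Sum>t\<in>supp (\<lambda>t. x k t - f t). cmod (x k t - f t))"
      by (rule reduced_norm_le[OF dC]) (auto intro: sum_nonneg n2_conv_le_sum dC)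
    also have "\<dots> \<le> (\<Sum>t\<in>carrier G. cmod (x k t - f t))"
      using fin CcD(2)[OF dC] by (intro sum_mono2) auto
    finally show ?thesis using xC fC reduced_norm_nonneg[OF dC, of k] by (simp add: R_minus)
  qed
  then have "(\<lambda>k. nrm (Cc_alg \<Gamma>) (x k \<ominus>\<^bsub>Cc_alg \<Gamma>\<^esub> f)) \<longlonglongrightarrow> 0"
    by (intro Lim_null_comparison[OF always_eventually lim] allI)
  then have "a = const_class f"
    unfolding x(2) const_class_def using x(1) const_cauchy[OF fC] by (simp only: R.cls_eq_iff)
  then show ?thesis using that fC by blast
qed

primrec cpow :: "('a \<Rightarrow> complex) \<Rightarrow> nat \<Rightarrow> 'a \<Rightarrow> complex" where
  "cpow f 0 = \<delta>"
| "cpow f (Suc m) = conv \<Gamma> (cpow f m) f"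

lemma cpow_closed: "f \<in> Cc \<Gamma> \<Longrightarrow> cpow f m \<in> Cc \<Gamma>"
  by (induction m) (auto intro: conv_closed)

lemma const_class_pow: "f \<in> Cc \<Gamma> \<Longrightarrow> const_class f [^]\<^bsub>Cr \<Gamma>\<^esub> m = const_class (cpow f m)"
  by (induction m) (auto simp: const_class_one const_class_mult cpow_closed)

text \<open>The matrix of left convolution in the basis of point masses.\<close>

definition gmat :: "(nat \<Rightarrow> 'a) \<Rightarrow> nat \<Rightarrow> ('a \<Rightarrow> complex) \<Rightarrow> complex mat" where
  "gmat e n f = mat n n (\<lambda>(i, j). f (e i \<otimes> inv (e j)))"

context
  fixes e :: "nat \<Rightarrow> 'a" and n :: nat
  assumes e: "bij_betw e {..<n} (carrier G)"
begin

lemma enum_closed: "i < n \<Longrightarrow> e i \<in> carrier G"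
  using e by (auto simp: bij_betw_def)

lemma conv_enum:
  assumes i: "i < n" and h: "h \<in> carrier G"
  shows "conv \<Gamma> f g (e i \<otimes> h) = (\<Sum>k<n. f (e i \<otimes> inv (e k)) * g (e k \<otimes> h))"
proof -
  have fin: "finite (carrier G)" using e bij_betw_finite by blast
  have b: "bij_betw (\<lambda>k. e k \<otimes> h) {..<n} (carrier G)"
  proof -
    have "bij_betw (\<lambda>x. x \<otimes> h) (carrier G) (carrier G)"
      by (rule bij_betwI[where g="\<lambda>y. y \<otimes> inv h"]) (use h in \<open>auto simp: m_assoc\<close>)
    from bij_betw_trans[OF e this] show ?thesis by (simp add: o_def)
  qed
  have "conv \<Gamma> f g (e i \<otimes> h) = (\<Sum>y\<in>carrier G. f (e i \<otimes> h \<otimes> inv y) * g y)"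
    using enum_closed[OF i] h fin by (simp add: conv_def infsum_finite)
  also have "\<dots> = (\<Sum>k<n. f (e i \<otimes> h \<otimes> inv (e k \<otimes> h)) * g (e k \<otimes> h))"
    by (rule sum.reindex_bij_betw[OF b, symmetric])
  also have "\<dots> = (\<Sum>k<n. f (e i \<otimes> inv (e k)) * g (e k \<otimes> h))"
    by (rule sum.cong) (use enum_closed i h in \<open>auto simp: group_cancel\<close>)
  finally show ?thesis .
qed

lemma gmat_conv: "gmat e n (conv \<Gamma> f g) = gmat e n f * gmat e n g"
  by (rule eq_matI)
    (simp_all add: gmat_def conv_enum enum_closed scalar_prod_def atLeast0LessThan)

lemma gmat_delta: "gmat e n \<delta> = 1\<^sub>m n"
proof (rule eq_matI)
  fix i j assume "i < dim_row (1\<^sub>m n :: complex mat)" "j < dim_col (1\<^sub>m n :: complex mat)"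
  then have ij: "i < n" "j < n" by auto
  have "e i \<otimes> inv (e j) = \<one> \<longleftrightarrow> e i = e j"
    using enum_closed ij by (metis inv_closed inv_equality inv_inv r_inv)
  also have "\<dots> \<longleftrightarrow> i = j"
    using e ij by (auto simp: bij_betw_def dest: inj_onD)
  finally show "gmat e n \<delta> $$ (i, j) = 1\<^sub>m n $$ (i, j)"
    using ij by (simp add: gmat_def \<delta>_def)
qed (simp_all add: gmat_def)

lemma gmat_carrier: "gmat e n f \<in> carrier_mat n n"
  by (simp add: gmat_def)

lemma gmat_cpow: "gmat e n (cpow f m) = gmat e n f ^\<^sub>m m"
  by (induction m) (simp_all add: gmat_delta gmat_conv, simp add: gmat_def)

lemma mtrace_gmat:
  fixes f :: "'a \<Rightarrow> complex"
  shows "mtrace (gmat e n f) = of_nat n * f \<one>"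
proof -
  have "mtrace (gmat e n f) = (\<Sum>i<n. f (e i \<otimes> inv (e i)))" by (simp add: mtrace_def gmat_def)
  also have "\<dots> = (\<Sum>i<n. f \<one>)" by (rule sum.cong) (simp_all add: enum_closed)
  finally show ?thesis by simp
qed

lemma eigenvalue_gmat:
  assumes f: "f \<in> Cc \<Gamma>" and k: "eigenvalue (gmat e n f) k"
  shows "k \<in> spectrum (Cr \<Gamma>) (const_class f)"
proof -
  obtain u where u: "u \<in> carrier_vec n" "u \<noteq> 0\<^sub>v n" "gmat e n f *\<^sub>v u = k \<cdot>\<^sub>v u"
    using k gmat_carrier[of f] by (auto simp: eigenvalue_def eigenvector_def)
  define v where "v x = (if x \<in> carrier G then u $ (the_inv_into {..<n} e x) else 0)" for x
  have ve: "v (e i) = u $ i" if "i < n" for i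
    using that e enum_closed by (simp add: v_def bij_betw_def the_inv_into_f_f)
  have fin: "finite (carrier G)" using e bij_betw_finite by blast
  have "supp v \<subseteq> carrier G" by (auto simp: supp_def v_def split: if_splits)
  then have v: "v \<in> Cc \<Gamma>" using fin by (auto simp: Cc_group_iff intro: finite_subset)
  have "v \<noteq> (\<lambda>x. 0)"
  proof
    assume "v = (\<lambda>x. 0)"
    then have "u = 0\<^sub>v n" using ve u(1) by (intro eq_vecI) auto
    then show False using u(2) by simp
  qed
  moreover have "conv \<Gamma> f v = (\<lambda>x. k * v x)"
  proof
    fix x
    show "conv \<Gamma> f v x = k * v x"
    proof (cases "x \<in> carrier G")
      case True
      then obtain i where i: "i < n" "x = e i" using e by (auto simp: bij_betw_def)
      have "conv \<Gamma> f v (e i \<otimes> \<one>) = (\<Sum>j<n. f (e i \<otimes> inv (e j)) * v (e j \<otimes> \<one>))"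
        by (rule conv_enum[OF i(1)]) simp
      then have "conv \<Gamma> f v x = (\<Sum>j<n. f (e i \<otimes> inv (e j)) * u $ j)"
      proof -
        have "(\<Sum>j<n. f (e i \<otimes> inv (e j)) * v (e j \<otimes> \<one>)) = (\<Sum>j<n. f (e i \<otimes> inv (e j)) * u $ j)"
          by (rule sum.cong) (simp_all add: enum_closed ve)
        then show ?thesis
          using \<open>conv \<Gamma> f v (e i \<otimes> \<one>) = _\<close> i enum_closed[OF i(1)] by simp
      qed
      also have "\<dots> = (gmat e n f *\<^sub>v u) $ i"
        using i u(1) by (simp add: gmat_def scalar_prod_def atLeast0LessThan)
      also have "\<dots> = k * v x" using i u ve by simp
      finally show ?thesis .
    qed (simp add: conv_off v_def)
  qed
  ultimately show ?thesis by (intro eigenvalue_in_spectrum[OF f v])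
qed

end

lemma finite_enum:
  assumes "finite (carrier G)"
  obtains e where "bij_betw e {..<card (carrier G)} (carrier G)"
  using ex_bij_betw_nat_finite[OF assms] by (auto simp: atLeast0LessThan)

lemma card_pos: "finite (carrier G) \<Longrightarrow> card (carrier G) > 0"
  by (auto simp: card_gt_0_iff)

text \<open>The value at the unit is the normalized trace of the convolution matrix, that is, the mean of the
  eigenvalues. A bound on the spectrum therefore bounds all moments, with constant \<open>1\<close> independently of
  the order of the group.\<close>

lemma tau_pow_bound:
  assumes fin: "finite (carrier G)" and a: "a \<in> carrier (Cr \<Gamma>)"
    and le: "\<And>z. z \<in> spectrum (Cr \<Gamma>) a \<Longrightarrow> cmod z \<le> \<rho>"
  shows "cmod (tau (a [^]\<^bsub>Cr \<Gamma>\<^esub> (m::nat))) \<le> \<rho> ^ m"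
proof -
  obtain f where f: "f \<in> Cc \<Gamma>" "a = const_class f" using const_class_surj[OF fin a] .
  let ?n = "card (carrier G)"
  obtain e where e: "bij_betw e {..<?n} (carrier G)" using finite_enum[OF fin] .
  have "cmod (mtrace (gmat e ?n f ^\<^sub>m m)) \<le> ?n * \<rho> ^ m"
    by (rule mtrace_pow_bound[OF gmat_carrier[OF e]]) (use le eigenvalue_gmat[OF e f(1)] f(2) in blast)
  then have "?n * cmod (cpow f m \<one>) \<le> ?n * \<rho> ^ m"
    unfolding gmat_cpow[OF e, symmetric] mtrace_gmat[OF e] by (simp add: norm_mult)
  then have "cmod (cpow f m \<one>) \<le> \<rho> ^ m"
    using card_pos[OF fin] by simp
  then show ?thesis unfolding f(2) by (simp add: const_class_pow f(1) tau_const_class cpow_closed)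
qed

lemma spectrum_nonempty_finite:
  assumes fin: "finite (carrier G)" and a: "a \<in> carrier (Cr \<Gamma>)"
  shows "spectrum (Cr \<Gamma>) a \<noteq> {}"
proof -
  obtain f where f: "f \<in> Cc \<Gamma>" "a = const_class f" using const_class_surj[OF fin a] .
  let ?n = "card (carrier G)"
  obtain e where e: "bij_betw e {..<?n} (carrier G)" using finite_enum[OF fin] .
  obtain k where "eigenvalue (gmat e ?n f) k"
    using eigenvalue_exists[OF gmat_carrier[OF e, of f] card_pos[OF fin]] .
  from eigenvalue_gmat[OF e f(1) this] show ?thesis using f(2) by blast
qed

end

section \<open>Convergence of spectra\<close>

text \<open>On the real points \<open>z\<close> with \<open>e \<le> \<bar>z\<bar> \<le> M\<close> the polynomial \<open>1 - z\<^sup>2/M\<^sup>2\<close> is at most \<open>1 - e\<^sup>2/M\<^sup>2\<close> in modulus.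
  Half of this margin survives in a strip of width proportional to \<open>e\<^sup>2/M\<close> about the real line.\<close>

lemma quadratic_estimate:
  fixes z :: complex
  assumes Im: "\<bar>Im z\<bar> \<le> e\<^sup>2 / (8 * M)" and Re: "\<bar>Re z\<bar> \<le> M" and e: "0 < e" "e \<le> M" and z: "e \<le> cmod z"
  shows "cmod (1 - z\<^sup>2 / of_real (M\<^sup>2)) \<le> 1 - e\<^sup>2 / (2 * M\<^sup>2)"
proof -
  define d where "d = e\<^sup>2 / (8 * M)"
  define u v where "u = Re z" and "v = Im z"
  have M: "M > 0" using e by linarith
  have d: "d \<ge> 0" "8 * (M * d) = e\<^sup>2" using M by (simp_all add: d_def)
  have "d \<le> M"
  proof -
    have "e\<^sup>2 \<le> M\<^sup>2" using e by (intro power_mono) auto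
    then have "M * d \<le> M * M" using d(2) zero_le_power2[of M] unfolding power2_eq_square[of M] by linarith
    then show ?thesis using M by simp
  qed
  then have dd: "d\<^sup>2 \<le> M * d" using d(1) by (simp add: power2_eq_square mult_right_mono)
  have "\<bar>v\<bar> \<le> d" using Im by (simp add: v_def d_def)
  then have v2: "v\<^sup>2 \<le> d\<^sup>2" using abs_le_square_iff[of v d] d(1) by simp
  have u2: "u\<^sup>2 \<le> M\<^sup>2" using Re M by (simp add: u_def abs_le_square_iff[symmetric])
  have uv: "\<bar>u * v\<bar> \<le> M * d"
    using Im Re M d unfolding abs_mult u_def v_def by (intro mult_mono) (auto simp: d_def)
  have zz: "e\<^sup>2 \<le> u\<^sup>2 + v\<^sup>2"
    using power_mono[OF z, of 2] e by (simp add: cmod_power2 u_def v_def)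
  let ?w = "1 - z\<^sup>2 / of_real (M\<^sup>2)"
  have "Re ?w = 1 - (u\<^sup>2 - v\<^sup>2) / M\<^sup>2" "Im ?w = - (2 * (u * v)) / M\<^sup>2"
    by (simp_all add: u_def v_def Re_divide_of_real Im_divide_of_real power2_eq_square[of z] power2_eq_square[of "Re z"]
        power2_eq_square[of "Im z"] del: of_real_power)
  then have "cmod ?w \<le> \<bar>1 - (u\<^sup>2 - v\<^sup>2) / M\<^sup>2\<bar> + \<bar>2 * (u * v)\<bar> / M\<^sup>2"
    using cmod_le[of ?w] M by simp
  also have "\<bar>1 - (u\<^sup>2 - v\<^sup>2) / M\<^sup>2\<bar> = 1 - (u\<^sup>2 - v\<^sup>2) / M\<^sup>2"
  proof -
    have "u\<^sup>2 - v\<^sup>2 \<le> M\<^sup>2" using u2 zero_le_power2[of v] by linarith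
    then show ?thesis using M by simp
  qed
  also have "1 - (u\<^sup>2 - v\<^sup>2) / M\<^sup>2 + \<bar>2 * (u * v)\<bar> / M\<^sup>2 = 1 - ((u\<^sup>2 - v\<^sup>2) - 2 * \<bar>u * v\<bar>) / M\<^sup>2"
    by (simp add: abs_mult diff_divide_distrib)
  also have "\<dots> \<le> 1 - (e\<^sup>2 / 2) / M\<^sup>2"
  proof -
    have "e\<^sup>2 / 2 \<le> (u\<^sup>2 - v\<^sup>2) - 2 * \<bar>u * v\<bar>" using zz v2 dd uv d(2) by linarith
    from divide_right_mono[OF this zero_le_power2[of M]] show ?thesis by linarith
  qed
  finally show ?thesis by simp
qed

lemma hausdorff_tendstoI:
  fixes S :: "nat \<Rightarrow> 'x::metric_space set"
  assumes S: "\<And>n. compact (S n)" "\<And>n. S n \<noteq> {}" and T: "compact T" "T \<noteq> {}"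
    and upper: "\<And>e. e > 0 \<Longrightarrow> \<forall>\<^sub>F n in sequentially. \<forall>x\<in>S n. \<exists>y\<in>T. dist x y < e"
    and lower: "\<And>y e. y \<in> T \<Longrightarrow> e > 0 \<Longrightarrow> \<forall>\<^sub>F n in sequentially. \<exists>x\<in>S n. dist x y < e"
  shows "hausdorff_tendsto S T"
  unfolding hausdorff_tendsto_def
proof (intro conjI allI S T LIMSEQ_I)
  fix e :: real assume e: "e > 0"
  obtain D where D: "D \<subseteq> T" "finite D" "T \<subseteq> (\<Union>y\<in>D. ball y (e / 4))"
  proof (rule compactE_image[OF T(1), of T "\<lambda>y. ball y (e / 4)"])
    show "T \<subseteq> (\<Union>y\<in>T. ball y (e / 4))" using e by force
  qed auto
  have ev1: "\<forall>\<^sub>F n in sequentially. \<forall>y\<in>D. \<exists>x\<in>S n. dist x y < e / 4"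
    using D e by (intro eventually_ball_finite ballI lower) auto
  have ev2: "\<forall>\<^sub>F n in sequentially. \<forall>x\<in>S n. \<exists>y\<in>T. dist x y < e / 2"
    using e by (intro upper) simp
  have "\<forall>\<^sub>F n in sequentially. norm (hausdorff_dist (S n) T - 0) < e"
    using ev1 ev2
  proof eventually_elim
    fix n assume 1: "\<forall>y\<in>D. \<exists>x\<in>S n. dist x y < e / 4" and 2: "\<forall>x\<in>S n. \<exists>y\<in>T. dist x y < e / 2"
    have A: "infdist x T \<le> e / 2" if x: "x \<in> S n" for x
      using 2 x by (meson infdist_le2 less_imp_le)
    have B: "infdist y (S n) \<le> e / 2" if y: "y \<in> T" for y
    proof -
      obtain y' where y': "y' \<in> D" "dist y' y < e / 4" using D(3) y by auto
      obtain x where x: "x \<in> S n" "dist x y' < e / 4" using 1 y' by blast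
      have "dist y x < e / 2" using x y' dist_triangle[of x y y'] by (simp add: dist_commute)
      then show ?thesis using x(1) by (meson infdist_le2 less_imp_le)
    qed
    obtain x0 where x0: "x0 \<in> S n" using S(2) by blast
    have "(SUP x\<in>S n. infdist x T) \<le> e / 2" using S(2) A by (intro cSUP_least) auto
    moreover have "(SUP y\<in>T. infdist y (S n)) \<le> e / 2" using T(2) B by (intro cSUP_least) auto
    moreover have "bdd_above ((\<lambda>x. infdist x T) ` S n)" using A by (rule bdd_aboveI2)
    then have "infdist x0 T \<le> (SUP x\<in>S n. infdist x T)" by (rule cSUP_upper[OF x0])
    then have "0 \<le> (SUP x\<in>S n. infdist x T)" using infdist_nonneg[of x0 T] by linarith
    ultimately show "norm (hausdorff_dist (S n) T - 0) < e"
      using e unfolding hausdorff_dist_def by (auto simp: max_def)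
  qed
  then show "\<exists>no. \<forall>n\<ge>no. norm (hausdorff_dist (S n) T - 0) < e"
    by (simp add: eventually_sequentially)
qed

context hls
begin

lemma finite_fibre: "finite (carrier (F (enat n)))"
  using finite_index[of n] by (simp add: HLS_fibre_def HLS_subgroup_def FactGroup_def)

text \<open>The values \<open>f(n, 1)\<close> of a continuous function converge, and the trace is a contraction.\<close>

lemma tendsto_tau_ev:
  assumes a: "a \<in> carrier (Cr \<G>)"
  shows "(\<lambda>n. F.tau (enat n) (ev (enat n) a)) \<longlonglongrightarrow> F.tau \<infinity> (ev \<infinity> a)"
proof (rule LIMSEQ_I)
  fix e :: real assume e: "e > 0"
  obtain f where f: "f \<in> Cc \<G>" "nrm (Cr \<G>) (a \<ominus>\<^bsub>Cr \<G>\<^esub> embed f) < e / 3"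
    using embed_dense[OF a, of "e / 3"] e by auto
  have approx: "cmod (F.tau n (ev n a) - f (n, q n \<one>)) < e / 3" for n
  proof -
    note c = ev_closed[OF a, of n] embed_fibre_closed[OF restrict_closed[OF f(1), of n]]
    have "F.tau n (embed_fibre n (HLS_restrict n f)) = f (n, q n \<one>)"
      unfolding F.tau_const_class[OF restrict_closed[OF f(1)]] by (simp add: HLS_restrict_def q_one)
    then have "F.tau n (ev n a) - f (n, q n \<one>) = F.tau n (ev n a \<ominus>\<^bsub>Cr (\<K> n)\<^esub> embed_fibre n (HLS_restrict n f))"
      using F.tau_minus[OF c] by simp
    then show ?thesis
      using F.tau_le_nrm[OF D.minus_closed[OF c]] ev_approx(1)[OF a f, of n] by simp
  qed
  obtain M where M: "\<And>n. n \<ge> M \<Longrightarrow> cmod (f (enat n, q (enat n) \<one>) - f (\<infinity>, q \<infinity> \<one>)) < e / 3"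
    using LIMSEQ_D[OF tendsD[OF Cc_HLS_tends[OF f(1)] one_closed], of "e / 3"] e by auto
  have "norm (F.tau (enat n) (ev (enat n) a) - F.tau \<infinity> (ev \<infinity> a)) < e" if "n \<ge> M" for n
  proof -
    have "norm (x - w) < e" if "norm (x - y) < e / 3" "norm (y - z) < e / 3" "norm (w - z) < e / 3" for x y z w :: complex
      using that dist_triangle[of x w y] dist_triangle[of y w z] by (simp add: dist_norm norm_minus_commute)
    from this[OF approx M[OF that] approx] show ?thesis .
  qed
  then show "\<exists>no. \<forall>n\<ge>no. norm (F.tau (enat n) (ev (enat n) a) - F.tau \<infinity> (ev \<infinity> a)) < e" by blast
qed

lemma ev_pow: "a \<in> carrier (Cr \<G>) \<Longrightarrow> ev n (a [^]\<^bsub>Cr \<G>\<^esub> (m::nat)) = ev n a [^]\<^bsub>Cr (\<K> n)\<^esub> m"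
  by (induction m) (auto simp: ev_one ev_hom)

end

context hls_rd
begin

abbreviation sp :: "enat \<Rightarrow> (nat \<Rightarrow> enat \<times> 'a set \<Rightarrow> complex) set \<Rightarrow> complex set" where
  "sp n a \<equiv> spectrum (Cr (\<K> n)) (ev n a)"

text \<open>An inverse over \<open>\<infinity>\<close> lifts to a section, which is an approximate inverse nearby.\<close>

lemma not_in_spectrum_eventually:
  assumes a: "a \<in> carrier (Cr \<G>)" and z: "z \<notin> sp \<infinity> a"
  obtains d where "d > 0" "\<forall>\<^sub>F n in sequentially. \<forall>w\<in>ball z d. w \<notin> sp (enat n) a"
proof -
  let ?C = "Cr \<G>" and ?D = "\<lambda>n. Cr (\<K> n)"
  let ?y = "z \<odot>\<^bsub>?C\<^esub> \<one>\<^bsub>?C\<^esub> \<ominus>\<^bsub>?C\<^esub> a"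
  have y: "?y \<in> carrier ?C" using a by simp
  have evy: "ev n ?y = z \<odot>\<^bsub>?D n\<^esub> \<one>\<^bsub>?D n\<^esub> \<ominus>\<^bsub>?D n\<^esub> ev n a" for n
    using a by (simp add: ev_minus ev_hom ev_one)
  obtain r where r: "r \<in> carrier (?D \<infinity>)" "r \<otimes>\<^bsub>?D \<infinity>\<^esub> ev \<infinity> ?y = \<one>\<^bsub>?D \<infinity>\<^esub>" "ev \<infinity> ?y \<otimes>\<^bsub>?D \<infinity>\<^esub> r = \<one>\<^bsub>?D \<infinity>\<^esub>"
    using z unfolding D.spectrum_iff evy Units_def by blast
  obtain r' where r': "r' \<in> carrier ?C" "ev \<infinity> r' = r" using ev_surj[OF r(1)] .
  have small: "\<forall>\<^sub>F n in sequentially. nrm (?D (enat n)) (ev (enat n) x) < 1 / 2"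
    if x: "x \<in> carrier ?C" "ev \<infinity> x = \<zero>\<^bsub>?D \<infinity>\<^esub>" for x
    using order_tendstoD(2)[OF tendsto_nrm_ev[OF x(1)], of "1 / 2"] x(2) by (simp add: D.nrm_zero)
  have right: "\<forall>\<^sub>F n in sequentially. nrm (?D (enat n)) (ev (enat n) (?y \<otimes>\<^bsub>?C\<^esub> r' \<ominus>\<^bsub>?C\<^esub> \<one>\<^bsub>?C\<^esub>)) < 1 / 2"
    by (rule small) (use y r r' in \<open>simp_all add: ev_minus ev_hom(2) ev_one D.minus_eq D.r_neg\<close>)
  have left: "\<forall>\<^sub>F n in sequentially. nrm (?D (enat n)) (ev (enat n) (r' \<otimes>\<^bsub>?C\<^esub> ?y \<ominus>\<^bsub>?C\<^esub> \<one>\<^bsub>?C\<^esub>)) < 1 / 2"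
    by (rule small) (use y r r' in \<open>simp_all add: ev_minus ev_hom(2) ev_one D.minus_eq D.r_neg\<close>)
  define d where "d = 1 / (2 * (nrm ?C r' + 1))"
  have R: "nrm ?C r' + 1 > 0" using C.nrm_nonneg[OF r'(1)] by linarith
  from right left have "\<forall>\<^sub>F n in sequentially. \<forall>w\<in>ball z d. w \<notin> sp (enat n) a"
  proof eventually_elim
    fix n
    assume 1: "nrm (?D (enat n)) (ev (enat n) (?y \<otimes>\<^bsub>?C\<^esub> r' \<ominus>\<^bsub>?C\<^esub> \<one>\<^bsub>?C\<^esub>)) < 1 / 2"
      and 2: "nrm (?D (enat n)) (ev (enat n) (r' \<otimes>\<^bsub>?C\<^esub> ?y \<ominus>\<^bsub>?C\<^esub> \<one>\<^bsub>?C\<^esub>)) < 1 / 2"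
    show "\<forall>w\<in>ball z d. w \<notin> sp (enat n) a"
    proof
      fix w assume "w \<in> ball z d"
      then have w: "cmod (w - z) < d" by (simp add: dist_norm norm_minus_commute)
      show "w \<notin> sp (enat n) a"
      proof (rule D.not_in_spectrum_near[OF ev_closed[OF a] ev_closed[OF r'(1)]])
        show "nrm (?D (enat n)) ((z \<odot>\<^bsub>?D (enat n)\<^esub> \<one>\<^bsub>?D (enat n)\<^esub> \<ominus>\<^bsub>?D (enat n)\<^esub> ev (enat n) a)
            \<otimes>\<^bsub>?D (enat n)\<^esub> ev (enat n) r' \<ominus>\<^bsub>?D (enat n)\<^esub> \<one>\<^bsub>?D (enat n)\<^esub>) \<le> 1 / 2"
          using 1 y r' unfolding evy[symmetric] by (simp add: ev_minus ev_hom(2) ev_one)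
        show "nrm (?D (enat n)) (ev (enat n) r' \<otimes>\<^bsub>?D (enat n)\<^esub> (z \<odot>\<^bsub>?D (enat n)\<^esub> \<one>\<^bsub>?D (enat n)\<^esub> \<ominus>\<^bsub>?D (enat n)\<^esub> ev (enat n) a)
            \<ominus>\<^bsub>?D (enat n)\<^esub> \<one>\<^bsub>?D (enat n)\<^esub>) \<le> 1 / 2"
          using 2 y r' unfolding evy[symmetric] by (simp add: ev_minus ev_hom(2) ev_one)
        have "cmod (w - z) * nrm (?D (enat n)) (ev (enat n) r') \<le> cmod (w - z) * (nrm ?C r' + 1)"
          using ev_nrm_le[OF r'(1), of "enat n"] by (intro mult_left_mono) auto
        also have "\<dots> < d * (nrm ?C r' + 1)" using w R by (rule mult_strict_right_mono)
        also have "\<dots> = 1 / 2" using R by (simp add: d_def)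
        finally show "cmod (w - z) * nrm (?D (enat n)) (ev (enat n) r') < 1 / 2" .
      qed
    qed
  qed
  moreover have "d > 0" using R by (simp add: d_def)
  ultimately show ?thesis using that by blast
qed

text \<open>Points off the spectrum at \<open>\<infinity>\<close> are off the spectra nearby, locally uniformly; the points to be excluded
  form a compact set because all spectra lie in the disc of radius \<open>\<parallel>a\<parallel>\<close>.\<close>

lemma spectrum_upper:
  assumes a: "a \<in> carrier (Cr \<G>)" and e: "e > 0"
  shows "\<forall>\<^sub>F n in sequentially. \<forall>z\<in>sp (enat n) a. \<exists>w\<in>sp \<infinity> a. dist z w < e"
proof -
  define R where "R = nrm (Cr \<G>) a"
  define W where "W = cball 0 R - (\<Union>w\<in>sp \<infinity> a. ball w e)"
  have "compact W" unfolding W_def by (intro compact_diff compact_cball open_UN ballI open_ball)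
  have "\<forall>z\<in>W. \<exists>d. d > 0 \<and> (\<forall>\<^sub>F n in sequentially. \<forall>w\<in>ball z d. w \<notin> sp (enat n) a)"
  proof
    fix z assume "z \<in> W"
    then have "z \<notin> sp \<infinity> a" using e by (auto simp: W_def)
    obtain d where "d > 0" "\<forall>\<^sub>F n in sequentially. \<forall>w\<in>ball z d. w \<notin> sp (enat n) a"
      using not_in_spectrum_eventually[OF a \<open>z \<notin> sp \<infinity> a\<close>] .
    then show "\<exists>d. d > 0 \<and> (\<forall>\<^sub>F n in sequentially. \<forall>w\<in>ball z d. w \<notin> sp (enat n) a)"
      by (intro exI[of _ d] conjI)
  qed
  from bchoice[OF this] obtain d where
    "\<forall>z\<in>W. d z > 0 \<and> (\<forall>\<^sub>F n in sequentially. \<forall>w\<in>ball z (d z). w \<notin> sp (enat n) a)" ..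
  then have d: "\<And>z. z \<in> W \<Longrightarrow> d z > 0"
      "\<And>z. z \<in> W \<Longrightarrow> \<forall>\<^sub>F n in sequentially. \<forall>w\<in>ball z (d z). w \<notin> sp (enat n) a"
    by simp_all
  obtain D where D: "D \<subseteq> W" "finite D" "W \<subseteq> (\<Union>z\<in>D. ball z (d z))"
  proof (rule compactE_image[OF \<open>compact W\<close>, of W "\<lambda>z. ball z (d z)"])
    show "W \<subseteq> (\<Union>z\<in>W. ball z (d z))" using d(1) by force
  qed auto
  have "\<forall>\<^sub>F n in sequentially. \<forall>z\<in>D. \<forall>w\<in>ball z (d z). w \<notin> sp (enat n) a"
    using D by (intro eventually_ball_finite ballI d(2)) auto
  then show ?thesis
  proof eventually_elim
    fix n assume n: "\<forall>z\<in>D. \<forall>w\<in>ball z (d z). w \<notin> sp (enat n) a"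
    show "\<forall>z\<in>sp (enat n) a. \<exists>w\<in>sp \<infinity> a. dist z w < e"
    proof (intro ballI)
      fix z assume z: "z \<in> sp (enat n) a"
      have "cmod z \<le> R"
        using D.spectrum_le_nrm[OF ev_closed[OF a] z] ev_nrm_le[OF a, of "enat n"] unfolding R_def by linarith
      moreover have "z \<notin> W" using n D(3) z by blast
      ultimately show "\<exists>w\<in>sp \<infinity> a. dist z w < e"
        by (auto simp: W_def dist_commute)
    qed
  qed
qed

text \<open>Over finite \<open>n\<close> there are eigenvalues, and these have to accumulate at the spectrum over \<open>\<infinity>\<close>.\<close>

lemma spectrum_nonempty:
  assumes a: "a \<in> carrier (Cr \<G>)"
  shows "sp n a \<noteq> {}"
proof -
  have fin: "sp (enat k) a \<noteq> {}" for k
    by (rule F.spectrum_nonempty_finite[OF finite_fibre ev_closed[OF a]])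
  show ?thesis
  proof (cases n)
    case infinity
    have "\<forall>\<^sub>F k in sequentially. \<forall>z\<in>sp (enat k) a. \<exists>w\<in>sp \<infinity> a. dist z w < 1"
      by (rule spectrum_upper[OF a]) simp
    then obtain k where "\<forall>z\<in>sp (enat k) a. \<exists>w\<in>sp \<infinity> a. dist z w < 1"
      using eventually_happens'[OF sequentially_bot] by blast
    then show ?thesis using fin[of k] infinity by blast
  qed (use fin in simp)
qed

text \<open>The elements \<open>ev n a\<close> are only asymptotically self-adjoint, and a small perturbation of a self-adjoint
  matrix of large size can move its spectrum far. Moments are robust, however. If the spectra avoid the
  disc of radius \<open>e\<close> about \<open>s\<close> for infinitely many \<open>n\<close>, then, as they also approach the real line, the
  spectrum of \<open>w = 1 - (a - s)\<^sup>2/M\<^sup>2\<close> over these \<open>n\<close> lies in the disc of radius \<open>\<rho> < 1\<close>, and the \<open>m\<close>-th moment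
  of \<open>w\<close> is at most \<open>\<rho>\<^sup>m\<close>. This bound passes to the limit for each \<open>m\<close>. There \<open>w\<close> is self-adjoint, so its
  norm is at most \<open>\<rho>\<close>, and \<open>(a - s)\<^sup>2 = M\<^sup>2 (1 - w)\<close> is invertible.\<close>

lemma spectrum_lower:
  assumes a: "a \<in> carrier (Cr \<G>)" and sa: "star (Cr (\<K> \<infinity>)) (ev \<infinity> a) = ev \<infinity> a"
    and s: "s \<in> sp \<infinity> a" and e: "e > 0"
  shows "\<forall>\<^sub>F n in sequentially. \<exists>z\<in>sp (enat n) a. dist z s < e"
proof (rule ccontr)
  assume "\<not> (\<forall>\<^sub>F n in sequentially. \<exists>z\<in>sp (enat n) a. dist z s < e)"
  then have freq: "\<exists>\<^sub>F n in sequentially. \<forall>z\<in>sp (enat n) a. e \<le> dist z s"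
    by (simp add: frequently_def not_le)
  let ?C = "Cr \<G>" and ?D = "\<lambda>n. Cr (\<K> n)"
  define M where "M = 2 * nrm ?C a + e"
  have M: "0 < M" "e \<le> M" using C.nrm_nonneg[OF a] e by (auto simp: M_def)
  define \<rho> where "\<rho> = 1 - e\<^sup>2 / (2 * M\<^sup>2)"
  have "e\<^sup>2 \<le> M\<^sup>2" using M e by (intro power_mono) auto
  then have "e\<^sup>2 < 2 * M\<^sup>2" using zero_less_power[OF M(1), of 2] by linarith
  then have \<rho>: "0 < \<rho>" "\<rho> < 1" using M e by (auto simp: \<rho>_def)
  have real: "Im z = 0" if "z \<in> sp \<infinity> a" for z
    using D.spectrum_selfadjoint_real[OF ev_closed[OF a] sa that] .
  have sR: "cmod s \<le> nrm ?C a"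
    using D.spectrum_le_nrm[OF ev_closed[OF a] s] ev_nrm_le[OF a, of \<infinity>] by linarith
  let ?x = "a \<ominus>\<^bsub>?C\<^esub> s \<odot>\<^bsub>?C\<^esub> \<one>\<^bsub>?C\<^esub>"
  let ?m = "of_real (M\<^sup>2) :: complex"
  let ?w = "\<one>\<^bsub>?C\<^esub> \<ominus>\<^bsub>?C\<^esub> inverse ?m \<odot>\<^bsub>?C\<^esub> (?x \<otimes>\<^bsub>?C\<^esub> ?x)"
  let ?X = "\<lambda>n. ev n a \<ominus>\<^bsub>?D n\<^esub> s \<odot>\<^bsub>?D n\<^esub> \<one>\<^bsub>?D n\<^esub>"
  have m0: "?m \<noteq> 0" using M by simp
  have x: "?x \<in> carrier ?C" and w: "?w \<in> carrier ?C" using a by auto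
  have evx: "ev n ?x = ?X n" for n using a by (simp add: ev_minus ev_hom ev_one)
  have evw: "ev n ?w = \<one>\<^bsub>?D n\<^esub> \<ominus>\<^bsub>?D n\<^esub> inverse ?m \<odot>\<^bsub>?D n\<^esub> (?X n \<otimes>\<^bsub>?D n\<^esub> ?X n)" for n
    unfolding evx[symmetric] using x by (simp add: ev_minus ev_hom(2,3) ev_one)
  have near: "\<forall>\<^sub>F n in sequentially. \<forall>z\<in>sp (enat n) a. \<exists>t\<in>sp \<infinity> a. dist z t < e\<^sup>2 / (8 * M)"
    using M e by (intro spectrum_upper[OF a]) auto
  have freq2: "\<exists>\<^sub>F n in sequentially. \<forall>k\<in>sp (enat n) ?w. cmod k \<le> \<rho>"
    using frequently_eventually_frequently[OF freq near]
  proof (rule frequently_elim1)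
    fix n
    assume "(\<forall>z\<in>sp (enat n) a. e \<le> dist z s) \<and> (\<forall>z\<in>sp (enat n) a. \<exists>t\<in>sp \<infinity> a. dist z t < e\<^sup>2 / (8 * M))"
    then have far: "\<And>z. z \<in> sp (enat n) a \<Longrightarrow> e \<le> dist z s"
      and close: "\<And>z. z \<in> sp (enat n) a \<Longrightarrow> \<exists>t\<in>sp \<infinity> a. dist z t < e\<^sup>2 / (8 * M)" by auto
    show "\<forall>k\<in>sp (enat n) ?w. cmod k \<le> \<rho>"
    proof
      fix k assume "k \<in> sp (enat n) ?w"
      then obtain z where z: "z \<in> sp (enat n) a" "k = 1 - (z - s)\<^sup>2 / ?m"
        unfolding evw using D.spectrum_quadratic[OF ev_closed[OF a] m0] by blast
      obtain t where t: "t \<in> sp \<infinity> a" "dist z t < e\<^sup>2 / (8 * M)" using close[OF z(1)] by blast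
      have zR: "cmod z \<le> nrm ?C a"
        using D.spectrum_le_nrm[OF ev_closed[OF a] z(1)] ev_nrm_le[OF a, of "enat n"] by linarith
      have "\<bar>Im (z - s)\<bar> = \<bar>Im (z - t)\<bar>" using real[OF s] real[OF t(1)] by simp
      also have "\<dots> \<le> cmod (z - t)" by (rule abs_Im_le_cmod)
      finally have "\<bar>Im (z - s)\<bar> \<le> e\<^sup>2 / (8 * M)" using t(2) by (simp add: dist_norm)
      moreover have "\<bar>Re (z - s)\<bar> \<le> M"
        using abs_Re_le_cmod[of "z - s"] norm_triangle_ineq4[of z s] zR sR e unfolding M_def by linarith
      moreover have "e \<le> cmod (z - s)" using far[OF z(1)] by (simp add: dist_norm)
      ultimately show "cmod k \<le> \<rho>"
        unfolding z(2) \<rho>_def using e M by (intro quadratic_estimate)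
    qed
  qed
  have "nrm (?D \<infinity>) (ev \<infinity> ?w) \<le> \<rho>"
  proof (rule F.nrm_le_by_moments[OF ev_closed[OF w] _ \<rho>(1)])
    have "star (?D \<infinity>) (?X \<infinity>) = ?X \<infinity>"
    proof -
      have "cnj s = s" using real[OF s] by (simp add: complex_eq_iff)
      then show ?thesis
        using sa ev_closed[OF a, of \<infinity>] by (simp add: D.star_minus D.star_smult D.star_one)
    qed
    then show "star (?D \<infinity>) (ev \<infinity> ?w) = ev \<infinity> ?w"
      unfolding evw using ev_closed[OF a, of \<infinity>]
      by (simp add: D.star_minus D.star_smult D.star_one D.star_mult)
    fix m :: nat
    let ?p = "?w [^]\<^bsub>?C\<^esub> m"
    have p: "?p \<in> carrier ?C" using w by simp
    have freq3: "\<exists>\<^sub>F n in sequentially. cmod (F.tau (enat n) (ev (enat n) ?p)) \<le> \<rho> ^ m"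
      using freq2
    proof (rule frequently_elim1)
      fix n assume n: "\<forall>k\<in>sp (enat n) ?w. cmod k \<le> \<rho>"
      show "cmod (F.tau (enat n) (ev (enat n) ?p)) \<le> \<rho> ^ m"
        unfolding ev_pow[OF w] by (rule F.tau_pow_bound[OF finite_fibre ev_closed[OF w]]) (use n in blast)
    qed
    have lim: "(\<lambda>n. cmod (F.tau (enat n) (ev (enat n) ?p))) \<longlonglongrightarrow> cmod (F.tau \<infinity> (ev \<infinity> ?p))"
      by (intro tendsto_norm tendsto_tau_ev p)
    have "cmod (F.tau \<infinity> (ev \<infinity> ?p)) \<le> \<rho> ^ m"
    proof (rule ccontr)
      assume "\<not> cmod (F.tau \<infinity> (ev \<infinity> ?p)) \<le> \<rho> ^ m"
      then have "\<forall>\<^sub>F n in sequentially. \<rho> ^ m < cmod (F.tau (enat n) (ev (enat n) ?p))"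
        by (intro order_tendstoD(1)[OF lim]) simp
      then have "\<not> (\<exists>\<^sub>F n in sequentially. cmod (F.tau (enat n) (ev (enat n) ?p)) \<le> \<rho> ^ m)"
        by (simp add: frequently_def not_le)
      then show False using freq3 by blast
    qed
    then show "cmod (F.tau \<infinity> (ev \<infinity> ?w [^]\<^bsub>?D \<infinity>\<^esub> m)) \<le> \<rho> ^ m"
      unfolding ev_pow[OF w] .
  qed
  then have "\<one>\<^bsub>?D \<infinity>\<^esub> \<ominus>\<^bsub>?D \<infinity>\<^esub> ev \<infinity> ?w \<in> Units (?D \<infinity>)"
    using \<rho>(2) by (intro D.neumann ev_closed w) simp
  moreover have X: "?X \<infinity> \<in> carrier (?D \<infinity>)" using ev_closed[OF a, of \<infinity>] by simp
  have "\<one>\<^bsub>?D \<infinity>\<^esub> \<ominus>\<^bsub>?D \<infinity>\<^esub> ev \<infinity> ?w = inverse ?m \<odot>\<^bsub>?D \<infinity>\<^esub> (?X \<infinity> \<otimes>\<^bsub>?D \<infinity>\<^esub> ?X \<infinity>)"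
    unfolding evw using X
    by (simp add: D.minus_eq D.minus_add D.a_assoc[symmetric] D.r_neg)
  ultimately have "?m \<odot>\<^bsub>?D \<infinity>\<^esub> (inverse ?m \<odot>\<^bsub>?D \<infinity>\<^esub> (?X \<infinity> \<otimes>\<^bsub>?D \<infinity>\<^esub> ?X \<infinity>)) \<in> Units (?D \<infinity>)"
    using D.unit_smult[OF _ m0] by simp
  moreover have "?m \<odot>\<^bsub>?D \<infinity>\<^esub> (inverse ?m \<odot>\<^bsub>?D \<infinity>\<^esub> (?X \<infinity> \<otimes>\<^bsub>?D \<infinity>\<^esub> ?X \<infinity>)) = ?X \<infinity> \<otimes>\<^bsub>?D \<infinity>\<^esub> ?X \<infinity>"
    using X m0 D.smult_smult[OF D.m_closed[OF X X], of ?m "inverse ?m"] by (simp del: of_real_power)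
  ultimately have "?X \<infinity> \<in> Units (?D \<infinity>)"
    using D.unit_from_products[OF X X X] by simp
  then have "(-1) \<odot>\<^bsub>?D \<infinity>\<^esub> ?X \<infinity> \<in> Units (?D \<infinity>)" by (rule D.unit_smult) simp
  moreover have "(-1) \<odot>\<^bsub>?D \<infinity>\<^esub> ?X \<infinity> = s \<odot>\<^bsub>?D \<infinity>\<^esub> \<one>\<^bsub>?D \<infinity>\<^esub> \<ominus>\<^bsub>?D \<infinity>\<^esub> ev \<infinity> a"
    using ev_closed[OF a, of \<infinity>] by (simp add: D.smult_minus_1 D.minus_eq D.minus_add D.a_comm)
  ultimately show False using s unfolding D.spectrum_iff by simp
qed

lemma spectrum_tendsto:
  assumes a: "a \<in> carrier (Cr \<G>)" and sa: "star (Cr (\<K> \<infinity>)) (ev \<infinity> a) = ev \<infinity> a"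
  shows "hausdorff_tendsto (\<lambda>n. sp (enat n) a) (sp \<infinity> a)"
  by (rule hausdorff_tendstoI)
    (intro D.compact_spectrum ev_closed spectrum_nonempty spectrum_upper spectrum_lower a sa; assumption)+

end

theorem proposition5p1:
  fixes G :: "('a, 'm) monoid_scheme"
    and H :: "nat \<Rightarrow> 'a set"
    and l :: "enat \<times> 'a set \<Rightarrow> real"
  assumes "group G"
    and "countable (carrier G)"
    and "\<And>n. H n \<lhd> G"
    and "\<And>n. finite (rcosets\<^bsub>G\<^esub> (H n))"
    and "\<And>n. H (Suc n) \<subseteq> H n"
    and "(\<Inter>n. H n) = {\<one>\<^bsub>G\<^esub>}"
    and "length_function (HLS G H) l"
    and "\<exists>C>0. \<exists>q>0. \<forall>f\<in>Cc (HLS G H). \<forall>n.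
           reduced_norm (HLS_group G H n) (HLS_restrict n f)
             \<le> C * norm2 (HLS_group G H n) (\<lambda>x. l (n, x)) q (HLS_restrict n f)"
  shows "rapid_decay (HLS G H) l \<and>
    continuous_field (euclidean :: enat topology) (Cr (HLS G H)) (\<lambda>n. Cr (HLS_group G H n))
      (HLS_ev G H) (HLS_action G H) \<and>
    (\<forall>a\<in>carrier (Cr (HLS_group G H \<infinity>)). \<forall>a'\<in>carrier (Cr (HLS G H)).
       star (Cr (HLS_group G H \<infinity>)) a = a \<and> HLS_ev G H \<infinity> a' = a \<longrightarrow>
       hausdorff_tendsto
         (\<lambda>n. spectrum (Cr (HLS_group G H (enat n))) (HLS_ev G H (enat n) a'))
         (spectrum (Cr (HLS_group G H \<infinity>)) a))"
proof -
  interpret hls G H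
    by (intro hls.intro hls_axioms.intro assms(1,3,4,5,6))
  interpret hls_rd G H l
  proof (intro hls_rd.intro hls_rd_axioms.intro)
    show "hls G H" by (rule hls_axioms)
    show "length_function (HLS G H) l" by (rule assms(7))
    show "\<exists>C>0. \<exists>p>0. \<forall>f\<in>Cc (HLS G H). \<forall>n.
        reduced_norm (group_groupoid (HLS_fibre G H n)) (HLS_restrict n f) \<le> C * hls.wnorm G H l p n f"
      using assms(8) unfolding HLS_group_def norm2_group .
  qed
  show ?thesis
    unfolding HLS_group_def
  proof (intro conjI ballI impI)
    show "rapid_decay (HLS G H) l" by (rule rapid_decay_HLS)
    show "continuous_field (euclidean :: enat topology) (Cr (HLS G H))
        (\<lambda>n. Cr (group_groupoid (HLS_fibre G H n))) (HLS_ev G H) (HLS_action G H)"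
      by (rule continuous_field_HLS)
    fix a a'
    assume a': "a' \<in> carrier (Cr (HLS G H))"
      and "star (Cr (group_groupoid (HLS_fibre G H \<infinity>))) a = a \<and> HLS_ev G H \<infinity> a' = a"
    then have a: "HLS_ev G H \<infinity> a' = a"
      and sa: "star (Cr (group_groupoid (HLS_fibre G H \<infinity>))) (HLS_ev G H \<infinity> a') = HLS_ev G H \<infinity> a'"
      by simp_all
    show "hausdorff_tendsto
        (\<lambda>n. spectrum (Cr (group_groupoid (HLS_fibre G H (enat n)))) (HLS_ev G H (enat n) a'))
        (spectrum (Cr (group_groupoid (HLS_fibre G H \<infinity>))) a)"
      using spectrum_tendsto[OF a' sa] unfolding a .
  qed
qed

end
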